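(* For each $p\ge 0$, the point $(p+c(p),c(p))$ belongs to $\Sigma_K$, where $c(p)>\lambda_1$ is defined by the minimax formula $$c(p)=\inf_{\gamma\in\Gamma}\ \max_{u\in\gamma([-1,1])} J_p(u).$$
   Context: Let $s\in(0,1)$, $n>2s$, and let $\Omega\subset\mathbb R^n$ be a bounded domain with Lipschitz boundary. Let $K:\mathbb R^n\setminus\{0\}\to(0,\infty)$ satisfy: (i) $mK\in L^1(\mathbb R^n)$ with $m(x)=\min\{|x|^2,1\}$; (ii) there is $\lambda>0$ with $K(x)\ge\lambda|x|^{-(n+2s)}$ for all $x\ne0$; (iii) $K(x)=K(-x)$. Put $Q=\mathbb R^{2n}\setminus((\mathbb R^n\setminus\Omega)\times(\mathbb R^n\setminus\Omega))$. Let $X$ be the space of measurable $u:\mathbb R^n\to\mathbb R$ with $u|_\Omega\in L^2(\Omega)$ and $(u(x)-u(y))\sqrt{K(x-y)}\in L^2(Q)$, and let $X_0=\{u\in X: u=0 \text{ a.e. in }\mathbb R^n\setminus\Omega\}$, a Hilbert space with norm $\|u\|_{X_0}=\left(\int_Q|u(x)-u(y)|^2K(x-y)\,dx\,dy\right)^{1/2}$. Write $u^\pm=\max(\pm u,0)$. The Fučík spectrum $\Sigma_K$ is the set of $(\alpha,\beta)\in\mathbb R^2$ for which the problem $-\mathcal L_Ku=\alpha u^+-\beta u^-$ in $\Omega$, $u=0$ in $\mathbb R^n\setminus\Omega$, has a nontrivial weak solution, where $\mathcal L_Ku(x)=\frac12\int_{\mathbb R^n}(u(x+y)+u(x-y)-2u(x))K(y)\,dy$.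 Here $u\in X_0$ is a weak solution if for all $v\in X_0$: $\int_Q(u(x)-u(y))(v(x)-v(y))K(x-y)\,dx\,dy=\alpha\int_\Omega u^+v\,dx-\beta\int_\Omega u^-v\,dx$. $\lambda_1=\inf\{\|u\|_{X_0}^2: u\in X_0,\ \int_\Omega u^2=1\}$ is the first eigenvalue; it is simple and its eigenfunctions have constant sign; $\phi_1$ denotes the associated nonnegative eigenfunction with $\int_\Omega\phi_1^2=1$. Let $\mathcal P=\{u\in X_0:\int_\Omega u^2\,dx=1\}$ with the topology of $X_0$, $J_p(u)=\|u\|_{X_0}^2-p\int_\Omega(u^+)^2\,dx$, and $\Gamma=\{\gamma\in C([-1,1],\mathcal P):\gamma(-1)=-\phi_1,\ \gamma(1)=\phi_1\}$. *)

theory Defs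
  imports "HOL-Analysis.Analysis"
begin

text \<open>
  Elements of function spaces are represented by functions on the whole of \<open>real ^ 'n\<close>, and
  equality of elements is equality almost everywhere. Double integrals are taken with respect to
  the complete Lebesgue measure on the product space: \<open>(x, y) \<mapsto> K (x - y)\<close> with \<open>K\<close> Lebesgue
  measurable need not be measurable for the (incomplete) product of the two Lebesgue measures.
\<close>

text \<open>
  Around each boundary point the set lies strictly on one side of the graph of a Lipschitz
  function. The graph is taken in the direction of a unit vector \<open>e\<close>, over the hyperplane
  orthogonal to \<open>e\<close>, which plays the role of $\mathbb{R}^{n-1}$ after a rigid motion.
\<close>
definition lipschitz_boundary :: "(real ^ 'n::finite) set \<Rightarrow> bool" where
  "lipschitz_boundary \<Omega> \<longleftrightarrow>
    (\<forall>z\<in>frontier \<Omega>. \<exists>r>0. \<exists>e g. \<exists>L::real. norm e = 1 \<and>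
       L-lipschitz_on {y. y \<bullet> e = 0} g \<and>
       \<Omega> \<inter> ball z r = {x \<in> ball z r. x \<bullet> e < g (x - (x \<bullet> e) *\<^sub>R e)})"

definition bounded_lipschitz_domain :: "(real ^ 'n::finite) set \<Rightarrow> bool" where
  "bounded_lipschitz_domain \<Omega> \<longleftrightarrow>
    open \<Omega> \<and> connected \<Omega> \<and> \<Omega> \<noteq> {} \<and> bounded \<Omega> \<and> lipschitz_boundary \<Omega>"

text \<open>The value \<open>K 0\<close> is unconstrained: the kernel lives on the punctured space.\<close>
definition admissible_kernel :: "real \<Rightarrow> (real ^ 'n::finite \<Rightarrow> real) \<Rightarrow> bool" where
  "admissible_kernel s K \<longleftrightarrow>
    (\<forall>x. x \<noteq> 0 \<longrightarrow> K x > 0) \<and>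
    integrable lebesgue (\<lambda>x. min ((norm x)\<^sup>2) 1 * K x) \<and>
    (\<exists>c>0. \<forall>x. x \<noteq> 0 \<longrightarrow> K x \<ge> c * norm x powr (- (real CARD('n) + 2 * s))) \<and>
    (\<forall>x. x \<noteq> 0 \<longrightarrow> K x = K (- x))"

definition L2_on :: "'a::euclidean_space set \<Rightarrow> ('a \<Rightarrow> real) \<Rightarrow> bool" where
  "L2_on A f \<longleftrightarrow> set_borel_measurable lebesgue A f \<and> set_integrable lebesgue A (\<lambda>x. (f x)\<^sup>2)"

definition Q_set :: "(real ^ 'n::finite) set \<Rightarrow> ((real ^ 'n) \<times> (real ^ 'n)) set" where
  "Q_set \<Omega> = UNIV - (- \<Omega>) \<times> (- \<Omega>)"

definition X_space ::
  "(real ^ 'n::finite \<Rightarrow> real) \<Rightarrow> (real ^ 'n) set \<Rightarrow> (real ^ 'n \<Rightarrow> real) set" where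
  "X_space K \<Omega> =
    {u. u \<in> borel_measurable lebesgue \<and> L2_on \<Omega> u \<and>
        L2_on (Q_set \<Omega>) (\<lambda>(x, y). (u x - u y) * sqrt (K (x - y)))}"

definition X0_space ::
  "(real ^ 'n::finite \<Rightarrow> real) \<Rightarrow> (real ^ 'n) set \<Rightarrow> (real ^ 'n \<Rightarrow> real) set" where
  "X0_space K \<Omega> = {u \<in> X_space K \<Omega>. AE x in lebesgue. x \<notin> \<Omega> \<longrightarrow> u x = 0}"

definition X0_norm ::
  "(real ^ 'n::finite \<Rightarrow> real) \<Rightarrow> (real ^ 'n) set \<Rightarrow> (real ^ 'n \<Rightarrow> real) \<Rightarrow> real" where
  "X0_norm K \<Omega> u =
    sqrt (set_lebesgue_integral lebesgue (Q_set \<Omega>) (\<lambda>(x, y). \<bar>u x - u y\<bar>\<^sup>2 * K (x - y)))"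

text \<open>
  \<open>u\<close> is a weak solution of \<open>- L\<^sub>K u = \<alpha> u\<^sup>+ - \<beta> u\<^sup>-\<close> in \<open>\<Omega>\<close>, \<open>u = 0\<close> outside \<open>\<Omega>\<close>.
\<close>
definition fucik_weak_solution ::
  "(real ^ 'n::finite \<Rightarrow> real) \<Rightarrow> (real ^ 'n) set \<Rightarrow> real \<Rightarrow> real \<Rightarrow> (real ^ 'n \<Rightarrow> real) \<Rightarrow> bool" where
  "fucik_weak_solution K \<Omega> \<alpha> \<beta> u \<longleftrightarrow>
    u \<in> X0_space K \<Omega> \<and>
    (\<forall>v\<in>X0_space K \<Omega>.
       set_lebesgue_integral lebesgue (Q_set \<Omega>)
         (\<lambda>(x, y). (u x - u y) * (v x - v y) * K (x - y)) =
       \<alpha> * set_lebesgue_integral lebesgue \<Omega> (\<lambda>x. max (u x) 0 * v x) -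
       \<beta> * set_lebesgue_integral lebesgue \<Omega> (\<lambda>x. max (- u x) 0 * v x))"

definition fucik_spectrum ::
  "(real ^ 'n::finite \<Rightarrow> real) \<Rightarrow> (real ^ 'n) set \<Rightarrow> (real \<times> real) set" where
  "fucik_spectrum K \<Omega> =
    {(\<alpha>, \<beta>). \<exists>u. fucik_weak_solution K \<Omega> \<alpha> \<beta> u \<and> \<not> (AE x in lebesgue. u x = 0)}"

definition unit_sphere ::
  "(real ^ 'n::finite \<Rightarrow> real) \<Rightarrow> (real ^ 'n) set \<Rightarrow> (real ^ 'n \<Rightarrow> real) set" where
  "unit_sphere K \<Omega> =
    {u \<in> X0_space K \<Omega>. set_lebesgue_integral lebesgue \<Omega> (\<lambda>x. (u x)\<^sup>2) = 1}"

definition first_eigenvalue :: "(real ^ 'n::finite \<Rightarrow> real) \<Rightarrow> (real ^ 'n) set \<Rightarrow> real" where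
  "first_eigenvalue K \<Omega> = (INF u\<in>unit_sphere K \<Omega>. (X0_norm K \<Omega> u)\<^sup>2)"

text \<open>
  A representative of the nonnegative, \<open>L\<^sup>2\<close>-normalised eigenfunction for the first eigenvalue.
\<close>
definition first_eigenfunction ::
  "(real ^ 'n::finite \<Rightarrow> real) \<Rightarrow> (real ^ 'n) set \<Rightarrow> (real ^ 'n \<Rightarrow> real) \<Rightarrow> bool" where
  "first_eigenfunction K \<Omega> \<phi> \<longleftrightarrow>
    \<phi> \<in> unit_sphere K \<Omega> \<and> (AE x in lebesgue. \<phi> x \<ge> 0) \<and>
    (\<forall>v\<in>X0_space K \<Omega>.
       set_lebesgue_integral lebesgue (Q_set \<Omega>)
         (\<lambda>(x, y). (\<phi> x - \<phi> y) * (v x - v y) * K (x - y)) =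
       first_eigenvalue K \<Omega> * set_lebesgue_integral lebesgue \<Omega> (\<lambda>x. \<phi> x * v x))"

definition J_functional ::
  "(real ^ 'n::finite \<Rightarrow> real) \<Rightarrow> (real ^ 'n) set \<Rightarrow> real \<Rightarrow> (real ^ 'n \<Rightarrow> real) \<Rightarrow> real" where
  "J_functional K \<Omega> p u =
    (X0_norm K \<Omega> u)\<^sup>2 - p * set_lebesgue_integral lebesgue \<Omega> (\<lambda>x. (max (u x) 0)\<^sup>2)"

text \<open>
  Paths in the sphere that are continuous for \<open>X0_norm\<close>, given by a choice of representatives;
  hence the end points are prescribed almost everywhere only.
\<close>
definition admissible_paths ::
  "(real ^ 'n::finite \<Rightarrow> real) \<Rightarrow> (real ^ 'n) set \<Rightarrow> (real ^ 'n \<Rightarrow> real) \<Rightarrow>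
    (real \<Rightarrow> real ^ 'n \<Rightarrow> real) set" where
  "admissible_paths K \<Omega> \<phi> =
    {\<gamma>. (\<forall>t\<in>{-1..1}. \<gamma> t \<in> unit_sphere K \<Omega>) \<and>
        (\<forall>t\<in>{-1..1}. ((\<lambda>r. X0_norm K \<Omega> (\<lambda>x. \<gamma> r x - \<gamma> t x)) \<longlongrightarrow> 0) (at t within {-1..1})) \<and>
        (AE x in lebesgue. \<gamma> (-1) x = - \<phi> x) \<and>
        (AE x in lebesgue. \<gamma> 1 x = \<phi> x)}"

text \<open>
  The inner maximum is written as a supremum; it is attained because \<open>J_functional\<close> is continuous
  along admissible paths and \<open>{-1..1}\<close> is compact.
\<close>
definition minimax_level ::
  "(real ^ 'n::finite \<Rightarrow> real) \<Rightarrow> (real ^ 'n) set \<Rightarrow> (real ^ 'n \<Rightarrow> real) \<Rightarrow> real \<Rightarrow> real" where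
  "minimax_level K \<Omega> \<phi> p =
    (INF \<gamma>\<in>admissible_paths K \<Omega> \<phi>. SUP u\<in>\<gamma> ` {-1..1}. J_functional K \<Omega> p u)"

end

theory Submission
  imports Defs "HOL-Complex_Analysis.Great_Picard"
begin

text \<open>
  Write \<open>energy\<close> for the bilinear form of \<open>X\<^sub>0\<close> and \<open>mass\<close> for the \<open>L\<^sup>2\<close> product on the domain. A
  critical point \<open>u\<close> at level \<open>c\<close> of \<open>J u = energy u u - p * mass u\<^sup>+ u\<^sup>+\<close> on the sphere \<open>mass u u = 1\<close>
  satisfies \<open>energy u v = p * mass u\<^sup>+ v + c * mass u v\<close>, because testing with \<open>u\<close> itself identifies
  the multiplier as \<open>J u = c\<close>. Since \<open>u = u\<^sup>+ - u\<^sup>-\<close>, this is the Fucik problem for \<open>(p + c, c)\<close>.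
  So there are two things to prove: the minimax level is critical, and it exceeds the first
  eigenvalue.

  \<^emph>\<open>The level is critical.\<close> The gradient of \<open>J\<close> along the sphere, taken with respect to \<open>energy\<close>, is
  \<open>g = u - R (p u\<^sup>+ + J u \<cdot> u)\<close>, where \<open>R\<close> represents functionals of \<open>mass\<close> by elements of \<open>X\<^sub>0\<close>
  (\<open>riesz_exists\<close>). It depends continuously on \<open>u\<close>, so that the explicit step
  \<open>u \<mapsto> (u - \<tau> g) / \<parallel>u - \<tau> g\<parallel>\<close> with a fixed small \<open>\<tau>\<close> is a continuous self-map of the sphere, and it
  lowers \<open>J\<close> by at least a multiple of \<open>energy g g\<close> (\<open>descent_decrease\<close>); the non-quadratic term has
  the right sign because \<open>t \<mapsto> (t\<^sup>+)\<^sup>2\<close> is convex. The points \<open>\<plusminus>\<phi>\<^sub>1\<close> are critical, hence fixed up to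
  null functions, and the map acts on admissible paths. It cannot push an almost optimal path below the level, so this path
  has a point of height close to the level at which the gain, and with it the gradient, is small
  (\<open>almost_critical\<close>). A sequence of such points has an \<open>L\<^sup>2\<close>-convergent subsequence, the small
  gradient turns this into convergence in \<open>X\<^sub>0\<close>, and the limit is critical (\<open>minimax_critical\<close>).

  \<^emph>\<open>The level exceeds the first eigenvalue \<open>\<lambda>\<^sub>1\<close>.\<close> Along an admissible path \<open>mass u\<^sup>+ u\<^sup>+\<close> grows
  from 0 to 1, so it takes every small value \<open>\<delta>\<close>. Splitting \<open>u\<close> into \<open>u\<^sup>+\<close> and \<open>u\<^sup>-\<close> costs energy: as
  \<open>K\<close> is bounded below on bounded sets, \<open>energy u u\<close> exceeds the sum of the energies of the two parts
  by a multiple of \<open>\<integral>u\<^sup>+ \<cdot> \<integral>u\<^sup>-\<close> (\<open>interaction\<close>). If \<open>J u\<close> were below \<open>\<lambda>\<^sub>1 + \<delta>\<close>, the energies of both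
  parts would be bounded by a multiple of their masses, and a Nash inequality (\<open>nash\<close>) would give
  \<open>\<integral>u\<^sup>+ \<ge> c \<surd>\<delta>\<close> and \<open>\<integral>u\<^sup>- \<ge> c\<close>. The interaction would then be of order \<open>\<surd>\<delta>\<close>, whereas all the other terms
  leave room for order \<open>\<delta>\<close> only. Hence \<open>J \<ge> \<lambda>\<^sub>1 + \<delta>\<close> there (\<open>level_gap\<close>).

  \<^emph>\<open>The function space.\<close> Compactness in \<open>L\<^sup>2\<close> and the Nash inequality both come from one estimate
  (\<open>cube_inequality\<close>): on a cube of side \<open>h\<close>, the squared \<open>L\<^sup>2\<close> distance of \<open>u\<close> to its mean is up to a factor
  \<open>h\<^bsup>-n\<^esup>\<close> the double integral of \<open>(u x - u y)\<^sup>2\<close>, which \<open>K x \<ge> c |x|\<^bsup>-(n+2s)\<^esup>\<close> bounds by a multiple of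
  \<open>h\<^bsup>n+2s\<^esup>\<close> times the energy.
\<close>

section \<open>Positive semidefinite forms on function spaces\<close>

text \<open>
  The carrier is a set of functions rather than a type, since \<open>X\<^sub>0\<close> depends on the kernel and on the
  domain. The forms are only semidefinite, since functions are not identified almost everywhere.
\<close>
locale form_space =
  fixes V :: "('a \<Rightarrow> real) set" and B :: "('a \<Rightarrow> real) \<Rightarrow> ('a \<Rightarrow> real) \<Rightarrow> real"
  assumes zero_mem: "(\<lambda>_. 0) \<in> V"
    and lin_mem: "f \<in> V \<Longrightarrow> g \<in> V \<Longrightarrow> (\<lambda>x. a * f x + b * g x) \<in> V"
    and form_commute: "f \<in> V \<Longrightarrow> g \<in> V \<Longrightarrow> B f g = B g f"
    and lin_left: "f \<in> V \<Longrightarrow> g \<in> V \<Longrightarrow> h \<in> V \<Longrightarrow>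
      B (\<lambda>x. a * f x + b * g x) h = a * B f h + b * B g h"
    and nonneg: "f \<in> V \<Longrightarrow> 0 \<le> B f f"
begin

lemma diff_mem: "f \<in> V \<Longrightarrow> g \<in> V \<Longrightarrow> (\<lambda>x. f x - g x) \<in> V"
  using lin_mem[of f g 1 "-1"] by simp

lemma add_mem: "f \<in> V \<Longrightarrow> g \<in> V \<Longrightarrow> (\<lambda>x. f x + g x) \<in> V"
  using lin_mem[of f g 1 1] by simp

lemma scale_mem: "f \<in> V \<Longrightarrow> (\<lambda>x. a * f x) \<in> V"
  using lin_mem[of f f a 0] by simp

lemma uminus_mem: "f \<in> V \<Longrightarrow> (\<lambda>x. - f x) \<in> V"
  using scale_mem[of f "-1"] by simp

lemmas mem = zero_mem lin_mem diff_mem add_mem scale_mem uminus_mem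

lemma lin_right:
  "f \<in> V \<Longrightarrow> g \<in> V \<Longrightarrow> h \<in> V \<Longrightarrow> B h (\<lambda>x. a * f x + b * g x) = a * B h f + b * B h g"
  using form_commute[of h "\<lambda>x. a * f x + b * g x"] by (simp add: lin_left lin_mem form_commute[of h])

lemma diff_left: "f \<in> V \<Longrightarrow> g \<in> V \<Longrightarrow> h \<in> V \<Longrightarrow> B (\<lambda>x. f x - g x) h = B f h - B g h"
  using lin_left[of f g h 1 "-1"] by simp

lemma diff_right: "f \<in> V \<Longrightarrow> g \<in> V \<Longrightarrow> h \<in> V \<Longrightarrow> B h (\<lambda>x. f x - g x) = B h f - B h g"
  using lin_right[of f g h 1 "-1"] by simp

lemma scale_left: "f \<in> V \<Longrightarrow> h \<in> V \<Longrightarrow> B (\<lambda>x. a * f x) h = a * B f h"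
  using lin_left[of f f h a 0] by simp

lemma scale_right: "f \<in> V \<Longrightarrow> h \<in> V \<Longrightarrow> B h (\<lambda>x. a * f x) = a * B h f"
  using lin_right[of f f h a 0] by simp

lemma square_lin:
  assumes "f \<in> V" "g \<in> V"
  shows "B (\<lambda>x. a * f x + b * g x) (\<lambda>x. a * f x + b * g x)
    = a\<^sup>2 * B f f + 2 * a * b * B f g + b\<^sup>2 * B g g"
  using assms by (simp add: lin_left lin_right mem form_commute[of g f] power2_eq_square algebra_simps)

lemma cauchy_schwarz:
  assumes f: "f \<in> V" and g: "g \<in> V"
  shows "(B f g)\<^sup>2 \<le> B f f * B g g"
proof -
  have q: "0 \<le> B f f + 2 * t * B f g + t\<^sup>2 * B g g" for t
    using square_lin[OF f g, of 1 t] nonneg[OF lin_mem[OF f g, of 1 t]] by simp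
  show ?thesis
  proof (cases "B g g = 0")
    case True
    have "B f g = 0"
    proof (rule ccontr)
      assume "B f g \<noteq> 0"
      then have "2 * (- (B f f + 1) / (2 * B f g)) * B f g = - (B f f + 1)" by simp
      then show False
        using q[of "- (B f f + 1) / (2 * B f g)"] True by simp
    qed
    then show ?thesis using True by simp
  next
    case False
    then have "B g g > 0" using nonneg[OF g] by linarith
    then show ?thesis
      using q[of "- B f g / B g g"] by (simp add: power2_eq_square field_simps)
  qed
qed

definition nrm :: "('a \<Rightarrow> real) \<Rightarrow> real" where
  "nrm f = sqrt (B f f)"

lemma nrm_nonneg [simp]: "f \<in> V \<Longrightarrow> 0 \<le> nrm f"
  by (simp add: nrm_def nonneg)

lemma nrm_square: "f \<in> V \<Longrightarrow> (nrm f)\<^sup>2 = B f f"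
  by (simp add: nrm_def nonneg)

lemma abs_le_nrm: "f \<in> V \<Longrightarrow> g \<in> V \<Longrightarrow> \<bar>B f g\<bar> \<le> nrm f * nrm g"
  using cauchy_schwarz[of f g]
  by (metis (no_types) nrm_def real_sqrt_abs real_sqrt_le_mono real_sqrt_mult)

lemma nrm_lin:
  assumes f: "f \<in> V" and g: "g \<in> V"
  shows "nrm (\<lambda>x. a * f x + b * g x) \<le> \<bar>a\<bar> * nrm f + \<bar>b\<bar> * nrm g"
proof (rule power2_le_imp_le)
  have "a * b * B f g \<le> \<bar>a * b\<bar> * \<bar>B f g\<bar>" by (metis abs_ge_self abs_mult)
  also have "\<dots> \<le> \<bar>a * b\<bar> * (nrm f * nrm g)" by (intro mult_left_mono abs_le_nrm f g) auto
  finally have "a * b * B f g \<le> \<bar>a\<bar> * \<bar>b\<bar> * (nrm f * nrm g)" by (simp add: abs_mult)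
  then show "(nrm (\<lambda>x. a * f x + b * g x))\<^sup>2 \<le> (\<bar>a\<bar> * nrm f + \<bar>b\<bar> * nrm g)\<^sup>2"
    using f g
    by (simp add: nrm_square mem square_lin power2_sum power_mult_distrib algebra_simps)
qed (use f g in auto)

lemma nrm_diff: "f \<in> V \<Longrightarrow> g \<in> V \<Longrightarrow> nrm (\<lambda>x. f x - g x) \<le> nrm f + nrm g"
  using nrm_lin[of f g 1 "-1"] by simp

lemma nrm_add: "f \<in> V \<Longrightarrow> g \<in> V \<Longrightarrow> nrm (\<lambda>x. f x + g x) \<le> nrm f + nrm g"
  using nrm_lin[of f g 1 1] by simp

lemma nrm_commute: "f \<in> V \<Longrightarrow> g \<in> V \<Longrightarrow> nrm (\<lambda>x. f x - g x) = nrm (\<lambda>x. g x - f x)"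
  by (simp add: nrm_def diff_left diff_right mem form_commute[of g f])

lemma nrm_triangle_rev:
  assumes f: "f \<in> V" and g: "g \<in> V"
  shows "\<bar>nrm f - nrm g\<bar> \<le> nrm (\<lambda>x. f x - g x)"
  using nrm_add[OF diff_mem[OF f g] g] nrm_add[OF diff_mem[OF g f] f] nrm_commute[OF f g]
  by simp

definition cts_path :: "(real \<Rightarrow> 'a \<Rightarrow> real) \<Rightarrow> real set \<Rightarrow> bool" where
  "cts_path \<gamma> S \<longleftrightarrow> (\<forall>t\<in>S. \<gamma> t \<in> V) \<and>
    (\<forall>t\<in>S. ((\<lambda>r. nrm (\<lambda>x. \<gamma> r x - \<gamma> t x)) \<longlongrightarrow> 0) (at t within S))"

lemma cts_path_if_le:
  assumes "\<And>t. t \<in> S \<Longrightarrow> \<gamma> t \<in> V"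
    and "\<And>t. t \<in> S \<Longrightarrow> (h t \<longlongrightarrow> 0) (at t within S)"
    and "\<And>r t. r \<in> S \<Longrightarrow> t \<in> S \<Longrightarrow> nrm (\<lambda>x. \<gamma> r x - \<gamma> t x) \<le> h t r"
  shows "cts_path \<gamma> S"
  unfolding cts_path_def
proof (intro conjI ballI assms(1))
  fix t assume t: "t \<in> S"
  have "\<forall>\<^sub>F r in at t within S. norm (nrm (\<lambda>x. \<gamma> r x - \<gamma> t x)) \<le> h t r"
    unfolding eventually_at_filter
    using assms(3)[OF _ t] assms(1) t by (intro always_eventually) (auto simp: mem)
  then show "((\<lambda>r. nrm (\<lambda>x. \<gamma> r x - \<gamma> t x)) \<longlongrightarrow> 0) (at t within S)"
    by (rule Lim_null_comparison) (rule assms(2)[OF t])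
qed

lemma cts_path_const: "f \<in> V \<Longrightarrow> cts_path (\<lambda>_. f) S"
  by (rule cts_path_if_le[where h = "\<lambda>_ _. 0"]) (auto simp: nrm_def scale_left[of f _ 0, simplified] zero_mem)

text \<open>
  Multiplying by continuous scalars is what normalisation of a path onto the sphere amounts to.
\<close>
lemma cts_path_lin:
  assumes g: "cts_path \<gamma> S" and d: "cts_path \<delta> S"
    and a: "continuous_on S a" and b: "continuous_on S b"
  shows "cts_path (\<lambda>t x. a t * \<gamma> t x + b t * \<delta> t x) S"
proof -
  have gV: "t \<in> S \<Longrightarrow> \<gamma> t \<in> V" and dV: "t \<in> S \<Longrightarrow> \<delta> t \<in> V" for t
    using g d by (auto simp: cts_path_def)
  let ?h = "\<lambda>t r. \<bar>a r\<bar> * nrm (\<lambda>x. \<gamma> r x - \<gamma> t x) + \<bar>a r - a t\<bar> * nrm (\<gamma> t)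
     + (\<bar>b r\<bar> * nrm (\<lambda>x. \<delta> r x - \<delta> t x) + \<bar>b r - b t\<bar> * nrm (\<delta> t))"
  show ?thesis
  proof (rule cts_path_if_le[where h = ?h])
    fix t assume t: "t \<in> S"
    show "(\<lambda>x. a t * \<gamma> t x + b t * \<delta> t x) \<in> V" using gV dV t mem by blast
    have la: "(a \<longlongrightarrow> a t) (at t within S)" and lb: "(b \<longlongrightarrow> b t) (at t within S)"
      using a b t by (auto simp: continuous_on_def)
    have lg: "((\<lambda>r. nrm (\<lambda>x. \<gamma> r x - \<gamma> t x)) \<longlongrightarrow> 0) (at t within S)"
      and ld: "((\<lambda>r. nrm (\<lambda>x. \<delta> r x - \<delta> t x)) \<longlongrightarrow> 0) (at t within S)"
      using g d t by (auto simp: cts_path_def)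
    have "(?h t \<longlongrightarrow> \<bar>a t\<bar> * 0 + \<bar>a t - a t\<bar> * nrm (\<gamma> t) + (\<bar>b t\<bar> * 0 + \<bar>b t - b t\<bar> * nrm (\<delta> t)))
        (at t within S)"
      by (intro tendsto_intros la lb lg ld)
    then show "(?h t \<longlongrightarrow> 0) (at t within S)" by simp
  next
    fix r t assume r: "r \<in> S" and t: "t \<in> S"
    have split: "nrm (\<lambda>x. c * f x - c' * g x) \<le> \<bar>c\<bar> * nrm (\<lambda>x. f x - g x) + \<bar>c - c'\<bar> * nrm g"
      if "f \<in> V" "g \<in> V" for f g c c'
      using nrm_lin[OF diff_mem[OF that] that(2), of c "c - c'"] by (simp add: algebra_simps)
    have "(\<lambda>x. a r * \<gamma> r x + b r * \<delta> r x - (a t * \<gamma> t x + b t * \<delta> t x))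
      = (\<lambda>x. (a r * \<gamma> r x - a t * \<gamma> t x) + (b r * \<delta> r x - b t * \<delta> t x))"
      by (simp add: algebra_simps)
    then have "nrm (\<lambda>x. a r * \<gamma> r x + b r * \<delta> r x - (a t * \<gamma> t x + b t * \<delta> t x))
      \<le> nrm (\<lambda>x. a r * \<gamma> r x - a t * \<gamma> t x) + nrm (\<lambda>x. b r * \<delta> r x - b t * \<delta> t x)"
      using nrm_add[of "\<lambda>x. a r * \<gamma> r x - a t * \<gamma> t x" "\<lambda>x. b r * \<delta> r x - b t * \<delta> t x"]
      by (simp add: gV dV r t mem)
    also have "\<dots> \<le> ?h t r"
      by (intro add_mono split gV dV r t)
    finally show "nrm (\<lambda>x. a r * \<gamma> r x + b r * \<delta> r x - (a t * \<gamma> t x + b t * \<delta> t x)) \<le> ?h t r" .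
  qed
qed

lemma continuous_on_nrm:
  assumes g: "cts_path \<gamma> S"
  shows "continuous_on S (\<lambda>t. nrm (\<gamma> t))"
  unfolding continuous_on_def
proof
  fix t assume t: "t \<in> S"
  have "\<forall>\<^sub>F r in at t within S. norm (nrm (\<gamma> r) - nrm (\<gamma> t)) \<le> nrm (\<lambda>x. \<gamma> r x - \<gamma> t x)"
    unfolding eventually_at_filter real_norm_def
    using g t by (intro always_eventually impI allI nrm_triangle_rev) (auto simp: cts_path_def)
  then have "((\<lambda>r. nrm (\<gamma> r) - nrm (\<gamma> t)) \<longlongrightarrow> 0) (at t within S)"
    by (rule Lim_null_comparison) (use g t in \<open>auto simp: cts_path_def\<close>)
  then show "((\<lambda>t. nrm (\<gamma> t)) \<longlongrightarrow> nrm (\<gamma> t)) (at t within S)"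
    by (rule LIM_zero_cancel)
qed

lemma tendsto_form:
  assumes f: "\<And>k. f k \<in> V" "g \<in> V" "v \<in> V"
    and lim: "(\<lambda>k. B (\<lambda>x. f k x - g x) (\<lambda>x. f k x - g x)) \<longlonglongrightarrow> 0"
  shows "(\<lambda>k. B (f k) v) \<longlonglongrightarrow> B g v"
proof -
  have l: "(\<lambda>k. nrm (\<lambda>x. f k x - g x)) \<longlonglongrightarrow> 0"
    using tendsto_real_sqrt[OF lim] by (simp add: nrm_def)
  have "(\<lambda>k. B (f k) v - B g v) \<longlonglongrightarrow> 0"
  proof (rule Lim_null_comparison)
    show "\<forall>\<^sub>F k in sequentially. norm (B (f k) v - B g v) \<le> nrm (\<lambda>x. f k x - g x) * nrm v"
      using abs_le_nrm[OF diff_mem[OF f(1) f(2)] f(3)] f by (auto simp: diff_left)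
    show "(\<lambda>k. nrm (\<lambda>x. f k x - g x) * nrm v) \<longlonglongrightarrow> 0"
      using tendsto_mult_right[OF l, of "nrm v"] by simp
  qed
  then show ?thesis by (rule LIM_zero_cancel)
qed

end


section \<open>Minimax on the unit sphere of a weaker form\<close>

definition pos :: "('a \<Rightarrow> real) \<Rightarrow> 'a \<Rightarrow> real" where
  "pos f = (\<lambda>x. max (f x) 0)"

lemma pos_scale: "0 \<le> a \<Longrightarrow> pos (\<lambda>x. a * f x) = (\<lambda>x. a * pos f x)"
  by (auto simp: pos_def fun_eq_iff max_def mult_le_0_iff zero_le_mult_iff)

text \<open>
  \<open>B\<close> is the energy and \<open>D\<close> the weaker form that defines the sphere. The positive part enters only
  through its \<open>D\<close>-products: \<open>pos_convex\<close> is the convexity of \<open>f \<mapsto> D (pos f) (pos f)\<close>, whose derivative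
  at \<open>f\<close> is \<open>2 * D (pos f)\<close>. The function \<open>e\<close> serves to join \<open>- \<phi>\<close> to \<open>\<phi>\<close> inside the sphere.
\<close>
locale minimax_setting = E: form_space V B + H: form_space V D
  for V :: "('a \<Rightarrow> real) set" and B D :: "('a \<Rightarrow> real) \<Rightarrow> ('a \<Rightarrow> real) \<Rightarrow> real" +
  fixes C p lam :: real and \<phi> e :: "'a \<Rightarrow> real"
  assumes C_pos: "0 < C" and p_nonneg: "0 \<le> p"
    and poincare: "f \<in> V \<Longrightarrow> D f f \<le> C * B f f"
    and null: "f \<in> V \<Longrightarrow> D f f = 0 \<Longrightarrow> B f f = 0"
    and complete: "(\<And>k::nat. F k \<in> V) \<Longrightarrow>
      (\<And>\<epsilon>. 0 < \<epsilon> \<Longrightarrow> \<exists>n. \<forall>k\<ge>n. \<forall>l\<ge>n. B (\<lambda>x. F k x - F l x) (\<lambda>x. F k x - F l x) < \<epsilon>) \<Longrightarrow>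
      \<exists>g\<in>V. (\<lambda>k. B (\<lambda>x. F k x - g x) (\<lambda>x. F k x - g x)) \<longlonglongrightarrow> 0"
    and compact: "(\<And>k::nat. F k \<in> V) \<Longrightarrow> (\<And>k. B (F k) (F k) \<le> M) \<Longrightarrow>
      \<exists>r::nat \<Rightarrow> nat. strict_mono r \<and> (\<forall>\<epsilon>>0. \<exists>n. \<forall>k\<ge>n. \<forall>l\<ge>n.
        D (\<lambda>x. F (r k) x - F (r l) x) (\<lambda>x. F (r k) x - F (r l) x) < \<epsilon>)"
    and pos_mem: "f \<in> V \<Longrightarrow> pos f \<in> V"
    and pos_self: "f \<in> V \<Longrightarrow> D (pos f) f = D (pos f) (pos f)"
    and pos_contraction: "f \<in> V \<Longrightarrow> g \<in> V \<Longrightarrow>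
      D (\<lambda>x. pos f x - pos g x) (\<lambda>x. pos f x - pos g x) \<le> D (\<lambda>x. f x - g x) (\<lambda>x. f x - g x)"
    and pos_convex: "f \<in> V \<Longrightarrow> h \<in> V \<Longrightarrow>
      D (pos f) (pos f) + 2 * D (pos f) h \<le> D (pos (\<lambda>x. f x + h x)) (pos (\<lambda>x. f x + h x))"
    and phi_mem: "\<phi> \<in> V" and phi_unit: "D \<phi> \<phi> = 1"
    and phi_pos: "v \<in> V \<Longrightarrow> D (pos \<phi>) v = D \<phi> v"
    and phi_neg: "v \<in> V \<Longrightarrow> D (pos (\<lambda>x. - \<phi> x)) v = 0"
    and phi_eigen: "v \<in> V \<Longrightarrow> B \<phi> v = lam * D \<phi> v"
    and e_mem: "e \<in> V"
    and e_indep: "D (\<lambda>x. e x - a * \<phi> x) (\<lambda>x. e x - a * \<phi> x) \<noteq> 0"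
begin

text \<open>
  A sequence minimising \<open>B v v - 2 * D f v\<close> is Cauchy by the parallelogram law. Its limit satisfies the
  Euler equation, which is obtained from the inequality between the infimum and the value at
  \<open>v k + t * u\<close> by letting \<open>k\<close> tend to infinity.
\<close>
lemma riesz_exists:
  assumes f: "f \<in> V"
  shows "\<exists>w\<in>V. \<forall>v\<in>V. B w v = D f v"
proof -
  define I where "I v = B v v - 2 * D f v" for v
  have low: "- (C * D f f) \<le> I v" if v: "v \<in> V" for v
  proof -
    have "\<bar>D f v\<bar> \<le> H.nrm f * H.nrm v" by (rule H.abs_le_nrm[OF f v])
    also have "H.nrm v \<le> sqrt (C * B v v)"
      unfolding H.nrm_def using poincare[OF v] by simp
    finally have "D f v \<le> H.nrm f * sqrt (C * B v v)"
      using H.nrm_nonneg[OF f] by (smt (verit) mult_left_mono)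
    moreover have "0 \<le> (sqrt C * H.nrm f - E.nrm v)\<^sup>2" by simp
    ultimately show ?thesis
      using C_pos f v E.nonneg[OF v]
      by (simp add: I_def power2_diff E.nrm_square H.nrm_square power_mult_distrib E.nrm_def real_sqrt_mult algebra_simps)
  qed
  define m where "m = (INF v\<in>V. I v)"
  have bdd: "bdd_below (I ` V)" using low by (auto simp: bdd_below_def)
  have m_le: "m \<le> I v" if "v \<in> V" for v
    unfolding m_def by (rule cINF_lower[OF bdd that])
  have "\<exists>v\<in>V. I v < m + 1 / Suc k" for k
  proof -
    have "\<exists>y\<in>I ` V. y < m + 1 / Suc k"
      unfolding m_def using E.zero_mem
      by (intro cInf_lessD) auto
    then show ?thesis by auto
  qed
  then obtain v where v: "\<And>k. v k \<in> V" and Iv: "\<And>k. I (v k) < m + 1 / Suc k" by metis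
  have cauchy: "B (\<lambda>x. v k x - v l x) (\<lambda>x. v k x - v l x) \<le> 2 * (1 / Suc k) + 2 * (1 / Suc l)" for k l
  proof -
    let ?w = "\<lambda>x. (1/2) * v k x + (1/2) * v l x"
    have "m \<le> I ?w" by (rule m_le) (intro E.mem v)
    moreover have "I ?w = (I (v k) + I (v l)) / 2 - B (\<lambda>x. v k x - v l x) (\<lambda>x. v k x - v l x) / 4"
      unfolding I_def E.square_lin[OF v v] H.lin_right[OF v v f]
      using v[of k] v[of l]
      by (simp add: E.diff_left E.diff_right E.mem E.form_commute[of "v l" "v k"]
          power2_eq_square field_simps)
    moreover have "y \<le> 2 * s + 2 * t"
      if "m \<le> x" "x = (a + b) / 2 - y / 4" "a < m + s" "b < m + t" for x y a b s t :: real
      using that by (simp add: field_simps)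
    ultimately show ?thesis using Iv[of k] Iv[of l] by blast
  qed
  have "\<exists>w\<in>V. (\<lambda>k. B (\<lambda>x. v k x - w x) (\<lambda>x. v k x - w x)) \<longlonglongrightarrow> 0"
  proof (rule complete[OF v])
    fix \<epsilon> :: real assume "0 < \<epsilon>"
    then obtain n where n: "1 / Suc n < \<epsilon> / 4" using nat_approx_posE by (metis zero_less_divide_iff zero_less_numeral)
    have "B (\<lambda>x. v k x - v l x) (\<lambda>x. v k x - v l x) < \<epsilon>" if "k \<ge> n" "l \<ge> n" for k l
    proof -
      have "1 / real (Suc k) \<le> 1 / Suc n" "1 / real (Suc l) \<le> 1 / Suc n"
        using that by (simp_all add: frac_le)
      then show ?thesis using cauchy[of k l] n by linarith
    qed
    then show "\<exists>n. \<forall>k\<ge>n. \<forall>l\<ge>n. B (\<lambda>x. v k x - v l x) (\<lambda>x. v k x - v l x) < \<epsilon>" by blast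
  qed
  then obtain w where w: "w \<in> V" and lim: "(\<lambda>k. B (\<lambda>x. v k x - w x) (\<lambda>x. v k x - w x)) \<longlonglongrightarrow> 0"
    by blast
  have "B w u = D f u" if u: "u \<in> V" for u
  proof -
    have var: "0 \<le> 2 * t * (B w u - D f u) + t\<^sup>2 * B u u" for t
    proof -
      have 1: "- 1 / Suc k \<le> 2 * t * (B (v k) u - D f u) + t\<^sup>2 * B u u" for k
      proof -
        have "m \<le> I (\<lambda>x. 1 * v k x + t * u x)" by (rule m_le) (intro E.mem v u)
        also have "\<dots> = I (v k) + (2 * t * (B (v k) u - D f u) + t\<^sup>2 * B u u)"
          unfolding I_def using v[of k] u f
          by (simp only: E.square_lin H.lin_right) (simp add: algebra_simps)
        finally show ?thesis using Iv[of k] by simp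
      qed
      have 2: "(\<lambda>k. - 1 / real (Suc k)) \<longlonglongrightarrow> 0"
        using tendsto_minus[OF LIMSEQ_inverse_real_of_nat] by (simp add: divide_inverse)
      have 3: "(\<lambda>k. 2 * t * (B (v k) u - D f u) + t\<^sup>2 * B u u)
          \<longlonglongrightarrow> 2 * t * (B w u - D f u) + t\<^sup>2 * B u u"
        by (intro tendsto_intros E.tendsto_form[OF v w u lim])
      show ?thesis by (rule LIMSEQ_le[OF 2 3]) (use 1 in auto)
    qed
    show ?thesis
    proof (rule ccontr)
      assume ne: "B w u \<noteq> D f u"
      define d where "d = B w u - D f u"
      \<comment> \<open>adding 1 keeps the denominator of the test parameter \<open>t = - d / b\<close> positive\<close>
      define b where "b = B u u + 1"
      have b: "b > 0" using E.nonneg[OF u] by (simp add: b_def)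
      have "0 \<le> 2 * (- d / b) * d + (- d / b)\<^sup>2 * (b - 1)"
        using var[of "- d / b"] by (simp add: d_def b_def)
      also have "\<dots> = - d\<^sup>2 / b - d\<^sup>2 / b\<^sup>2"
        using b by (simp add: power2_eq_square field_simps)
      also have "\<dots> < 0"
      proof -
        have "0 < d\<^sup>2 / b" "0 < d\<^sup>2 / b\<^sup>2" using b ne by (simp_all add: d_def)
        then show ?thesis by simp
      qed
      finally show False by simp
    qed
  qed
  with w show ?thesis by blast
qed

definition riesz :: "('a \<Rightarrow> real) \<Rightarrow> 'a \<Rightarrow> real" where
  "riesz f = (SOME w. w \<in> V \<and> (\<forall>v\<in>V. B w v = D f v))"

lemma riesz_mem: "f \<in> V \<Longrightarrow> riesz f \<in> V"
  and riesz_eq: "f \<in> V \<Longrightarrow> v \<in> V \<Longrightarrow> B (riesz f) v = D f v"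
  using someI_ex[of "\<lambda>w. w \<in> V \<and> (\<forall>v\<in>V. B w v = D f v)"] riesz_exists[of f]
  unfolding riesz_def by blast+

lemma nrm_embedding: "f \<in> V \<Longrightarrow> H.nrm f \<le> sqrt C * E.nrm f"
  unfolding H.nrm_def E.nrm_def real_sqrt_mult[symmetric] using poincare by simp

lemma riesz_lipschitz:
  assumes f: "f \<in> V" and g: "g \<in> V"
  shows "E.nrm (\<lambda>x. riesz f x - riesz g x) \<le> sqrt C * H.nrm (\<lambda>x. f x - g x)"
proof -
  let ?w = "\<lambda>x. riesz f x - riesz g x"
  have w: "?w \<in> V" by (intro E.mem riesz_mem f g)
  have "(E.nrm ?w)\<^sup>2 = D (\<lambda>x. f x - g x) ?w"
    using f g w by (simp add: E.nrm_square E.diff_left riesz_mem riesz_eq H.diff_left)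
  also have "\<dots> \<le> H.nrm (\<lambda>x. f x - g x) * H.nrm ?w"
    using H.abs_le_nrm[OF E.diff_mem[OF f g] w] by linarith
  also have "\<dots> \<le> H.nrm (\<lambda>x. f x - g x) * (sqrt C * E.nrm ?w)"
    by (intro mult_left_mono nrm_embedding w) (simp add: E.mem f g)
  finally have *: "E.nrm ?w * E.nrm ?w \<le> (sqrt C * H.nrm (\<lambda>x. f x - g x)) * E.nrm ?w"
    by (simp add: power2_eq_square algebra_simps)
  show ?thesis
  proof (cases "E.nrm ?w = 0")
    case True
    then show ?thesis using C_pos f g by (simp add: E.mem)
  next
    case False
    then have "E.nrm ?w > 0" using w by (simp add: order_less_le)
    then show ?thesis using * by simp
  qed
qed

lemma cts_path_embedding: "E.cts_path \<gamma> S \<Longrightarrow> H.cts_path \<gamma> S"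
proof (rule H.cts_path_if_le[where h = "\<lambda>t r. sqrt C * E.nrm (\<lambda>x. \<gamma> r x - \<gamma> t x)"])
  assume c: "E.cts_path \<gamma> S"
  then show "\<gamma> t \<in> V" if "t \<in> S" for t using that by (auto simp: E.cts_path_def)
  then show "H.nrm (\<lambda>x. \<gamma> r x - \<gamma> t x) \<le> sqrt C * E.nrm (\<lambda>x. \<gamma> r x - \<gamma> t x)"
    if "r \<in> S" "t \<in> S" for r t using that by (intro nrm_embedding E.mem)
  show "((\<lambda>r. sqrt C * E.nrm (\<lambda>x. \<gamma> r x - \<gamma> t x)) \<longlongrightarrow> 0) (at t within S)" if "t \<in> S" for t
    using c that tendsto_mult_right_zero by (fastforce simp: E.cts_path_def)
qed

lemma cts_path_pos:
  assumes c: "H.cts_path \<gamma> S"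
  shows "H.cts_path (\<lambda>t. pos (\<gamma> t)) S"
proof (rule H.cts_path_if_le[where h = "\<lambda>t r. H.nrm (\<lambda>x. \<gamma> r x - \<gamma> t x)"])
  have mem: "\<gamma> t \<in> V" if "t \<in> S" for t using that c by (auto simp: H.cts_path_def)
  then show "pos (\<gamma> t) \<in> V" if "t \<in> S" for t using that by (intro pos_mem)
  show "H.nrm (\<lambda>x. pos (\<gamma> r) x - pos (\<gamma> t) x) \<le> H.nrm (\<lambda>x. \<gamma> r x - \<gamma> t x)"
    if "r \<in> S" "t \<in> S" for r t
    using pos_contraction[OF mem mem] that by (simp add: H.nrm_def)
  show "((\<lambda>r. H.nrm (\<lambda>x. \<gamma> r x - \<gamma> t x)) \<longlongrightarrow> 0) (at t within S)" if "t \<in> S" for t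
    using c that by (simp add: H.cts_path_def)
qed

lemma cts_path_riesz:
  assumes c: "H.cts_path \<gamma> S"
  shows "E.cts_path (\<lambda>t. riesz (\<gamma> t)) S"
proof (rule E.cts_path_if_le[where h = "\<lambda>t r. sqrt C * H.nrm (\<lambda>x. \<gamma> r x - \<gamma> t x)"])
  have mem: "\<gamma> t \<in> V" if "t \<in> S" for t using that c by (auto simp: H.cts_path_def)
  then show "riesz (\<gamma> t) \<in> V" if "t \<in> S" for t using that by (intro riesz_mem)
  show "E.nrm (\<lambda>x. riesz (\<gamma> r) x - riesz (\<gamma> t) x) \<le> sqrt C * H.nrm (\<lambda>x. \<gamma> r x - \<gamma> t x)"
    if "r \<in> S" "t \<in> S" for r t
    using riesz_lipschitz[OF mem mem] that by blast
  show "((\<lambda>r. sqrt C * H.nrm (\<lambda>x. \<gamma> r x - \<gamma> t x)) \<longlongrightarrow> 0) (at t within S)" if "t \<in> S" for t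
    using c that tendsto_mult_right_zero by (fastforce simp: H.cts_path_def)
qed

definition J :: "('a \<Rightarrow> real) \<Rightarrow> real" where
  "J u = B u u - p * D (pos u) (pos u)"

lemma continuous_on_J:
  assumes "E.cts_path \<gamma> S"
  shows "continuous_on S (\<lambda>t. J (\<gamma> t))"
proof -
  have mem: "\<gamma> t \<in> V" if "t \<in> S" for t using that assms by (auto simp: E.cts_path_def)
  have "continuous_on S (\<lambda>t. (E.nrm (\<gamma> t))\<^sup>2 - p * (H.nrm (pos (\<gamma> t)))\<^sup>2)"
    by (intro continuous_intros E.continuous_on_nrm H.continuous_on_nrm cts_path_pos cts_path_embedding assms)
  then show ?thesis
    by (rule continuous_on_cong[THEN iffD1, rotated 2])
       (auto simp: J_def E.nrm_square H.nrm_square mem pos_mem)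
qed


definition sphere :: "('a \<Rightarrow> real) set" where
  "sphere = {u \<in> V. D u u = 1}"

text \<open>
  The part of the derivative of \<open>J\<close> that has to be represented, including the multiplier: on the
  sphere, \<open>B u v - D (force u) v\<close> is half the derivative of \<open>J - J u * D\<close> at \<open>u\<close> in direction \<open>v\<close>, and
  it vanishes for \<open>v = u\<close>.
\<close>
definition force :: "('a \<Rightarrow> real) \<Rightarrow> 'a \<Rightarrow> real" where
  "force u = (\<lambda>x. p * pos u x + J u * u x)"

definition grad :: "('a \<Rightarrow> real) \<Rightarrow> 'a \<Rightarrow> real" where
  "grad u = (\<lambda>x. u x - riesz (force u) x)"

text \<open>
  The step size: the second order terms \<open>B g g\<close> and \<open>- J u * D g g \<le> p * C * B g g\<close> of a step along \<open>- g\<close>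
  are then absorbed by half of the first order gain.
\<close>
definition rate :: real where "rate = 1 / (1 + p * C)"

definition step :: "('a \<Rightarrow> real) \<Rightarrow> 'a \<Rightarrow> real" where
  "step u = (\<lambda>x. u x - rate * grad u x)"

definition descent :: "('a \<Rightarrow> real) \<Rightarrow> 'a \<Rightarrow> real" where
  "descent u = (\<lambda>x. inverse (H.nrm (step u)) * step u x)"

lemma force_mem: "u \<in> V \<Longrightarrow> force u \<in> V"
  unfolding force_def by (intro E.mem pos_mem)

lemma grad_mem: "u \<in> V \<Longrightarrow> grad u \<in> V"
  unfolding grad_def by (intro E.mem riesz_mem force_mem)

lemma step_mem: "u \<in> V \<Longrightarrow> step u \<in> V"
  unfolding step_def by (intro E.mem grad_mem)

lemma grad_eq:
  "u \<in> V \<Longrightarrow> v \<in> V \<Longrightarrow> B (grad u) v = B u v - p * D (pos u) v - J u * D u v"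
  using riesz_eq[OF force_mem] riesz_mem[OF force_mem]
  by (simp add: grad_def E.diff_left) (simp add: force_def H.lin_left pos_mem)

lemma rate_pos: "0 < rate"
  using C_pos p_nonneg by (simp add: rate_def add_pos_nonneg)

lemma D_pos_le: 
  assumes u: "u \<in> V" shows "D (pos u) (pos u) \<le> D u u"
proof -
  have z: "pos (\<lambda>_. 0 :: real) = (\<lambda>_. 0)" by (simp add: pos_def)
  show ?thesis using pos_contraction[OF u E.zero_mem] by (simp add: z)
qed

lemma J_lower: "u \<in> sphere \<Longrightarrow> B u u - p \<le> J u"
  using D_pos_le[of u] p_nonneg mult_left_mono[of "D (pos u) (pos u)" 1 p]
  by (simp add: J_def sphere_def)

lemma J_ge: "u \<in> sphere \<Longrightarrow> - p \<le> J u"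
  using J_lower[of u] E.nonneg[of u] by (simp add: sphere_def)

lemma J_scale: "u \<in> V \<Longrightarrow> 0 \<le> a \<Longrightarrow> J (\<lambda>x. a * u x) = a\<^sup>2 * J u"
  by (simp add: J_def pos_scale E.scale_left E.scale_right H.scale_left H.scale_right E.mem pos_mem
      power2_eq_square algebra_simps)

lemma grad_orthogonal: 
  assumes u: "u \<in> sphere" shows "B (grad u) u = 0"
  using u grad_eq[of u u] pos_self[of u] by (simp add: sphere_def J_def)

lemma step_B:
  assumes u: "u \<in> sphere"
  shows "B (step u) (step u) = B u u + rate\<^sup>2 * B (grad u) (grad u)"
proof -
  have V: "u \<in> V" using u by (simp add: sphere_def)
  have "B (step u) (step u) = B (\<lambda>x. 1 * u x + (- rate) * grad u x) (\<lambda>x. 1 * u x + (- rate) * grad u x)"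
    by (simp add: step_def)
  also have "\<dots> = B u u + rate\<^sup>2 * B (grad u) (grad u)"
    unfolding E.square_lin[OF V grad_mem[OF V]]
    using grad_orthogonal[OF u] E.form_commute[OF V grad_mem[OF V]] by simp
  finally show ?thesis .
qed

text \<open>
  A step is orthogonal to \<open>u\<close>, so it cannot lose energy and does not pass through zero.
\<close>
lemma step_D_pos:
  assumes u: "u \<in> sphere"
  shows "0 < D (step u) (step u)"
proof (rule ccontr)
  have V: "u \<in> V" using u by (simp add: sphere_def)
  assume "\<not> 0 < D (step u) (step u)"
  then have "D (step u) (step u) = 0" using H.nonneg[OF step_mem[OF V]] by simp
  then have "B u u + rate\<^sup>2 * B (grad u) (grad u) = 0"
    using null[OF step_mem[OF V]] step_B[OF u] by simp
  moreover have "0 \<le> rate\<^sup>2 * B (grad u) (grad u)" using E.nonneg[OF grad_mem[OF V]] by simp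
  ultimately have "B u u = 0" using E.nonneg[OF V] by linarith
  then show False using poincare[OF V] u by (simp add: sphere_def)
qed

lemma normalise:
  assumes u: "u \<in> V" "0 < D u u"
  shows "(\<lambda>x. inverse (H.nrm u) * u x) \<in> sphere"
    and "J (\<lambda>x. inverse (H.nrm u) * u x) * D u u = J u"
proof -
  define a where "a = inverse (H.nrm u)"
  have a: "0 \<le> a" "a\<^sup>2 * D u u = 1"
    using u H.nrm_square[OF u(1)] by (auto simp: a_def power_inverse)
  have "(\<lambda>x. a * u x) \<in> sphere"
    using u a by (simp add: sphere_def H.scale_left H.scale_right E.mem power2_eq_square mult.assoc)
  moreover have "J (\<lambda>x. a * u x) * D u u = J u"
    using a u by (simp add: J_scale)
  ultimately show "(\<lambda>x. inverse (H.nrm u) * u x) \<in> sphere"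
    "J (\<lambda>x. inverse (H.nrm u) * u x) * D u u = J u"
    by (simp_all add: a_def)
qed

lemma descent_sphere:
  assumes u: "u \<in> sphere" shows "descent u \<in> sphere"
  unfolding descent_def
  by (rule normalise(1)) (use u step_mem step_D_pos in \<open>auto simp: sphere_def\<close>)

text \<open>
  Put \<open>w = u - \<tau> g\<close>. By homogeneity it suffices to bound \<open>J w - J u * D w w\<close>. Here \<open>B w w\<close> and \<open>D w w\<close> are
  expanded exactly and the positive part is estimated by convexity. The first order terms add up to
  \<open>- 2 * \<tau> * B g g\<close>, because \<open>B g g\<close> equals \<open>- p * D (pos u) g - J u * D u g\<close>, and the choice of \<open>\<tau>\<close>
  keeps half of it.
\<close>
lemma descent_decrease:
  assumes u: "u \<in> sphere"
  shows "rate * B (grad u) (grad u) \<le> (J u - J (descent u)) * D (step u) (step u)"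
proof -
  have V: "u \<in> V" and u1: "D u u = 1" using u by (auto simp: sphere_def)
  define g where "g = grad u"
  define \<tau> where "\<tau> = rate"
  have g: "g \<in> V" using grad_mem[OF V] by (simp add: g_def)
  have s: "step u = (\<lambda>x. u x + (- \<tau>) * g x)" by (simp add: step_def g_def \<tau>_def)
  have sV: "step u \<in> V" by (rule step_mem[OF V])
  have bgg: "B g g = - p * D (pos u) g - J u * D u g"
    using grad_eq[OF V g] grad_orthogonal[OF u] E.form_commute[OF V g] by (simp add: g_def)
  have Ds: "D (step u) (step u) = 1 - 2 * \<tau> * D u g + \<tau>\<^sup>2 * D g g"
    using H.square_lin[OF V g, of 1 "- \<tau>"] u1 by (simp add: s)
  have "D (pos u) (pos u) - 2 * \<tau> * D (pos u) g \<le> D (pos (step u)) (pos (step u))"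
    using pos_convex[OF V E.scale_mem[OF g, of "- \<tau>"]] H.scale_right[OF g pos_mem[OF V], of "- \<tau>"]
    by (simp add: s)
  then have pp: "p * (D (pos u) (pos u) - 2 * \<tau> * D (pos u) g) \<le> p * D (pos (step u)) (pos (step u))"
    by (intro mult_left_mono p_nonneg)
  have "- J u * (\<tau>\<^sup>2 * D g g) \<le> p * (\<tau>\<^sup>2 * D g g)"
    using J_ge[OF u] H.nonneg[OF g] by (intro mult_right_mono) auto
  also have "\<dots> \<le> p * (\<tau>\<^sup>2 * (C * B g g))"
    using poincare[OF g] p_nonneg by (intro mult_left_mono) auto
  finally have jj: "- J u * (\<tau>\<^sup>2 * D g g) \<le> p * (\<tau>\<^sup>2 * (C * B g g))" .
  have tau: "\<tau>\<^sup>2 * (1 + p * C) = \<tau>"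
  proof -
    have "1 + p * C \<noteq> 0" using C_pos p_nonneg by (smt (verit) mult_nonneg_nonneg)
    then show ?thesis unfolding \<tau>_def rate_def by (simp add: power2_eq_square)
  qed
  have "J (step u) - J u * D (step u) (step u)
    \<le> B u u + \<tau>\<^sup>2 * B g g - p * (D (pos u) (pos u) - 2 * \<tau> * D (pos u) g)
        - J u * (1 - 2 * \<tau> * D u g) + p * (\<tau>\<^sup>2 * (C * B g g))"
    using pp jj step_B[OF u] unfolding Ds by (simp add: J_def[of "step u"] g_def \<tau>_def algebra_simps)
  also have "\<dots> = (\<tau>\<^sup>2 * (1 + p * C)) * B g g - 2 * \<tau> * B g g"
    unfolding bgg by (simp add: J_def algebra_simps)
  finally have main: "J (step u) - J u * D (step u) (step u) \<le> - \<tau> * B g g"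
    by (simp add: tau)
  have "J (descent u) * D (step u) (step u) = J (step u)"
    unfolding descent_def by (rule normalise(2)[OF sV step_D_pos[OF u]])
  then show ?thesis using main by (simp add: g_def \<tau>_def algebra_simps)
qed

lemma descent_le: "u \<in> sphere \<Longrightarrow> J (descent u) \<le> J u"
proof -
  assume u: "u \<in> sphere"
  have "0 \<le> rate * B (grad u) (grad u)"
    using rate_pos E.nonneg[OF grad_mem] u by (simp add: sphere_def)
  then have "0 \<le> (J u - J (descent u)) * D (step u) (step u)"
    using descent_decrease[OF u] by linarith
  then show ?thesis using step_D_pos[OF u] by (simp add: zero_le_mult_iff)
qed

text \<open>
  The factor \<open>D (step u) (step u)\<close> in the previous estimate grows with the gradient itself; for small
  \<open>\<epsilon>\<close> that contribution is absorbed on the left.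
\<close>
lemma small_decrease_small_grad:
  assumes u: "u \<in> sphere" and "J u \<le> A" and d: "J u - J (descent u) \<le> \<epsilon>"
    and eps: "2 * \<epsilon> * C * rate \<le> 1"
  shows "B (grad u) (grad u) \<le> 2 * \<epsilon> * C * (A + p) / rate"
proof -
  have V: "u \<in> V" using u by (auto simp: sphere_def)
  define b where "b = B (grad u) (grad u)"
  have b: "0 \<le> b" using E.nonneg[OF grad_mem[OF V]] by (simp add: b_def)
  have e0: "0 \<le> \<epsilon>" using descent_le[OF u] d by simp
  have "rate * b \<le> (J u - J (descent u)) * D (step u) (step u)"
    using descent_decrease[OF u] by (simp add: b_def)
  also have "\<dots> \<le> \<epsilon> * (C * (A + p + rate\<^sup>2 * b))"
  proof (intro mult_mono d e0)
    have "D (step u) (step u) \<le> C * B (step u) (step u)" by (rule poincare[OF step_mem[OF V]])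
    also have "\<dots> \<le> C * (A + p + rate\<^sup>2 * b)"
      using step_B[OF u] J_lower[OF u] \<open>J u \<le> A\<close> C_pos by (simp add: b_def)
    finally show "D (step u) (step u) \<le> C * (A + p + rate\<^sup>2 * b)" .
  qed (use H.nonneg[OF step_mem[OF V]] in auto)
  also have "\<dots> = \<epsilon> * C * (A + p) + (2 * \<epsilon> * C * rate) * (rate * b) / 2"
    by (simp add: power2_eq_square algebra_simps)
  also have "\<dots> \<le> \<epsilon> * C * (A + p) + 1 * (rate * b) / 2"
    using mult_right_mono[OF eps, of "rate * b"] rate_pos b by simp
  finally show ?thesis using rate_pos by (simp add: b_def field_simps)
qed


definition paths :: "(real \<Rightarrow> 'a \<Rightarrow> real) set" where
  "paths = {\<gamma>. E.cts_path \<gamma> {-1..1} \<and> (\<forall>t\<in>{-1..1}. \<gamma> t \<in> sphere) \<and>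
     H.nrm (\<lambda>x. \<gamma> (-1) x - (- \<phi> x)) = 0 \<and> H.nrm (\<lambda>x. \<gamma> 1 x - \<phi> x) = 0}"

definition level :: real where
  "level = (INF \<gamma>\<in>paths. SUP u\<in>\<gamma> ` {-1..1}. J u)"

lemma descent_path:
  assumes c: "E.cts_path \<gamma> S" and s: "\<And>t. t \<in> S \<Longrightarrow> \<gamma> t \<in> sphere"
  shows "E.cts_path (\<lambda>t. descent (\<gamma> t)) S"
proof -
  have f: "H.cts_path (\<lambda>t. force (\<gamma> t)) S"
    unfolding force_def
    by (intro H.cts_path_lin cts_path_pos cts_path_embedding c continuous_on_J continuous_intros)
  have "E.cts_path (\<lambda>t x. (1 - rate) * \<gamma> t x + rate * riesz (force (\<gamma> t)) x) S"
    by (intro E.cts_path_lin cts_path_riesz f c continuous_intros)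
  then have st: "E.cts_path (\<lambda>t. step (\<gamma> t)) S"
    by (simp add: step_def grad_def algebra_simps)
  have "continuous_on S (\<lambda>t. H.nrm (step (\<gamma> t)))"
    by (intro H.continuous_on_nrm cts_path_embedding st)
  moreover have "H.nrm (step (\<gamma> t)) \<noteq> 0" if "t \<in> S" for t
    using step_D_pos[OF s[OF that]] by (simp add: H.nrm_def)
  ultimately have "continuous_on S (\<lambda>t. inverse (H.nrm (step (\<gamma> t))))"
    by (intro continuous_on_inverse) auto
  from E.cts_path_lin[OF st st this continuous_on_const[of S 0]]
  show ?thesis by (simp add: descent_def)
qed

text \<open>
  The end points of paths are prescribed only up to null functions; the forms do not see the
  difference.
\<close>
lemma null_cong:
  assumes "f \<in> V" "g \<in> V" "H.nrm (\<lambda>x. f x - g x) = 0" "v \<in> V"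
  shows "B f v = B g v" "D f v = D g v" "D (pos f) v = D (pos g) v"
proof -
  have z: "D (\<lambda>x. f x - g x) (\<lambda>x. f x - g x) = 0" using assms(3) by (simp add: H.nrm_def)
  have "B (\<lambda>x. f x - g x) (\<lambda>x. f x - g x) = 0" using null[OF E.diff_mem z] assms by blast
  then show "B f v = B g v"
    using E.abs_le_nrm[OF E.diff_mem[of f g] assms(4)] assms by (simp add: E.nrm_def E.diff_left)
  show "D f v = D g v"
    using H.abs_le_nrm[OF E.diff_mem[of f g] assms(4)] assms by (simp add: H.diff_left)
  have "D (\<lambda>x. pos f x - pos g x) (\<lambda>x. pos f x - pos g x) = 0"
    using pos_contraction[OF assms(1,2)] z H.nonneg[OF E.diff_mem[OF pos_mem pos_mem], of f g] assms
    by linarith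
  then show "D (pos f) v = D (pos g) v"
    using H.abs_le_nrm[OF E.diff_mem[OF pos_mem pos_mem] assms(4), of f g] assms
    by (simp add: H.nrm_def H.diff_left pos_mem)
qed

lemma descent_fixes_critical:
  assumes u: "u \<in> sphere" and crit: "\<And>v. v \<in> V \<Longrightarrow> B (grad u) v = 0"
  shows "H.nrm (\<lambda>x. descent u x - u x) = 0"
proof -
  have V: "u \<in> V" and u1: "D u u = 1" using u by (auto simp: sphere_def)
  have "D (grad u) (grad u) \<le> 0" using poincare[OF grad_mem[OF V]] crit[OF grad_mem[OF V]] by simp
  then have g0: "H.nrm (grad u) = 0" using H.nonneg[OF grad_mem[OF V]] by (simp add: H.nrm_def)
  have "(\<lambda>x. step u x - u x) = (\<lambda>x. (- rate) * grad u x + 0 * grad u x)" by (simp add: step_def)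
  then have "H.nrm (\<lambda>x. step u x - u x) \<le> 0"
    using H.nrm_lin[OF grad_mem[OF V] grad_mem[OF V], of "- rate" 0] g0 by simp
  then have su: "H.nrm (\<lambda>x. step u x - u x) = 0"
    using H.nrm_nonneg[OF E.diff_mem[OF step_mem[OF V] V]] by simp
  have "H.nrm (step u) = 1"
    using H.nrm_triangle_rev[OF step_mem[OF V] V] su u1 by (simp add: H.nrm_def)
  then show ?thesis using su by (simp add: descent_def)
qed

lemma ends_critical:
  assumes u: "u \<in> V" and e: "H.nrm (\<lambda>x. u x - \<phi> x) = 0 \<or> H.nrm (\<lambda>x. u x - (- \<phi> x)) = 0"
    and v: "v \<in> V"
  shows "B (grad u) v = 0"
  using e
proof
  assume a: "H.nrm (\<lambda>x. u x - \<phi> x) = 0"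
  note c = null_cong[OF u phi_mem a]
  have "D \<phi> u = 1"
    using c(2)[OF phi_mem] H.form_commute[OF u phi_mem] phi_unit by simp
  moreover have "D \<phi> (pos u) = 1"
    using c(3)[OF phi_mem] H.form_commute[OF pos_mem[OF u] phi_mem] phi_pos[OF phi_mem] phi_unit
    by simp
  ultimately have "J u = lam - p"
    using c(1)[OF u] c(3)[OF pos_mem[OF u]] phi_eigen[OF u] phi_pos[OF pos_mem[OF u]]
    by (simp add: J_def)
  then show ?thesis
    using c[OF v] by (simp add: grad_eq u v phi_eigen phi_pos left_diff_distrib)
next
  have m: "(\<lambda>x. - \<phi> x) \<in> V" by (intro E.mem phi_mem)
  have neg: "B (\<lambda>x. - \<phi> x) v = - B \<phi> v" "D (\<lambda>x. - \<phi> x) v = - D \<phi> v" if "v \<in> V" for v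
    using E.scale_left[OF phi_mem that, of "-1"] H.scale_left[OF phi_mem that, of "-1"] by simp_all
  assume a: "H.nrm (\<lambda>x. u x - (- \<phi> x)) = 0"
  note c = null_cong[OF u m a]
  have u\<phi>: "D \<phi> u = -1"
    using c(2)[OF phi_mem] H.form_commute[OF u phi_mem] phi_unit neg(2)[OF phi_mem] by simp
  have "J u = lam"
    using c[OF u] c(3)[OF pos_mem[OF u]] u
    by (simp add: J_def neg phi_eigen u\<phi> phi_neg pos_mem)
  then show ?thesis
    using c[OF v] by (simp add: grad_eq u v neg phi_eigen phi_neg)
qed

lemma descent_paths:
  assumes g: "\<gamma> \<in> paths" shows "(\<lambda>t. descent (\<gamma> t)) \<in> paths"
proof -
  have c: "E.cts_path \<gamma> {-1..1}" and s: "\<And>t. t \<in> {-1..1} \<Longrightarrow> \<gamma> t \<in> sphere"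
    and e: "H.nrm (\<lambda>x. \<gamma> (-1) x - (- \<phi> x)) = 0" "H.nrm (\<lambda>x. \<gamma> 1 x - \<phi> x) = 0"
    using g by (auto simp: paths_def)
  have fixd: "H.nrm (\<lambda>x. descent u x - w x) = 0"
    if u: "u \<in> sphere" and w: "w \<in> V" "H.nrm (\<lambda>x. u x - w x) = 0"
      and "w = \<phi> \<or> w = (\<lambda>x. - \<phi> x)" for u w
  proof -
    have V: "u \<in> V" "descent u \<in> V" using u descent_sphere[OF u] by (auto simp: sphere_def)
    have "H.nrm (\<lambda>x. descent u x - u x) = 0"
      using u ends_critical[OF V(1)] that by (intro descent_fixes_critical) auto
    then have "H.nrm (\<lambda>x. (descent u x - u x) + (u x - w x)) \<le> 0"
      using H.nrm_add[OF E.diff_mem[OF V(2) V(1)] E.diff_mem[OF V(1) w(1)]] w(2) by simp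
    then show ?thesis using H.nrm_nonneg[OF E.diff_mem[OF V(2) w(1)]] by (simp add: algebra_simps)
  qed
  show ?thesis
    unfolding paths_def mem_Collect_eq
  proof (intro conjI ballI)
    show "H.nrm (\<lambda>x. descent (\<gamma> (-1)) x - - \<phi> x) = 0"
      by (rule fixd[where w = "\<lambda>x. - \<phi> x"]) (use s e E.mem phi_mem in auto)
    show "H.nrm (\<lambda>x. descent (\<gamma> 1) x - \<phi> x) = 0"
      by (rule fixd[where w = "\<phi>"]) (use s e phi_mem in auto)
  qed (auto intro!: descent_path c s descent_sphere)
qed

text \<open>
  The polygon from \<open>- \<phi>\<close> over \<open>e\<close> to \<open>\<phi>\<close> avoids zero by independence and is projected to the sphere.
\<close>
lemma paths_nonempty: "paths \<noteq> {}"
proof -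
  let ?w = "\<lambda>t x. t * \<phi> x + (1 - \<bar>t\<bar>) * e x"
  have w: "?w t \<in> V" for t by (intro E.mem phi_mem e_mem)
  have p: "0 < D (?w t) (?w t)" for t :: real
  proof (rule ccontr)
    assume "\<not> 0 < D (?w t) (?w t)"
    then have z: "D (?w t) (?w t) = 0" using H.nonneg[OF w[of t]] by simp
    show False
    proof (cases "\<bar>t\<bar> = 1")
      case True
      then have "t\<^sup>2 = 1" by (metis one_power2 power2_abs)
      moreover have "D (?w t) (?w t) = t\<^sup>2"
        unfolding H.square_lin[OF phi_mem e_mem] using True phi_unit by simp
      ultimately show False using z by simp
    next
      case False
      define a where "a = 1 - \<bar>t\<bar>"
      have a: "a \<noteq> 0" using False by (simp add: a_def)
      have "(\<lambda>x. e x - (- t / a) * \<phi> x) = (\<lambda>x. inverse a * ?w t x)"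
        using a by (simp add: a_def[symmetric] fun_eq_iff field_simps)
      then have "D (\<lambda>x. e x - (- t / a) * \<phi> x) (\<lambda>x. e x - (- t / a) * \<phi> x) = 0"
        using z w[of t] by (simp only: H.scale_left H.scale_right E.mem)
      then show False using e_indep by blast
    qed
  qed
  have cw: "E.cts_path ?w {-1..1}"
    by (intro E.cts_path_lin E.cts_path_const phi_mem e_mem continuous_intros)
  have ne: "H.nrm (?w t) \<noteq> 0" for t using p[of t] unfolding H.nrm_def by simp
  have "continuous_on {-1..1} (\<lambda>t. inverse (H.nrm (?w t)))"
    by (intro continuous_on_inverse H.continuous_on_nrm cts_path_embedding cw ballI ne)
  from E.cts_path_lin[OF cw cw this continuous_on_const[of "{-1..1}" 0]]
  have c: "E.cts_path (\<lambda>t x. inverse (H.nrm (?w t)) * ?w t x) {-1..1}" by simp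
  have n1: "H.nrm \<phi> = 1" "H.nrm (\<lambda>x. - \<phi> x) = 1"
    using phi_unit H.scale_left[OF phi_mem E.uminus_mem[OF phi_mem], of "-1"]
      H.scale_right[OF phi_mem phi_mem, of "-1"] by (simp_all add: H.nrm_def)
  have z: "H.nrm (\<lambda>x. 0) = 0"
    using H.scale_left[OF H.zero_mem H.zero_mem, of 0] by (simp add: H.nrm_def)
  have "(\<lambda>t x. inverse (H.nrm (?w t)) * ?w t x) \<in> paths"
    unfolding paths_def
    using c normalise(1)[OF w p] n1 z by simp
  then show ?thesis by blast
qed

lemma bdd_above_path:
  assumes "\<gamma> \<in> paths" shows "bdd_above (J ` \<gamma> ` {-1..1})"
proof -
  have "compact ((\<lambda>t. J (\<gamma> t)) ` {-1..1})"
    by (intro compact_continuous_image continuous_on_J) (use assms in \<open>auto simp: paths_def\<close>)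
  then show ?thesis
    by (simp add: image_image bounded_imp_bdd_above compact_imp_bounded)
qed

lemma bdd_below_levels: "bdd_below ((\<lambda>\<gamma>. SUP u\<in>\<gamma> ` {-1..1}. J u) ` paths)"
proof (rule bdd_belowI2)
  fix \<gamma> assume g: "\<gamma> \<in> paths"
  have "- p \<le> J (\<gamma> 1)" using g J_ge by (auto simp: paths_def)
  also have "J (\<gamma> 1) \<le> (SUP u\<in>\<gamma> ` {-1..1}. J u)"
    by (rule cSUP_upper[OF _ bdd_above_path[OF g]]) auto
  finally show "- p \<le> (SUP u\<in>\<gamma> ` {-1..1}. J u)" .
qed

text \<open>
  Take a path whose maximum is below \<open>level + \<epsilon>\<close>. Its image under \<open>descent\<close> is again a path and thus
  has a point above \<open>level - \<epsilon>\<close>; the preimage of that point is as required.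
\<close>
lemma almost_critical:
  assumes eps: "0 < \<epsilon>"
  shows "\<exists>u\<in>sphere. \<bar>J u - level\<bar> < \<epsilon> \<and> J u - J (descent u) < 2 * \<epsilon>"
proof -
  have "\<exists>y \<in> (\<lambda>\<gamma>. SUP u\<in>\<gamma> ` {-1..1}. J u) ` paths. y < level + \<epsilon>"
    unfolding level_def using paths_nonempty eps by (intro cInf_lessD) auto
  then obtain \<gamma> where g: "\<gamma> \<in> paths" and up: "(SUP u\<in>\<gamma> ` {-1..1}. J u) < level + \<epsilon>" by auto
  let ?d = "\<lambda>t. descent (\<gamma> t)"
  have d: "?d \<in> paths" by (rule descent_paths[OF g])
  have "level \<le> (SUP u\<in>?d ` {-1..1}. J u)"
    unfolding level_def by (rule cINF_lower[OF bdd_below_levels d])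
  then have "level - \<epsilon> < (SUP u\<in>?d ` {-1..1}. J u)" using eps by simp
  then obtain t where t: "t \<in> {-1..1}" "level - \<epsilon> < J (?d t)"
    using less_cSUP_iff[OF _ bdd_above_path[OF d]] by auto
  have s: "\<gamma> t \<in> sphere" using g t by (auto simp: paths_def)
  have "J (\<gamma> t) < level + \<epsilon>"
    using cSUP_upper[OF _ bdd_above_path[OF g], of "\<gamma> t"] t up by simp
  then show ?thesis using descent_le[OF s] t s by (intro bexI[of _ "\<gamma> t"]) auto
qed


text \<open>
  The almost critical points are bounded in energy, so by compactness a subsequence is \<open>D\<close>-Cauchy.
  For a difference \<open>w\<close> of two of them, \<open>B w w\<close> is a sum of \<open>B (g k) w\<close>, which tends to zero with the
  gradients, and of \<open>D\<close>-products with \<open>w\<close>. Hence the subsequence is \<open>B\<close>-Cauchy as well, and the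
  approximate equation passes to the limit.
\<close>
theorem minimax_critical:
  "\<exists>u\<in>sphere. \<forall>v\<in>V. B u v = p * D (pos u) v + level * D u v"
proof -
  define c where "c = level"
  define \<epsilon> where "\<epsilon> k = 1 / real (Suc k)" for k
  have eps_pos: "0 < \<epsilon> k" for k by (simp add: \<epsilon>_def)
  have eps_lim: "\<epsilon> \<longlonglongrightarrow> 0" unfolding \<epsilon>_def using LIMSEQ_inverse_real_of_nat by (simp add: divide_inverse)
  have "\<forall>k. \<exists>u\<in>sphere. \<bar>J u - c\<bar> < \<epsilon> k \<and> J u - J (descent u) < 2 * \<epsilon> k"
    unfolding c_def using almost_critical eps_pos by blast
  then obtain U where U: "\<And>k. U k \<in> sphere" and JU: "\<And>k. \<bar>J (U k) - c\<bar> < \<epsilon> k"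
    and dec: "\<And>k. J (U k) - J (descent (U k)) < 2 * \<epsilon> k" by metis
  have UV: "U k \<in> V" and U1: "D (U k) (U k) = 1" for k using U by (auto simp: sphere_def)
  define A where "A = c + 1"
  have JA: "J (U k) \<le> A" for k
  proof -
    have "\<epsilon> k \<le> 1" by (simp add: \<epsilon>_def)
    then show ?thesis using JU[of k] by (simp add: A_def)
  qed
  define g where "g k = grad (U k)" for k
  have gV: "g k \<in> V" for k by (simp add: g_def grad_mem UV)
  have g_lim: "(\<lambda>k. B (g k) (g k)) \<longlonglongrightarrow> 0"
  proof (rule Lim_null_comparison)
    have "(\<lambda>k. 2 * (2 * \<epsilon> k) * C * rate) \<longlonglongrightarrow> 2 * (2 * 0) * C * rate"
      by (intro tendsto_intros eps_lim)
    then have "\<forall>\<^sub>F k in sequentially. 2 * (2 * \<epsilon> k) * C * rate < 1"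
      by (rule order_tendstoD) simp
    then show "\<forall>\<^sub>F k in sequentially. norm (B (g k) (g k)) \<le> 2 * (2 * \<epsilon> k) * C * (A + p) / rate"
      using small_decrease_small_grad[OF U JA less_imp_le[OF dec]] E.nonneg[OF gV]
      by (auto simp: g_def elim!: eventually_mono)
    have "(\<lambda>k. 2 * (2 * \<epsilon> k) * C * (A + p) / rate) \<longlonglongrightarrow> 2 * (2 * 0) * C * (A + p) / rate"
      using rate_pos by (intro tendsto_intros eps_lim) auto
    then show "(\<lambda>k. 2 * (2 * \<epsilon> k) * C * (A + p) / rate) \<longlonglongrightarrow> 0" by simp
  qed
  have g0: "(\<lambda>k. E.nrm (g k)) \<longlonglongrightarrow> 0"
    using tendsto_real_sqrt[OF g_lim] by (simp add: E.nrm_def)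
  have J_lim: "(\<lambda>k. J (U k)) \<longlonglongrightarrow> c"
  proof (rule LIM_zero_cancel, rule Lim_null_comparison[OF _ eps_lim])
    show "\<forall>\<^sub>F k in sequentially. norm (J (U k) - c) \<le> \<epsilon> k"
      using JU by (auto intro!: always_eventually less_imp_le)
  qed
  define M where "M = A + p"
  have BM: "B (U k) (U k) \<le> M" for k
    using J_lower[OF U[of k]] JA[of k] by (simp add: M_def)
  have NM: "E.nrm (U k) \<le> sqrt M" for k using BM[of k] by (simp add: E.nrm_def)
  obtain r :: "nat \<Rightarrow> nat" where r: "strict_mono r"
    and cau: "\<forall>e>0. \<exists>n. \<forall>k\<ge>n. \<forall>l\<ge>n.
        D (\<lambda>x. U (r k) x - U (r l) x) (\<lambda>x. U (r k) x - U (r l) x) < e"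
    using compact[of U, OF UV BM] by blast
  define L where "L = \<bar>A\<bar> + p"
  have L: "\<bar>J (U k)\<bar> \<le> L" for k using JA[of k] J_ge[OF U[of k]] p_nonneg by (auto simp: L_def)
  have diff_bound: "B (\<lambda>x. U k x - U l x) (\<lambda>x. U k x - U l x)
      \<le> 2 * sqrt M * (E.nrm (g k) + E.nrm (g l)) + 2 * (p + L) * H.nrm (\<lambda>x. U k x - U l x)" for k l
  proof -
    let ?w = "\<lambda>x. U k x - U l x"
    have w: "?w \<in> V" by (intro E.mem UV)
    have w2: "E.nrm ?w \<le> 2 * sqrt M" using E.nrm_diff[OF UV UV, of k l] NM[of k] NM[of l] by simp
    have norm_one: "H.nrm (U k) = 1" for k by (simp add: H.nrm_def U1)
    have posunit: "H.nrm (pos (U k)) \<le> 1" for k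
      using D_pos_le[OF UV] by (simp add: H.nrm_def U1)
    have E_eq: "B (U k) ?w = B (g k) ?w + p * D (pos (U k)) ?w + J (U k) * D (U k) ?w" for k
      using grad_eq[OF UV w, of k] by (simp add: g_def)
    have a: "\<bar>B (g k) ?w\<bar> \<le> E.nrm (g k) * (2 * sqrt M)" for k
      using E.abs_le_nrm[OF gV w, of k] w2 mult_left_mono[OF w2 E.nrm_nonneg[OF gV[of k]]] by linarith
    have b: "\<bar>p * D (pos (U k)) ?w\<bar> \<le> p * H.nrm ?w" for k
    proof -
      have "\<bar>D (pos (U k)) ?w\<bar> \<le> H.nrm (pos (U k)) * H.nrm ?w"
        by (rule H.abs_le_nrm[OF pos_mem[OF UV] w])
      also have "\<dots> \<le> 1 * H.nrm ?w" by (intro mult_right_mono posunit H.nrm_nonneg w)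
      finally show ?thesis using p_nonneg by (simp add: abs_mult mult_left_mono)
    qed
    have d: "\<bar>J (U k) * D (U k) ?w\<bar> \<le> L * H.nrm ?w" for k
      unfolding abs_mult using H.abs_le_nrm[OF UV w, of k] L[of k] norm_one[of k]
      by (intro mult_mono) (auto intro: order_trans[OF abs_ge_zero])
    have "B ?w ?w = B (U k) ?w - B (U l) ?w" by (rule E.diff_left[OF UV UV w])
    then have "B ?w ?w \<le> E.nrm (g k) * (2 * sqrt M) + E.nrm (g l) * (2 * sqrt M)
        + (p * H.nrm ?w + p * H.nrm ?w) + (L * H.nrm ?w + L * H.nrm ?w)"
      using a[of k] a[of l] b[of k] b[of l] d[of k] d[of l] unfolding E_eq by linarith
    then show ?thesis by (simp add: algebra_simps)
  qed
  have "\<exists>u\<in>V. (\<lambda>k. B (\<lambda>x. U (r k) x - u x) (\<lambda>x. U (r k) x - u x)) \<longlonglongrightarrow> 0"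
  proof (rule complete)
    show "U (r k) \<in> V" for k by (rule UV)
    fix e :: real assume e: "0 < e"
    define d where "d = e / (4 * sqrt M + 2 * (p + L) + 1)"
    have M0: "0 \<le> M" using BM[of 0] E.nonneg[OF UV[of 0]] by linarith
    have L0: "0 \<le> L" using L[of 0] by simp
    have den: "0 < 4 * sqrt M + 2 * (p + L) + 1"
      using M0 L0 p_nonneg by (simp add: add_nonneg_pos)
    have d: "0 < d" using e den by (simp add: d_def)
    have "\<forall>\<^sub>F k in sequentially. E.nrm (g (r k)) < d"
      using LIMSEQ_subseq_LIMSEQ[OF g0 r] d by (intro order_tendstoD(2)) (auto simp: o_def)
    then obtain n1 where n1: "\<And>k. k \<ge> n1 \<Longrightarrow> E.nrm (g (r k)) < d"
      by (auto simp: eventually_sequentially)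
    obtain n2 where n2: "\<And>k l. k \<ge> n2 \<Longrightarrow> l \<ge> n2 \<Longrightarrow>
        D (\<lambda>x. U (r k) x - U (r l) x) (\<lambda>x. U (r k) x - U (r l) x) < d\<^sup>2"
      using cau d zero_less_power by meson
    have "B (\<lambda>x. U (r k) x - U (r l) x) (\<lambda>x. U (r k) x - U (r l) x) < e"
      if k: "k \<ge> max n1 n2" and l: "l \<ge> max n1 n2" for k l
    proof -
      have h: "H.nrm (\<lambda>x. U (r k) x - U (r l) x) \<le> d"
        unfolding H.nrm_def using n2[of k l] k l d by (intro real_le_lsqrt) auto
      have "B (\<lambda>x. U (r k) x - U (r l) x) (\<lambda>x. U (r k) x - U (r l) x)
        \<le> 2 * sqrt M * (d + d) + 2 * (p + L) * d"
        using n1[of k] n1[of l] k l h M0 L0 p_nonneg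
        by (intro order_trans[OF diff_bound] add_mono mult_left_mono) auto
      also have "\<dots> = d * (4 * sqrt M + 2 * (p + L))" by (simp add: algebra_simps)
      also have "\<dots> < d * (4 * sqrt M + 2 * (p + L) + 1)" using d by simp
      also have "\<dots> = e" using den by (simp add: d_def)
      finally show ?thesis .
    qed
    then show "\<exists>n. \<forall>k\<ge>n. \<forall>l\<ge>n. B (\<lambda>x. U (r k) x - U (r l) x) (\<lambda>x. U (r k) x - U (r l) x) < e"
      by blast
  qed
  then obtain u where u: "u \<in> V"
    and lim: "(\<lambda>k. B (\<lambda>x. U (r k) x - u x) (\<lambda>x. U (r k) x - u x)) \<longlonglongrightarrow> 0" by blast
  have limD: "(\<lambda>k. D (\<lambda>x. U (r k) x - u x) (\<lambda>x. U (r k) x - u x)) \<longlonglongrightarrow> 0"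
  proof (rule Lim_null_comparison)
    show "\<forall>\<^sub>F k in sequentially. norm (D (\<lambda>x. U (r k) x - u x) (\<lambda>x. U (r k) x - u x))
        \<le> C * B (\<lambda>x. U (r k) x - u x) (\<lambda>x. U (r k) x - u x)"
      using poincare H.nonneg UV u E.mem by (auto intro!: always_eventually)
    show "(\<lambda>k. C * B (\<lambda>x. U (r k) x - u x) (\<lambda>x. U (r k) x - u x)) \<longlonglongrightarrow> 0"
      using tendsto_mult_left[OF lim, of C] by simp
  qed
  have limP: "(\<lambda>k. D (\<lambda>x. pos (U (r k)) x - pos u x) (\<lambda>x. pos (U (r k)) x - pos u x)) \<longlonglongrightarrow> 0"
  proof (rule Lim_null_comparison[OF _ limD])
    show "\<forall>\<^sub>F k in sequentially. norm (D (\<lambda>x. pos (U (r k)) x - pos u x) (\<lambda>x. pos (U (r k)) x - pos u x))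
        \<le> D (\<lambda>x. U (r k) x - u x) (\<lambda>x. U (r k) x - u x)"
      using pos_contraction[OF UV u] H.nonneg[OF E.diff_mem[OF pos_mem[OF UV] pos_mem[OF u]]]
      by (auto intro!: always_eventually)
  qed
  have nl: "(\<lambda>k. H.nrm (\<lambda>x. U (r k) x - u x)) \<longlonglongrightarrow> 0"
    using tendsto_real_sqrt[OF limD] by (simp add: H.nrm_def)
  have "(\<lambda>k. 1 - H.nrm u) \<longlonglongrightarrow> 0"
  proof (rule Lim_null_comparison[OF _ nl])
    show "\<forall>\<^sub>F k in sequentially. norm (1 - H.nrm u) \<le> H.nrm (\<lambda>x. U (r k) x - u x)"
      using H.nrm_triangle_rev[OF UV u] by (auto simp: H.nrm_def U1 intro!: always_eventually)
  qed
  then have "H.nrm u = 1" by (simp add: LIMSEQ_const_iff)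
  then have us: "u \<in> sphere" using u by (simp add: sphere_def H.nrm_def)
  have "B u v = p * D (pos u) v + c * D u v" if v: "v \<in> V" for v
  proof -
    have Jr: "(\<lambda>k. J (U (r k))) \<longlonglongrightarrow> c"
      using LIMSEQ_subseq_LIMSEQ[OF J_lim r] by (simp add: o_def)
    have "(\<lambda>k. B (U (r k)) v - p * D (pos (U (r k))) v - J (U (r k)) * D (U (r k)) v)
        \<longlonglongrightarrow> B u v - p * D (pos u) v - c * D u v"
      by (intro tendsto_intros Jr E.tendsto_form[OF _ u v lim] H.tendsto_form[OF _ u v limD]
          H.tendsto_form[OF _ _ v limP] UV pos_mem u)
    then have "(\<lambda>k. B (g (r k)) v) \<longlonglongrightarrow> B u v - p * D (pos u) v - c * D u v"
      by (simp add: g_def grad_eq UV v)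
    moreover have "(\<lambda>k. B (g (r k)) v) \<longlonglongrightarrow> 0"
    proof (rule Lim_null_comparison)
      show "\<forall>\<^sub>F k in sequentially. norm (B (g (r k)) v) \<le> E.nrm (g (r k)) * E.nrm v"
        using E.abs_le_nrm[OF gV v] by (auto intro!: always_eventually)
      show "(\<lambda>k. E.nrm (g (r k)) * E.nrm v) \<longlonglongrightarrow> 0"
        using tendsto_mult_right[OF LIMSEQ_subseq_LIMSEQ[OF g0 r], of "E.nrm v"] by (simp add: o_def)
    qed
    ultimately have "B u v - p * D (pos u) v - c * D u v = 0" using LIMSEQ_unique by blast
    then show ?thesis by simp
  qed
  then show ?thesis using us by (auto simp: c_def)
qed

text \<open>
  Every path crosses the set where \<open>D (pos u) (pos u) = \<delta>\<close>, and on that set \<open>J u \<ge> lam + \<delta>\<close>. Otherwise the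
  interaction term \<open>\<kappa> * m (pos u) * m (pos (- u))\<close> would be at most of order \<open>\<delta>\<close>, while \<open>nash\<close> bounds
  it below by a multiple of \<open>\<surd>\<delta>\<close>; the constant in \<open>\<delta>\<close> makes the two bounds incompatible.
\<close>
theorem level_gap:
  fixes m :: "('a \<Rightarrow> real) \<Rightarrow> real"
  assumes kappa: "0 < \<kappa>"
    and nash: "\<And>M. \<exists>c>0. \<forall>w\<in>V. (\<forall>x. 0 \<le> w x) \<longrightarrow> B w w \<le> M * D w w \<longrightarrow> c * D w w \<le> (m w)\<^sup>2"
    and m_nonneg: "\<And>w. w \<in> V \<Longrightarrow> (\<forall>x. 0 \<le> w x) \<Longrightarrow> 0 \<le> m w"
    and interaction: "\<And>u. u \<in> V \<Longrightarrow>
      B (pos u) (pos u) + B (pos (\<lambda>x. - u x)) (pos (\<lambda>x. - u x))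
        + \<kappa> * m (pos u) * m (pos (\<lambda>x. - u x)) \<le> B u u"
    and split: "\<And>u. u \<in> V \<Longrightarrow> D u u = D (pos u) (pos u) + D (pos (\<lambda>x. - u x)) (pos (\<lambda>x. - u x))"
    and lam: "\<And>u. u \<in> V \<Longrightarrow> lam * D u u \<le> B u u"
  shows "lam < level"
proof -
  have lam0: "0 \<le> lam" using phi_eigen[OF phi_mem] phi_unit E.nonneg[OF phi_mem] by simp
  define M where "M = p + 1 + lam"
  have M: "1 \<le> M" using lam0 p_nonneg by (simp add: M_def)
  obtain c0 where c0: "0 < c0"
    and nash': "\<And>w. w \<in> V \<Longrightarrow> \<forall>x. 0 \<le> w x \<Longrightarrow> B w w \<le> (2 * M) * D w w \<Longrightarrow> c0 * D w w \<le> (m w)\<^sup>2"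
    using nash[of "2 * M"] by blast
  define \<delta> where "\<delta> = min (1/2) (\<kappa>\<^sup>2 * c0\<^sup>2 / (4 * M\<^sup>2))"
  have \<delta>: "0 < \<delta>" "\<delta> \<le> 1/2" "\<delta> \<le> \<kappa>\<^sup>2 * c0\<^sup>2 / (4 * M\<^sup>2)"
    using kappa c0 M by (auto simp: \<delta>_def)
  have barrier: "lam + \<delta> \<le> J u" if u: "u \<in> sphere" and ud: "D (pos u) (pos u) = \<delta>" for u
  proof (rule ccontr)
    assume "\<not> lam + \<delta> \<le> J u"
    then have Bu: "B u u < lam + \<delta> + p * \<delta>" using ud by (simp add: J_def)
    have V: "u \<in> V" and u1: "D u u = 1" using u by (auto simp: sphere_def)
    define P N where "P = pos u" and "N = pos (\<lambda>x. - u x)"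
    have PV: "P \<in> V" and NV: "N \<in> V" using V by (auto simp: P_def N_def intro!: pos_mem E.mem)
    have P0: "\<forall>x. 0 \<le> P x" and N0: "\<forall>x. 0 \<le> N x" by (auto simp: P_def N_def pos_def)
    have DP: "D P P = \<delta>" using ud by (simp add: P_def)
    have DN: "D N N = 1 - \<delta>" using split[OF V] u1 DP by (simp add: P_def N_def)
    have mP: "0 \<le> m P" and mN: "0 \<le> m N" using m_nonneg PV NV P0 N0 by auto
    have BP: "0 \<le> B P P" and BN: "lam * (1 - \<delta>) \<le> B N N" "0 \<le> B N N"
      using E.nonneg PV NV lam[OF NV] DN by auto
    have int: "B P P + B N N + \<kappa> * m P * m N \<le> B u u"
      using interaction[OF V] by (simp add: P_def N_def)
    have km: "0 \<le> \<kappa> * m P * m N" using kappa mP mN by simp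
    have BM: "B P P + \<kappa> * m P * m N \<le> M * \<delta>"
      using int BN Bu by (simp add: M_def algebra_simps)
    have "M * \<delta> \<le> 2 * M * \<delta>" using M \<delta> by simp
    then have "B P P \<le> (2 * M) * D P P" using BM km DP by simp
    from nash'[OF PV P0 this] have nP: "c0 * \<delta> \<le> (m P)\<^sup>2" by (simp add: DP)
    have "B N N \<le> lam + (1 + p) * \<delta>" using int BP km Bu by (simp add: algebra_simps)
    also have "\<dots> \<le> lam + (1 + p) * 1" using \<delta> p_nonneg by (intro add_left_mono mult_left_mono) auto
    also have "\<dots> = M" by (simp add: M_def)
    also have "\<dots> \<le> (2 * M) * (1 - \<delta>)"
      using mult_left_mono[of "1/2" "1 - \<delta>" "2 * M"] M \<delta> by simp
    finally have "B N N \<le> (2 * M) * D N N" by (simp add: DN)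
    from nash'[OF NV N0 this] have "c0 * (1 - \<delta>) \<le> (m N)\<^sup>2" by (simp add: DN)
    moreover have "c0 * (1/2) \<le> c0 * (1 - \<delta>)" using c0 \<delta> by (intro mult_left_mono) auto
    ultimately have nN: "c0 / 2 \<le> (m N)\<^sup>2" by simp
    have "\<kappa>\<^sup>2 * ((c0 * \<delta>) * (c0 / 2)) \<le> \<kappa>\<^sup>2 * ((m P)\<^sup>2 * (m N)\<^sup>2)"
      using nP nN c0 \<delta> by (intro mult_left_mono mult_mono) auto
    also have "\<dots> = (\<kappa> * m P * m N)\<^sup>2" by (simp add: power_mult_distrib)
    also have "\<dots> \<le> (M * \<delta>)\<^sup>2" using BM BP km by (intro power_mono) auto
    finally have "\<delta> * (\<kappa>\<^sup>2 * c0\<^sup>2 / 2) \<le> \<delta> * (M\<^sup>2 * \<delta>)"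
      by (simp add: power2_eq_square algebra_simps)
    then have "\<kappa>\<^sup>2 * c0\<^sup>2 / 2 \<le> M\<^sup>2 * \<delta>" using \<delta>(1) by simp
    also have "\<dots> \<le> M\<^sup>2 * (\<kappa>\<^sup>2 * c0\<^sup>2 / (4 * M\<^sup>2))" using \<delta>(3) by (intro mult_left_mono) auto
    also have "\<dots> = \<kappa>\<^sup>2 * c0\<^sup>2 / 4" using M by simp
    finally have "\<kappa>\<^sup>2 * c0\<^sup>2 \<le> 0" by simp
    moreover have "0 < \<kappa>\<^sup>2 * c0\<^sup>2" using kappa c0 by simp
    ultimately show False by linarith
  qed
  have "lam + \<delta> \<le> level"
    unfolding level_def
  proof (rule cINF_greatest[OF paths_nonempty])
    fix \<gamma> assume g: "\<gamma> \<in> paths"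
    then have c: "E.cts_path \<gamma> {-1..1}" and s: "\<And>t. t \<in> {-1..1} \<Longrightarrow> \<gamma> t \<in> sphere"
      and e: "H.nrm (\<lambda>x. \<gamma> (-1) x - (- \<phi> x)) = 0" "H.nrm (\<lambda>x. \<gamma> 1 x - \<phi> x) = 0"
      by (auto simp: paths_def)
    have gV: "\<gamma> t \<in> V" if "t \<in> {-1..1}" for t using s[OF that] by (simp add: sphere_def)
    let ?f = "\<lambda>t. (H.nrm (pos (\<gamma> t)))\<^sup>2"
    have f: "?f t = D (pos (\<gamma> t)) (pos (\<gamma> t))" if "t \<in> {-1..1}" for t
      using H.nrm_square[OF pos_mem[OF gV[OF that]]] .
    have cf: "continuous_on {-1..1} ?f"
      by (intro continuous_intros H.continuous_on_nrm cts_path_pos cts_path_embedding c)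
    have m1: "\<gamma> (-1) \<in> V" and p1: "\<gamma> 1 \<in> V" using gV by auto
    have fm: "?f (-1) = 0"
      using null_cong(3)[OF m1 E.uminus_mem[OF phi_mem] e(1) pos_mem[OF m1]] f[of "-1"]
        phi_neg[OF pos_mem[OF m1]] by simp
    have fp: "?f 1 = 1"
    proof -
      have "?f 1 = D (pos \<phi>) (pos (\<gamma> 1))"
        using null_cong(3)[OF p1 phi_mem e(2) pos_mem[OF p1]] f[of 1] by simp
      also have "\<dots> = D (pos (\<gamma> 1)) \<phi>"
        using phi_pos[OF pos_mem[OF p1]] H.form_commute[OF phi_mem pos_mem[OF p1]] by simp
      also have "\<dots> = 1"
        using null_cong(3)[OF p1 phi_mem e(2) phi_mem] phi_pos[OF phi_mem] phi_unit by simp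
      finally show ?thesis .
    qed
    obtain t where t: "t \<in> {-1..1}" "?f t = \<delta>"
      using IVT'[of ?f "-1" \<delta> 1] cf fm fp \<delta> by auto
    have "lam + \<delta> \<le> J (\<gamma> t)" using barrier[OF s[OF t(1)]] f[OF t(1)] t(2) by simp
    also have "\<dots> \<le> (SUP u\<in>\<gamma> ` {-1..1}. J u)"
      by (rule cSUP_upper[OF _ bdd_above_path[OF g]]) (use t in auto)
    finally show "lam + \<delta> \<le> (SUP u\<in>\<gamma> ` {-1..1}. J u)" .
  qed
  then show ?thesis using \<delta> by simp
qed

end

section \<open>Square integrable functions\<close>

definition L2_functions :: "'a measure \<Rightarrow> ('a \<Rightarrow> real) set" where
  "L2_functions M = {f \<in> borel_measurable M. integrable M (\<lambda>x. (f x)\<^sup>2)}"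

lemma integrable_L2_mult:
  assumes "f \<in> L2_functions M" "g \<in> L2_functions M"
  shows "integrable M (\<lambda>x. f x * g x)"
proof (rule Bochner_Integration.integrable_bound)
  show "integrable M (\<lambda>x. (f x)\<^sup>2 + (g x)\<^sup>2)"
    using assms by (auto simp: L2_functions_def)
  show "(\<lambda>x. f x * g x) \<in> borel_measurable M"
    using assms by (auto simp: L2_functions_def)
  have "\<bar>a * b\<bar> \<le> a\<^sup>2 + b\<^sup>2" for a b :: real
    using sum_squares_bound[of "\<bar>a\<bar>" "\<bar>b\<bar>"] mult_nonneg_nonneg[of "\<bar>a\<bar>" "\<bar>b\<bar>"]
    by (simp only: abs_mult power2_abs) linarith
  then show "AE x in M. norm (f x * g x) \<le> norm ((f x)\<^sup>2 + (g x)\<^sup>2)" by simp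
qed

lemma L2_lin:
  assumes "f \<in> L2_functions M" "g \<in> L2_functions M"
  shows "(\<lambda>x. a * f x + b * g x) \<in> L2_functions M"
proof -
  have "(\<lambda>x. (a * f x + b * g x)\<^sup>2)
    = (\<lambda>x. a\<^sup>2 * (f x)\<^sup>2 + (2 * a * b) * (f x * g x) + b\<^sup>2 * (g x)\<^sup>2)"
    by (auto simp: power2_sum power_mult_distrib algebra_simps)
  then show ?thesis
    using assms integrable_L2_mult[OF assms] by (auto simp: L2_functions_def)
qed

lemma L2_if_abs_le:
  assumes "f \<in> L2_functions M" "g \<in> borel_measurable M" "AE x in M. \<bar>g x\<bar> \<le> \<bar>f x\<bar>"
  shows "g \<in> L2_functions M"
proof -
  have "integrable M (\<lambda>x. (g x)\<^sup>2)"
  proof (rule Bochner_Integration.integrable_bound)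
    show "integrable M (\<lambda>x. (f x)\<^sup>2)" using assms by (auto simp: L2_functions_def)
    show "AE x in M. norm ((g x)\<^sup>2) \<le> norm ((f x)\<^sup>2)"
      using assms(3) by (auto simp: abs_le_square_iff)
  qed (use assms in measurable)
  then show ?thesis using assms by (simp add: L2_functions_def)
qed

lemma form_space_L2: "form_space (L2_functions M) (\<lambda>f g. \<integral>x. f x * g x \<partial>M)"
proof
  fix f g h :: "'a \<Rightarrow> real" and a b :: real
  assume f: "f \<in> L2_functions M" and g: "g \<in> L2_functions M" and h: "h \<in> L2_functions M"
  have "(\<integral>x. (a * f x + b * g x) * h x \<partial>M) = (\<integral>x. a * (f x * h x) + b * (g x * h x) \<partial>M)"
    by (simp add: algebra_simps)
  also have "\<dots> = a * (\<integral>x. f x * h x \<partial>M) + b * (\<integral>x. g x * h x \<partial>M)"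
    using integrable_L2_mult[OF f h] integrable_L2_mult[OF g h] by simp
  finally show "(\<integral>x. (a * f x + b * g x) * h x \<partial>M)
      = a * (\<integral>x. f x * h x \<partial>M) + b * (\<integral>x. g x * h x \<partial>M)" .
next
  fix f :: "'a \<Rightarrow> real"
  show "0 \<le> (\<integral>x. f x * f x \<partial>M)" by (rule integral_nonneg_AE) simp
qed (auto simp: L2_lin mult.commute, simp add: L2_functions_def)

text \<open>
  Both forms on \<open>X\<^sub>0\<close> are \<open>L\<^sup>2\<close> products of functions that depend linearly on the argument.
\<close>
lemma form_space_pullback:
  assumes W: "form_space W G"
    and V: "(\<lambda>_. 0) \<in> V"
      "\<And>f g a b. f \<in> V \<Longrightarrow> g \<in> V \<Longrightarrow> (\<lambda>x. a * f x + b * g x) \<in> V"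
    and T: "\<And>f. f \<in> V \<Longrightarrow> T f \<in> W"
      "\<And>f g a b. f \<in> V \<Longrightarrow> g \<in> V \<Longrightarrow> T (\<lambda>x. a * f x + b * g x) = (\<lambda>z. a * T f z + b * T g z)"
  shows "form_space V (\<lambda>f g. G (T f) (T g))"
proof -
  interpret W: form_space W G by (rule W)
  show ?thesis
    by standard (auto simp: V T W.lin_left W.nonneg intro: W.form_commute)
qed

text \<open>
  Fatou's lemma in the form that is needed to identify a pointwise limit with a limit in norm.
\<close>
lemma Fatou_L2:
  assumes f: "\<And>i. f i \<in> L2_functions M" and g: "g \<in> borel_measurable M"
    and lim: "AE x in M. (\<lambda>i. f i x) \<longlonglongrightarrow> g x"
    and bound: "\<And>i. i \<ge> n \<Longrightarrow> (\<integral>x. (f i x)\<^sup>2 \<partial>M) \<le> e"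
  shows "g \<in> L2_functions M" and "(\<integral>x. (g x)\<^sup>2 \<partial>M) \<le> e"
proof -
  have e: "0 \<le> e"
    using order_trans[OF integral_nonneg_AE bound[of n]] by simp
  have fm: "f i \<in> borel_measurable M" and fi: "integrable M (\<lambda>x. (f i x)\<^sup>2)" for i
    using f by (auto simp: L2_functions_def)
  have "(\<integral>\<^sup>+x. ennreal ((g x)\<^sup>2) \<partial>M) \<le> (\<integral>\<^sup>+x. liminf (\<lambda>i. ennreal ((f i x)\<^sup>2)) \<partial>M)"
  proof (rule nn_integral_mono_AE)
    show "AE x in M. ennreal ((g x)\<^sup>2) \<le> liminf (\<lambda>i. ennreal ((f i x)\<^sup>2))"
      using lim
    proof eventually_elim
      fix x assume "(\<lambda>i. f i x) \<longlonglongrightarrow> g x"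
      then have "(\<lambda>i. ennreal ((f i x)\<^sup>2)) \<longlonglongrightarrow> ennreal ((g x)\<^sup>2)"
        by (intro tendsto_intros) auto
      then have "liminf (\<lambda>i. ennreal ((f i x)\<^sup>2)) = ennreal ((g x)\<^sup>2)"
        by (intro lim_imp_Liminf) auto
      then show "ennreal ((g x)\<^sup>2) \<le> liminf (\<lambda>i. ennreal ((f i x)\<^sup>2))" by simp
    qed
  qed
  also have "\<dots> \<le> liminf (\<lambda>i. \<integral>\<^sup>+x. ennreal ((f i x)\<^sup>2) \<partial>M)"
    using fm by (intro nn_integral_liminf) auto
  also have "\<dots> \<le> liminf (\<lambda>i::nat. ennreal e)"
  proof (rule Liminf_mono)
    show "\<forall>\<^sub>F i in sequentially. (\<integral>\<^sup>+x. ennreal ((f i x)\<^sup>2) \<partial>M) \<le> ennreal e"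
      using bound fi unfolding eventually_sequentially
      by (intro exI[of _ n]) (simp add: nn_integral_eq_integral ennreal_leI)
  qed
  also have "\<dots> = ennreal e" by (intro lim_imp_Liminf) auto
  finally have *: "(\<integral>\<^sup>+x. ennreal ((g x)\<^sup>2) \<partial>M) \<le> ennreal e" .
  have gi: "integrable M (\<lambda>x. (g x)\<^sup>2)"
    using g * by (intro integrableI_bounded) (auto simp: top_unique intro: le_less_trans)
  then show "g \<in> L2_functions M" using g by (simp add: L2_functions_def)
  show "(\<integral>x. (g x)\<^sup>2 \<partial>M) \<le> e"
    using * gi e by (simp add: nn_integral_eq_integral)
qed

section \<open>Lebesgue measure on a product space\<close>

text \<open>
  Composition with a Borel map preserves Lebesgue measurability and statements almost everywhere
  only if preimages of null sets are null. The three maps of interest on the product are the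
  projections and the difference.
\<close>
lemma lebesgue_pullback:
  fixes f :: "'a::euclidean_space \<Rightarrow> 'b::euclidean_space"
  assumes f[measurable]: "f \<in> borel_measurable borel"
    and null: "\<And>N. N \<in> null_sets lborel \<Longrightarrow> f -` N \<in> null_sets lborel"
  shows "f \<in> lebesgue \<rightarrow>\<^sub>M lebesgue"
    and "AE x in lebesgue. P x \<Longrightarrow> AE z in lebesgue. P (f z)"
proof -
  have fm: "f \<in> lebesgue \<rightarrow>\<^sub>M lborel"
    using f by (simp add: measurable_completion)
  show "f \<in> lebesgue \<rightarrow>\<^sub>M lebesgue"
  proof (rule completion.measurable_completion2[OF fm], rule subsetI)
    fix N :: "'b set" assume N: "N \<in> null_sets lborel"
    then have "f -` N \<in> null_sets lebesgue" using null[OF N] null_sets_completionI by blast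
    then show "N \<in> null_sets (distr lebesgue lborel f)"
      using N fm by (auto simp: null_sets_def emeasure_distr)
  qed
  assume "AE x in lebesgue. P x"
  then have "AE x in lborel. P x" by (simp add: AE_completion_iff)
  then obtain N where N: "N \<in> null_sets lborel" "{x. \<not> P x} \<subseteq> N"
    by (auto simp: eventually_ae_filter)
  have "AE z in lborel. P (f z)"
    using null[OF N(1)] N(2) unfolding eventually_ae_filter by (intro bexI[of _ "f -` N"]) auto
  then show "AE z in lebesgue. P (f z)" by (rule AE_completion)
qed

lemma null_fst: 
  assumes "N \<in> null_sets (lborel :: 'a::euclidean_space measure)"
  shows "fst -` N \<in> null_sets (lborel :: ('a \<times> 'b::euclidean_space) measure)"
proof -
  have N: "N \<in> sets lborel" "emeasure lborel N = 0" using assms by auto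
  have "fst -` N = N \<times> (UNIV :: 'b set)" by auto
  moreover have "emeasure (lborel \<Otimes>\<^sub>M lborel) (N \<times> (UNIV :: 'b set)) = 0"
    using N by (subst lborel.emeasure_pair_measure_Times) auto
  moreover have "N \<times> (UNIV :: 'b set) \<in> sets (lborel \<Otimes>\<^sub>M lborel)"
    by (rule pair_measureI[OF N(1)]) simp
  ultimately show ?thesis by (simp only: null_sets_def lborel_prod mem_Collect_eq)
qed

lemma null_snd: 
  assumes "N \<in> null_sets (lborel :: 'b::euclidean_space measure)"
  shows "snd -` N \<in> null_sets (lborel :: ('a::euclidean_space \<times> 'b) measure)"
proof -
  have N: "N \<in> sets lborel" "emeasure lborel N = 0" using assms by auto
  have "snd -` N = (UNIV :: 'a set) \<times> N" by auto
  moreover have "emeasure (lborel \<Otimes>\<^sub>M lborel) ((UNIV :: 'a set) \<times> N) = 0"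
    using N by (subst lborel.emeasure_pair_measure_Times) auto
  moreover have "(UNIV :: 'a set) \<times> N \<in> sets (lborel \<Otimes>\<^sub>M lborel)"
    by (rule pair_measureI[OF _ N(1)]) simp
  ultimately show ?thesis by (simp only: null_sets_def lborel_prod mem_Collect_eq)
qed

lemma null_diff: 
  assumes "N \<in> null_sets (lborel :: 'a::euclidean_space measure)"
  shows "(\<lambda>z. fst z - snd z) -` N \<in> null_sets (lborel :: ('a \<times> 'a) measure)"
proof -
  let ?A = "(\<lambda>z::'a \<times> 'a. fst z - snd z) -` N"
  have N[measurable]: "N \<in> sets borel" using assms by auto
  have "(\<lambda>z::'a \<times> 'a. fst z - snd z) \<in> borel_measurable borel"
    by (intro borel_measurable_continuous_onI continuous_intros)
  from measurable_sets[OF this N] have A: "?A \<in> sets (lborel \<Otimes>\<^sub>M lborel)"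
    unfolding lborel_prod by simp
  have "emeasure lborel ((\<lambda>x. (x, y)) -` ?A) = 0" for y
  proof -
    have "(\<lambda>x. (x, y)) -` ?A = {x. x - y \<in> N}" by auto
    then show ?thesis using null_sets_translation[OF assms, of y] by auto
  qed
  then have "emeasure (lborel \<Otimes>\<^sub>M lborel) ?A = 0"
    by (subst lborel_pair.emeasure_pair_measure_alt2[OF A]) simp
  then show ?thesis using A by (simp only: null_sets_def lborel_prod mem_Collect_eq)
qed

lemma lebesgue_fst:
  "fst \<in> (lebesgue :: ('a::euclidean_space \<times> 'b::euclidean_space) measure) \<rightarrow>\<^sub>M lebesgue"
  and AE_lebesgue_fst: "AE x in lebesgue. P x \<Longrightarrow>
    AE z in (lebesgue :: ('a \<times> 'b) measure). P (fst z)"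
  by (rule lebesgue_pullback[OF borel_measurable_continuous_onI[OF continuous_on_fst[OF continuous_on_id]] null_fst];
      simp)+

lemma lebesgue_snd:
  "snd \<in> (lebesgue :: ('a::euclidean_space \<times> 'b::euclidean_space) measure) \<rightarrow>\<^sub>M lebesgue"
  and AE_lebesgue_snd: "AE x in lebesgue. P x \<Longrightarrow>
    AE z in (lebesgue :: ('a \<times> 'b) measure). P (snd z)"
  by (rule lebesgue_pullback[OF borel_measurable_continuous_onI[OF continuous_on_snd[OF continuous_on_id]] null_snd];
      simp)+

lemma lebesgue_diff:
  "(\<lambda>z. fst z - snd z) \<in> (lebesgue :: ('a::euclidean_space \<times> 'a) measure) \<rightarrow>\<^sub>M lebesgue"
  by (rule lebesgue_pullback(1)[OF _ null_diff])
    (auto intro!: borel_measurable_continuous_onI continuous_intros)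

text \<open>
  Fubini's theorem is applied to Borel representatives, because the completed Lebesgue measure of the
  product space is not the product of the completed factors.
\<close>
lemma borel_representative:
  fixes f :: "'a::euclidean_space \<Rightarrow> real"
  assumes "integrable lebesgue f"
  obtains g where "g \<in> borel_measurable borel" "AE x in lebesgue. f x = g x"
    "integrable lborel g" "integral\<^sup>L lborel g = integral\<^sup>L lebesgue f"
proof -
  have fm: "f \<in> borel_measurable lebesgue" using assms by auto
  obtain g where g: "g \<in> borel_measurable lborel" "AE x in lborel. f x = g x"
    using completion_ex_borel_measurable_real[OF fm] by blast
  have ae: "AE x in lebesgue. f x = g x" by (rule AE_completion[OF g(2)])
  have gm: "g \<in> borel_measurable lebesgue" using g by (simp add: measurable_completion)
  have "integrable lebesgue g" using integrable_cong_AE_imp[OF assms gm ae] .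
  then have "integrable lborel g" using integrable_completion[OF g(1)] by simp
  moreover have "integral\<^sup>L lborel g = integral\<^sup>L lebesgue f"
    using integral_completion[OF g(1)] integral_cong_AE[OF fm gm ae] by simp
  ultimately show ?thesis using that g ae by auto
qed

lemma tensor_integral:
  fixes f :: "'a::euclidean_space \<Rightarrow> real" and g :: "'b::euclidean_space \<Rightarrow> real"
  assumes f: "integrable lebesgue f" and g: "integrable lebesgue g"
  shows "integrable lebesgue (\<lambda>z. f (fst z) * g (snd z))"
    and "(\<integral>z. f (fst z) * g (snd z) \<partial>lebesgue)
      = (\<integral>x. f x \<partial>lebesgue) * (\<integral>y. g y \<partial>lebesgue)"
proof -
  obtain f' where f'[measurable]: "f' \<in> borel_measurable borel" and ff: "AE x in lebesgue. f x = f' x"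
    and fi: "integrable lborel f'" and fe: "integral\<^sup>L lborel f' = integral\<^sup>L lebesgue f"
    by (rule borel_representative[OF f])
  obtain g' where g'[measurable]: "g' \<in> borel_measurable borel" and gg: "AE x in lebesgue. g x = g' x"
    and gi: "integrable lborel g'" and ge: "integral\<^sup>L lborel g' = integral\<^sup>L lebesgue g"
    by (rule borel_representative[OF g])
  let ?h = "\<lambda>z. f' (fst z) * g' (snd z)"
  have hm: "?h \<in> borel_measurable (lborel \<Otimes>\<^sub>M lborel)" by measurable
  have hi: "integrable (lborel \<Otimes>\<^sub>M lborel) ?h"
  proof (rule lborel_pair.Fubini_integrable[OF hm])
    show "integrable lborel (\<lambda>x. LINT y|lborel. norm (f' (fst (x, y)) * g' (snd (x, y))))"
      using fi by (simp add: abs_mult)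
    show "AE x in lborel. integrable lborel (\<lambda>y. f' (fst (x, y)) * g' (snd (x, y)))"
      using gi by simp
  qed
  have he: "integral\<^sup>L (lborel \<Otimes>\<^sub>M lborel) ?h = integral\<^sup>L lborel f' * integral\<^sup>L lborel g'"
    using lborel_pair.integral_fst'[OF hi] by simp
  have hm': "?h \<in> borel_measurable lborel" using hm by (simp add: lborel_prod)
  have hl: "?h \<in> borel_measurable lebesgue" using hm' by (simp add: measurable_completion)
  have hli: "integrable lebesgue ?h" and hle: "integral\<^sup>L lebesgue ?h = integral\<^sup>L lborel f' * integral\<^sup>L lborel g'"
    using hi he integrable_completion[OF hm'] integral_completion[OF hm'] by (simp_all add: lborel_prod)
  have ae: "AE z in lebesgue. ?h z = f (fst z) * g (snd z)"
    using AE_lebesgue_fst[OF ff] AE_lebesgue_snd[OF gg] by eventually_elim simp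
  have m: "(\<lambda>z. f (fst z) * g (snd z)) \<in> borel_measurable lebesgue"
    using f g lebesgue_fst lebesgue_snd
    by (intro borel_measurable_times) (auto intro: measurable_compose)
  show "integrable lebesgue (\<lambda>z. f (fst z) * g (snd z))"
    by (rule integrable_cong_AE_imp[OF hli m ae])
  show "(\<integral>z. f (fst z) * g (snd z) \<partial>lebesgue) = (\<integral>x. f x \<partial>lebesgue) * (\<integral>y. g y \<partial>lebesgue)"
    using integral_cong_AE[OF hl m ae] hle fe ge by simp
qed

lemma nn_integral_lborel_isometry:
  fixes f :: "'a::euclidean_space \<Rightarrow> ennreal"
  assumes [measurable]: "f \<in> borel_measurable borel" and c: "\<bar>c\<bar> = (1::real)"
  shows "(\<integral>\<^sup>+x. f (t + c *\<^sub>R x) \<partial>lborel) = (\<integral>\<^sup>+x. f x \<partial>lborel)"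
proof -
  have "(\<integral>\<^sup>+x. f x \<partial>lborel) = (\<integral>\<^sup>+x. f x \<partial>density (distr lborel borel (\<lambda>x. t + c *\<^sub>R x)) (\<lambda>_. \<bar>c\<bar> ^ DIM('a)))"
    using c by (subst lborel_affine[of c t]) auto
  also have "\<dots> = (\<integral>\<^sup>+x. f (t + c *\<^sub>R x) \<partial>lborel)"
    using c by (simp add: density_1 nn_integral_distr)
  finally show ?thesis by simp
qed

lemma integrable_convolution:
  fixes f :: "'a::euclidean_space \<Rightarrow> real"
  assumes f: "integrable lebesgue f" and A: "A \<in> lmeasurable"
  shows "integrable lebesgue (\<lambda>z. indicator A (fst z) * f (fst z - snd z))"
    and "integrable lebesgue (\<lambda>z. indicator A (snd z) * f (fst z - snd z))"
proof -
  obtain f' where f'[measurable]: "f' \<in> borel_measurable borel" and ff: "AE x in lebesgue. f x = f' x"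
    and fi: "integrable lborel f'" by (rule borel_representative[OF f]) 
  have iA: "integrable lebesgue (indicator A :: 'a \<Rightarrow> real)" using A by (simp add: lmeasurable_iff_integrable)
  obtain a where a[measurable]: "a \<in> borel_measurable borel" and aA: "AE x in lebesgue. indicator A x = (a x :: real)"
    and ai: "integrable lborel a" by (rule borel_representative[OF iA])
  have fin: "(\<integral>\<^sup>+x. norm (f' x) \<partial>lborel) < \<infinity>" "(\<integral>\<^sup>+x. norm (a x) \<partial>lborel) < \<infinity>"
    using fi ai by (auto simp: integrable_iff_bounded)
  have fd: "AE z in lebesgue. f (fst z - snd z) = f' (fst z - snd z)"
    by (rule lebesgue_pullback(2)[OF _ null_diff ff])
      (intro borel_measurable_continuous_onI continuous_intros)
  have d: "(\<lambda>z::'a \<times> 'a. fst z - snd z) \<in> borel_measurable borel"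
      "(fst :: 'a \<times> 'a \<Rightarrow> 'a) \<in> borel_measurable borel" "(snd :: 'a \<times> 'a \<Rightarrow> 'a) \<in> borel_measurable borel"
    by (auto intro!: borel_measurable_continuous_onI continuous_intros)
  have bm: "(\<lambda>z. a (fst z) * f' (fst z - snd z)) \<in> borel_measurable lborel"
    "(\<lambda>z. a (snd z) * f' (fst z - snd z)) \<in> borel_measurable lborel"
    using measurable_compose[OF d(1) f'] measurable_compose[OF d(2) a] measurable_compose[OF d(3) a]
    by simp_all
  have r1: "(\<integral>\<^sup>+y. norm (f' (x - y)) \<partial>lborel) = (\<integral>\<^sup>+y. norm (f' y) \<partial>lborel)" for x
    using nn_integral_lborel_isometry[of "\<lambda>y. ennreal (norm (f' y))" "-1" x] by simp
  have r2: "(\<integral>\<^sup>+x. norm (f' (x - y)) \<partial>lborel) = (\<integral>\<^sup>+y. norm (f' y) \<partial>lborel)" for y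
    using nn_integral_lborel_isometry[of "\<lambda>y. ennreal (norm (f' y))" 1 "- y"] by simp
  have "(\<integral>\<^sup>+z. norm (a (fst z) * f' (fst z - snd z)) \<partial>(lborel \<Otimes>\<^sub>M lborel))
    = (\<integral>\<^sup>+x. \<integral>\<^sup>+y. ennreal (norm (a x)) * norm (f' (x - y)) \<partial>lborel \<partial>lborel)"
    by (subst lborel.nn_integral_fst[symmetric]) (simp_all add: abs_mult ennreal_mult)
  also have "\<dots> = (\<integral>\<^sup>+x. norm (a x) \<partial>lborel) * (\<integral>\<^sup>+y. norm (f' y) \<partial>lborel)"
  proof -
    have "(\<integral>\<^sup>+y. ennreal (norm (a x)) * norm (f' (x - y)) \<partial>lborel)
        = norm (a x) * (\<integral>\<^sup>+y. norm (f' y) \<partial>lborel)" for x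
      by (subst nn_integral_cmult) (simp_all only: r1, measurable)
    then show ?thesis by (simp only:) (rule nn_integral_multc, measurable)
  qed
  also have "\<dots> < \<infinity>" using fin by (simp add: ennreal_mult_less_top)
  finally have 1: "integrable lborel (\<lambda>z. a (fst z) * f' (fst z - snd z))"
    unfolding lborel_prod by (intro integrableI_bounded bm) auto
  have "(\<integral>\<^sup>+z. norm (a (snd z) * f' (fst z - snd z)) \<partial>(lborel \<Otimes>\<^sub>M lborel))
    = (\<integral>\<^sup>+y. \<integral>\<^sup>+x. ennreal (norm (a y)) * norm (f' (x - y)) \<partial>lborel \<partial>lborel)"
    by (subst lborel_pair.nn_integral_snd[symmetric]) (simp_all add: abs_mult ennreal_mult)
  also have "\<dots> = (\<integral>\<^sup>+x. norm (a x) \<partial>lborel) * (\<integral>\<^sup>+y. norm (f' y) \<partial>lborel)"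
  proof -
    have "(\<integral>\<^sup>+x. ennreal (norm (a y)) * norm (f' (x - y)) \<partial>lborel)
        = norm (a y) * (\<integral>\<^sup>+y. norm (f' y) \<partial>lborel)" for y
      by (subst nn_integral_cmult) (simp_all only: r2, measurable)
    then show ?thesis by (simp only:) (rule nn_integral_multc, measurable)
  qed
  also have "\<dots> < \<infinity>" using fin by (simp add: ennreal_mult_less_top)
  finally have 2: "integrable lborel (\<lambda>z. a (snd z) * f' (fst z - snd z))"
    unfolding lborel_prod by (intro integrableI_bounded bm) auto
  have m: "(\<lambda>z::'a\<times>'a. indicator A (fst z) * f (fst z - snd z)) \<in> borel_measurable lebesgue"
    "(\<lambda>z::'a\<times>'a. indicator A (snd z) * f (fst z - snd z)) \<in> borel_measurable lebesgue"
    using measurable_compose[OF lebesgue_fst borel_measurable_integrable[OF iA]]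
      measurable_compose[OF lebesgue_snd borel_measurable_integrable[OF iA]]
      measurable_compose[OF lebesgue_diff borel_measurable_integrable[OF f]]
    by (auto intro: borel_measurable_times)
  have 1: "integrable lebesgue (\<lambda>z. a (fst z) * f' (fst z - snd z))"
    using integrable_completion[OF borel_measurable_integrable[OF 1]] 1 by blast
  have 2: "integrable lebesgue (\<lambda>z. a (snd z) * f' (fst z - snd z))"
    using integrable_completion[OF borel_measurable_integrable[OF 2]] 2 by blast
  show "integrable lebesgue (\<lambda>z. indicator A (fst z) * f (fst z - snd z))"
  proof (rule integrable_cong_AE_imp[OF 1 m(1)])
    show "AE z in lebesgue. a (fst z) * f' (fst z - snd z) = indicator A (fst z) * f (fst z - snd z)"
      using AE_lebesgue_fst[OF aA] fd by eventually_elim simp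
  qed
  show "integrable lebesgue (\<lambda>z. indicator A (snd z) * f (fst z - snd z))"
  proof (rule integrable_cong_AE_imp[OF 2 m(2)])
    show "AE z in lebesgue. a (snd z) * f' (fst z - snd z) = indicator A (snd z) * f (fst z - snd z)"
      using AE_lebesgue_snd[OF aA] fd by eventually_elim simp
  qed
qed

section \<open>The space of the fractional problem\<close>

locale fractional_setting =
  fixes s :: real and K :: "real ^ 'n::finite \<Rightarrow> real" and \<Omega> :: "(real ^ 'n) set"
  assumes s_pos: "0 < s" and kernel: "admissible_kernel s K"
    and open_dom: "open \<Omega>" and bounded_dom: "bounded \<Omega>" and nonempty_dom: "\<Omega> \<noteq> {}"
begin

definition energy :: "(real ^ 'n \<Rightarrow> real) \<Rightarrow> (real ^ 'n \<Rightarrow> real) \<Rightarrow> real" where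
  "energy u v = set_lebesgue_integral lebesgue (Q_set \<Omega>)
     (\<lambda>(x, y). (u x - u y) * (v x - v y) * K (x - y))"

definition mass :: "(real ^ 'n \<Rightarrow> real) \<Rightarrow> (real ^ 'n \<Rightarrow> real) \<Rightarrow> real" where
  "mass u v = set_lebesgue_integral lebesgue \<Omega> (\<lambda>x. u x * v x)"

text \<open>
  The function whose \<open>L\<^sup>2\<close> norm on the product space is the norm of \<open>X\<^sub>0\<close>. Off the diagonal \<open>K\<close> is
  positive and is the square of its root; on the diagonal, where \<open>K 0\<close> may be negative, the factor
  \<open>u x - u y\<close> vanishes.
\<close>
definition energy_density :: "(real ^ 'n \<Rightarrow> real) \<Rightarrow> (real ^ 'n) \<times> (real ^ 'n) \<Rightarrow> real" where
  "energy_density u z = indicator (Q_set \<Omega>) z * ((u (fst z) - u (snd z)) * sqrt (K (fst z - snd z)))"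

definition restr :: "(real ^ 'n \<Rightarrow> real) \<Rightarrow> real ^ 'n \<Rightarrow> real" where
  "restr u x = indicator \<Omega> x * u x"

lemma K_pos: "x \<noteq> 0 \<Longrightarrow> 0 < K x"
  and K_weighted: "integrable lebesgue (\<lambda>x. min ((norm x)\<^sup>2) 1 * K x)"
  using kernel unfolding admissible_kernel_def by blast+

lemma K_measurable [measurable]: "K \<in> borel_measurable lebesgue"
proof -
  let ?f = "\<lambda>x. min ((norm x)\<^sup>2) 1 * K x"
  have f: "?f \<in> borel_measurable lebesgue" using K_weighted by simp
  have n: "(\<lambda>x::real^'n. min ((norm x)\<^sup>2) 1 :: real) \<in> borel_measurable lebesgue"
    by (rule measurable_completion)
      (simp add: borel_measurable_continuous_onI continuous_on_min continuous_on_power continuous_on_norm continuous_on_id continuous_on_const)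
  have z: "{0} \<in> sets (lebesgue :: (real^'n) measure)" by simp
  have "(\<lambda>x. if x \<in> {0} then K 0 else ?f x / min ((norm x)\<^sup>2) 1) \<in> borel_measurable lebesgue"
    using z by (intro measurable_If_set borel_measurable_divide f n) auto
  moreover have "(\<lambda>x. if x \<in> {0} then K 0 else ?f x / min ((norm x)\<^sup>2) 1) = K"
    by (auto simp: fun_eq_iff min_def)
  ultimately show ?thesis by simp
qed

lemma mem_Q_set: "z \<in> Q_set \<Omega> \<longleftrightarrow> fst z \<in> \<Omega> \<or> snd z \<in> \<Omega>"
  by (cases z) (auto simp: Q_set_def)

lemma dom_sets [measurable]: "\<Omega> \<in> sets lebesgue"
  by (intro sets_completionI_sets) (simp add: open_dom)

lemma dom_lmeasurable: "\<Omega> \<in> lmeasurable"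
  using bounded_dom open_dom by (rule lmeasurable_open)

lemma Q_set_sets [measurable]: "Q_set \<Omega> \<in> sets lebesgue"
proof -
  have "Q_set \<Omega> = (fst -` \<Omega> \<inter> space lebesgue) \<union> (snd -` \<Omega> \<inter> space lebesgue)"
    by (auto simp: mem_Q_set)
  then show ?thesis
    using measurable_sets[OF lebesgue_fst dom_sets] measurable_sets[OF lebesgue_snd dom_sets] by auto
qed

lemma energy_density_measurable:
  assumes "u \<in> borel_measurable lebesgue" shows "energy_density u \<in> borel_measurable lebesgue"
proof -
  have "(\<lambda>z. u (fst z)) \<in> borel_measurable (lebesgue :: ((real^'n) \<times> (real^'n)) measure)"
    "(\<lambda>z. u (snd z)) \<in> borel_measurable (lebesgue :: ((real^'n) \<times> (real^'n)) measure)"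
    "(\<lambda>z. K (fst z - snd z)) \<in> borel_measurable lebesgue"
    using measurable_compose[OF lebesgue_fst assms] measurable_compose[OF lebesgue_snd assms]
      measurable_compose[OF lebesgue_diff K_measurable] by auto
  then show ?thesis unfolding energy_density_def[abs_def] by measurable
qed

lemma restr_measurable:
  assumes "u \<in> borel_measurable lebesgue" shows "restr u \<in> borel_measurable lebesgue"
  unfolding restr_def[abs_def] using assms by measurable

lemma K_eq_sqrt_square: "(u x - u y) * (v x - v y) * (sqrt (K (x - y)) * sqrt (K (x - y)))
    = (u x - u y) * (v x - v y) * K (x - y)"
  using K_pos[of "x - y"] by (cases "x = y") auto

lemma energy_density_mult: "energy_density u (x, y) * energy_density v (x, y)
    = indicator (Q_set \<Omega>) (x, y) * ((u x - u y) * (v x - v y) * K (x - y))"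
  unfolding K_eq_sqrt_square[symmetric] by (simp add: energy_density_def indicator_def)

lemma energy_eq: "energy u v = (\<integral>z. energy_density u z * energy_density v z \<partial>lebesgue)"
  unfolding energy_def set_lebesgue_integral_def
  by (rule Bochner_Integration.integral_cong) (auto simp: energy_density_mult)

lemma mass_eq: "mass u v = (\<integral>x. restr u x * restr v x \<partial>lebesgue)"
  unfolding mass_def set_lebesgue_integral_def
  by (rule Bochner_Integration.integral_cong) (auto simp: restr_def indicator_def)

lemma X0_iff: "u \<in> X0_space K \<Omega> \<longleftrightarrow> u \<in> borel_measurable lebesgue \<and>
    (AE x in lebesgue. x \<notin> \<Omega> \<longrightarrow> u x = 0) \<and>
    restr u \<in> L2_functions lebesgue \<and> energy_density u \<in> L2_functions lebesgue"
proof -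
  have 1: "(\<lambda>x. indicator \<Omega> x *\<^sub>R u x) = restr u" "(\<lambda>x. indicator \<Omega> x *\<^sub>R (u x)\<^sup>2) = (\<lambda>x. (restr u x)\<^sup>2)"
    by (auto simp: restr_def fun_eq_iff indicator_def)
  have 2: "(\<lambda>z. indicator (Q_set \<Omega>) z *\<^sub>R (case z of (x, y) \<Rightarrow> (u x - u y) * sqrt (K (x - y)))) = energy_density u"
    "(\<lambda>z. indicator (Q_set \<Omega>) z *\<^sub>R (case z of (x, y) \<Rightarrow> (u x - u y) * sqrt (K (x - y)))\<^sup>2)
      = (\<lambda>z. (energy_density u z)\<^sup>2)"
    by (auto simp: energy_density_def fun_eq_iff indicator_def split_beta)
  show ?thesis
    unfolding X0_space_def X_space_def L2_on_def set_borel_measurable_def set_integrable_def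
      L2_functions_def mem_Collect_eq 1 2 by blast
qed

lemma X0D:
  assumes "u \<in> X0_space K \<Omega>"
  shows "u \<in> borel_measurable lebesgue" "AE x in lebesgue. x \<notin> \<Omega> \<longrightarrow> u x = 0"
    "restr u \<in> L2_functions lebesgue" "energy_density u \<in> L2_functions lebesgue"
    "integrable lebesgue (\<lambda>z. (energy_density u z)\<^sup>2)" "integrable lebesgue (\<lambda>x. (restr u x)\<^sup>2)"
  using assms by (auto simp: X0_iff L2_functions_def)

lemma energy_density_lin: "energy_density (\<lambda>x. a * f x + b * g x) = (\<lambda>z. a * energy_density f z + b * energy_density g z)"
  by (auto simp: energy_density_def fun_eq_iff algebra_simps)

lemma restr_lin: "restr (\<lambda>x. a * f x + b * g x) = (\<lambda>z. a * restr f z + b * restr g z)"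
  by (auto simp: restr_def fun_eq_iff algebra_simps)

lemma restr_diff: "restr (\<lambda>x. f x - g x) = (\<lambda>z. restr f z - restr g z)"
  by (auto simp: restr_def fun_eq_iff algebra_simps)

lemma X0_zero: "(\<lambda>_. 0) \<in> X0_space K \<Omega>"
  by (simp add: X0_iff L2_functions_def energy_density_def[abs_def] restr_def[abs_def])

lemma X0_lin:
  assumes f: "f \<in> X0_space K \<Omega>" and g: "g \<in> X0_space K \<Omega>"
  shows "(\<lambda>x. a * f x + b * g x) \<in> X0_space K \<Omega>"
  unfolding X0_iff
proof (intro conjI)
  show "(\<lambda>x. a * f x + b * g x) \<in> borel_measurable lebesgue" using X0D(1)[OF f] X0D(1)[OF g] by simp
  show "AE x in lebesgue. x \<notin> \<Omega> \<longrightarrow> a * f x + b * g x = 0"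
    using X0D(2)[OF f] X0D(2)[OF g] by eventually_elim auto
qed (simp_all add: energy_density_lin restr_lin L2_lin X0D f g)

sublocale E: form_space "X0_space K \<Omega>" energy
  unfolding energy_eq[abs_def]
  by (rule form_space_pullback[OF form_space_L2]) (auto simp: X0_zero X0_lin X0D energy_density_lin)

sublocale H: form_space "X0_space K \<Omega>" mass
  unfolding mass_eq[abs_def]
  by (rule form_space_pullback[OF form_space_L2]) (auto simp: X0_zero X0_lin X0D restr_lin)

lemma energy_square: "energy u u = (\<integral>z. (energy_density u z)\<^sup>2 \<partial>lebesgue)"
  by (simp add: energy_eq power2_eq_square)

lemma mass_square: "mass u u = (\<integral>x. (restr u x)\<^sup>2 \<partial>lebesgue)"
  by (simp add: mass_eq power2_eq_square)

lemma restr_AE_eq: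
  assumes u: "u \<in> X0_space K \<Omega>" shows "AE x in lebesgue. restr u x = u x"
  using X0D(2)[OF u] by eventually_elim (auto simp: restr_def)

lemma mass_zero_iff:
  assumes u: "u \<in> X0_space K \<Omega>"
  shows "mass u u = 0 \<longleftrightarrow> (AE x in lebesgue. u x = 0)"
proof -
  have "mass u u = 0 \<longleftrightarrow> (AE x in lebesgue. restr u x = 0)"
    unfolding mass_square using X0D(6)[OF u]
    by (subst integral_nonneg_eq_0_iff_AE) auto
  also have "\<dots> \<longleftrightarrow> (AE x in lebesgue. u x = 0)"
    using restr_AE_eq[OF u] by (auto elim: eventually_elim2)
  finally show ?thesis .
qed

lemma energy_null:
  assumes u: "u \<in> X0_space K \<Omega>" and z: "mass u u = 0"
  shows "energy u u = 0"
proof -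
  have a: "AE x in lebesgue. u x = 0" using z mass_zero_iff[OF u] by blast
  have "AE z in lebesgue. (energy_density u z)\<^sup>2 = 0"
    using AE_lebesgue_fst[OF a, where 'b = "real^'n"] AE_lebesgue_snd[OF a, where 'a = "real^'n"]
    by eventually_elim (simp add: energy_density_def)
  then show ?thesis
    unfolding energy_square using X0D(5)[OF u] by (subst integral_nonneg_eq_0_iff_AE) auto
qed

lemma X0_pos:
  assumes u: "u \<in> X0_space K \<Omega>" shows "pos u \<in> X0_space K \<Omega>"
  unfolding X0_iff
proof (intro conjI)
  show m: "pos u \<in> borel_measurable lebesgue" using X0D(1)[OF u] unfolding pos_def by measurable
  show "AE x in lebesgue. x \<notin> \<Omega> \<longrightarrow> pos u x = 0"
    using X0D(2)[OF u] by eventually_elim (auto simp: pos_def)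
  show "restr (pos u) \<in> L2_functions lebesgue"
    by (rule L2_if_abs_le[OF X0D(3)[OF u] restr_measurable[OF m]])
      (auto simp: restr_def pos_def indicator_def)
  have *: "\<bar>max a 0 - max b 0\<bar> \<le> \<bar>a - b\<bar>" for a b :: real by auto
  show "energy_density (pos u) \<in> L2_functions lebesgue"
    by (rule L2_if_abs_le[OF X0D(4)[OF u] energy_density_measurable[OF m]])
      (auto simp: energy_density_def pos_def indicator_def abs_mult intro!: mult_right_mono *)
qed

lemma mass_pos_self: "mass (pos u) u = mass (pos u) (pos u)"
  unfolding mass_eq by (rule Bochner_Integration.integral_cong) (auto simp: restr_def pos_def max_def)

lemma lebesgue_integral_mono:
  assumes "integrable lebesgue f" "integrable lebesgue g" "\<And>x. f x \<le> (g x :: real)"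
  shows "(\<integral>x. f x \<partial>lebesgue) \<le> (\<integral>x. g x \<partial>(lebesgue :: (real^'n) measure))"
  by (rule integral_mono[OF assms(1,2)]) (simp add: assms(3))

lemma mass_pos_contraction:
  assumes f: "f \<in> X0_space K \<Omega>" and g: "g \<in> X0_space K \<Omega>"
  shows "mass (\<lambda>x. pos f x - pos g x) (\<lambda>x. pos f x - pos g x) \<le> mass (\<lambda>x. f x - g x) (\<lambda>x. f x - g x)"
  unfolding mass_square
proof (rule lebesgue_integral_mono)
  show "integrable lebesgue (\<lambda>x. (restr (\<lambda>x. pos f x - pos g x) x)\<^sup>2)"
    "integrable lebesgue (\<lambda>x. (restr (\<lambda>x. f x - g x) x)\<^sup>2)"
    using X0D(6) E.diff_mem X0_pos f g by blast+
  have "\<bar>max a 0 - max b 0\<bar> \<le> \<bar>a - b\<bar>" for a b :: real by auto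
  then have "(max a 0 - max b 0)\<^sup>2 \<le> (a - b)\<^sup>2" for a b :: real by (simp add: abs_le_square_iff)
  then show "(restr (\<lambda>x. pos f x - pos g x) x)\<^sup>2 \<le> (restr (\<lambda>x. f x - g x) x)\<^sup>2" for x
    by (auto simp: restr_def pos_def indicator_def)
qed

lemma mass_pos_convex:
  assumes f: "f \<in> X0_space K \<Omega>" and h: "h \<in> X0_space K \<Omega>"
  shows "mass (pos f) (pos f) + 2 * mass (pos f) h
    \<le> mass (pos (\<lambda>x. f x + h x)) (pos (\<lambda>x. f x + h x))"
proof -
  have i1: "integrable lebesgue (\<lambda>x. (restr (pos f) x)\<^sup>2)" using X0D(6) X0_pos f by blast
  have i2: "integrable lebesgue (\<lambda>x. restr (pos f) x * restr h x)"
    using integrable_L2_mult X0D(3) X0_pos f h by blast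
  have "mass (pos f) (pos f) + 2 * mass (pos f) h
    = (\<integral>x. (restr (pos f) x)\<^sup>2 + 2 * (restr (pos f) x * restr h x) \<partial>lebesgue)"
    unfolding mass_square using i1 i2 by (simp add: mass_eq)
  also have "\<dots> \<le> mass (pos (\<lambda>x. f x + h x)) (pos (\<lambda>x. f x + h x))"
    unfolding mass_square
  proof (rule lebesgue_integral_mono)
    show "integrable lebesgue (\<lambda>x. (restr (pos f) x)\<^sup>2 + 2 * (restr (pos f) x * restr h x))"
      using i1 i2 by simp
    show "integrable lebesgue (\<lambda>x. (restr (pos (\<lambda>x. f x + h x)) x)\<^sup>2)"
      by (rule X0D(6)[OF X0_pos[OF E.add_mem[OF f h]]])
    have *: "(max a 0)\<^sup>2 + 2 * (max a 0 * b) \<le> (max (a + b) 0)\<^sup>2" for a b :: real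
    proof (cases "a \<le> 0")
      case False
      show ?thesis
      proof (cases "a + b \<le> 0")
        case True
        have "a * (a + 2 * b) \<le> 0" using False True by (intro mult_nonneg_nonpos) auto
        then show ?thesis using False True by (simp add: power2_eq_square algebra_simps)
      next
        case False
        have "0 \<le> b\<^sup>2" by simp
        then show ?thesis using \<open>\<not> a \<le> 0\<close> False by (simp add: power2_sum)
      qed
    qed simp
    show "(restr (pos f) x)\<^sup>2 + 2 * (restr (pos f) x * restr h x) \<le> (restr (pos (\<lambda>x. f x + h x)) x)\<^sup>2" for x
      using *[of "f x" "h x"] by (auto simp: restr_def pos_def indicator_def)
  qed
  finally show ?thesis .
qed

lemma mass_split:
  assumes u: "u \<in> X0_space K \<Omega>"
  shows "mass u u = mass (pos u) (pos u) + mass (pos (\<lambda>x. - u x)) (pos (\<lambda>x. - u x))"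
proof -
  have "mass u u = (\<integral>x. (restr (pos u) x)\<^sup>2 + (restr (pos (\<lambda>x. - u x)) x)\<^sup>2 \<partial>lebesgue)"
    unfolding mass_square
    by (rule Bochner_Integration.integral_cong) (auto simp: restr_def pos_def max_def)
  then show ?thesis
    using X0D(6)[OF X0_pos[OF u]] X0D(6)[OF X0_pos[OF E.uminus_mem[OF u]]] by (simp add: mass_square)
qed

lemma kernel_lower_bound:
  assumes "0 < r"
  shows "\<exists>\<kappa>>0. \<forall>z. z \<noteq> 0 \<longrightarrow> norm z \<le> r \<longrightarrow> \<kappa> \<le> K z"
proof -
  obtain c where c: "0 < c" "\<And>x. x \<noteq> 0 \<Longrightarrow> c * norm x powr (- (real CARD('n) + 2 * s)) \<le> K x"
    using kernel unfolding admissible_kernel_def by blast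
  show ?thesis
  proof (intro exI[of _ "c * r powr (- (real CARD('n) + 2 * s))"] conjI allI impI)
    show "0 < c * r powr (- (real CARD('n) + 2 * s))" using c assms by simp
    fix z :: "real^'n" assume z: "z \<noteq> 0" "norm z \<le> r"
    have "c * r powr (- (real CARD('n) + 2 * s)) \<le> c * norm z powr (- (real CARD('n) + 2 * s))"
      using c z s_pos by (intro mult_left_mono powr_mono2') auto
    also have "\<dots> \<le> K z" by (rule c(2)[OF z(1)])
    finally show "c * r powr (- (real CARD('n) + 2 * s)) \<le> K z" .
  qed
qed

lemma energy_density_square: "(energy_density u z)\<^sup>2 = indicator (Q_set \<Omega>) z * ((u (fst z) - u (snd z))\<^sup>2 * K (fst z - snd z))"
  using energy_density_mult[of u "fst z" "snd z" u] by (simp add: power2_eq_square)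

text \<open>
  Lower bounds on the energy are obtained by integrating pointwise minorants built from products
  \<open>f x * g y\<close>, whose integrals factorise.
\<close>
lemma integral_le_energy:
  assumes u: "u \<in> X0_space K \<Omega>" and G: "integrable lebesgue G"
    and le: "AE z in lebesgue. G z \<le> (energy_density u z)\<^sup>2"
  shows "(\<integral>z. G z \<partial>lebesgue) \<le> energy u u"
  unfolding energy_square by (rule integral_mono_AE[OF G X0D(5)[OF u] le])

lemma integrable_restr: 
  assumes u: "u \<in> X0_space K \<Omega>" shows "integrable lebesgue (restr u)"
proof -
  have "indicator \<Omega> \<in> L2_functions lebesgue"
  proof -
    have "(\<lambda>x. (indicator \<Omega> x)\<^sup>2 :: real) = indicator \<Omega>" by (auto simp: indicator_def)
    then show ?thesis using dom_lmeasurable by (simp add: L2_functions_def lmeasurable_iff_integrable)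
  qed
  from integrable_L2_mult[OF this X0D(3)[OF u]]
  show ?thesis by (rule Bochner_Integration.integrable_cong[THEN iffD1, rotated 2]) (auto simp: restr_def indicator_def)
qed

lemma integrable_indicator_dom [simp]: "integrable lebesgue (indicator \<Omega> :: _ \<Rightarrow> real)"
  using dom_lmeasurable by (simp add: lmeasurable_iff_integrable)

text \<open>
  A ball at positive distance from the domain carries the exterior value 0, so the energy of pairs
  \<open>(x, y)\<close> with \<open>x\<close> in the domain and \<open>y\<close> in the ball is an integral of \<open>(u x)\<^sup>2\<close> against a kernel that
  is bounded below.
\<close>
lemma poincare: "\<exists>C>0. \<forall>u\<in>X0_space K \<Omega>. mass u u \<le> C * energy u u"
proof -
  obtain R where R: "\<And>x. x \<in> \<Omega> \<Longrightarrow> norm x \<le> R" "0 < R" using bounded_dom bounded_pos by blast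
  obtain e :: "real^'n" where e: "norm e = 1" using vector_choose_size[of 1] by auto
  define a where "a = (R + 2) *\<^sub>R e"
  have na: "norm a = R + 2" using e R by (simp add: a_def)
  have out: "ball a 1 \<inter> \<Omega> = {}"
  proof (rule ccontr)
    assume "ball a 1 \<inter> \<Omega> \<noteq> {}"
    then obtain x where x: "x \<in> \<Omega>" "norm (a - x) < 1" by (auto simp: dist_norm)
    then show False using R(1)[OF x(1)] na norm_triangle_ineq2[of a x] by linarith
  qed
  have near: "norm (x - y) \<le> 2 * R + 3" if "x \<in> \<Omega>" "y \<in> ball a 1" for x y
  proof -
    have "norm (a - y) < 1" using that by (simp add: dist_norm)
    then have "norm y \<le> R + 3" using na norm_triangle_ineq2[of y a] by (simp add: norm_minus_commute)
    then show ?thesis using norm_triangle_ineq4[of x y] R(1)[OF that(1)] by linarith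
  qed
  obtain \<kappa> where \<kappa>: "0 < \<kappa>" "\<And>z. z \<noteq> 0 \<Longrightarrow> norm z \<le> 2 * R + 3 \<Longrightarrow> \<kappa> \<le> K z"
    using kernel_lower_bound[of "2 * R + 3"] R(2) by auto
  define b where "b = measure lebesgue (ball a 1)"
  have b: "0 < b" unfolding b_def using content_ball_pos[of 1 a] by simp
  have ib: "integrable lebesgue (indicator (ball a 1) :: _ \<Rightarrow> real)"
    by (simp add: lmeasurable_iff_integrable[symmetric])
  have "mass u u \<le> (1 / (\<kappa> * b)) * energy u u" if u: "u \<in> X0_space K \<Omega>" for u
  proof -
    let ?G = "\<lambda>z. (\<kappa> * (restr u (fst z))\<^sup>2) * indicator (ball a 1) (snd z)"
    have iu: "integrable lebesgue (\<lambda>x. \<kappa> * (restr u x)\<^sup>2)" using X0D(6)[OF u] by simp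
    have "(\<integral>z. ?G z \<partial>lebesgue) \<le> energy u u"
    proof (rule integral_le_energy[OF u tensor_integral(1)[OF iu ib]])
      show "AE z in lebesgue. ?G z \<le> (energy_density u z)\<^sup>2"
        using AE_lebesgue_snd[OF X0D(2)[OF u], where 'a = "real^'n"]
      proof eventually_elim
        fix z :: "(real^'n) \<times> (real^'n)" assume z: "snd z \<notin> \<Omega> \<longrightarrow> u (snd z) = 0"
        show "?G z \<le> (energy_density u z)\<^sup>2"
        proof (cases "fst z \<in> \<Omega> \<and> snd z \<in> ball a 1")
          case True
          then have o: "snd z \<notin> \<Omega>" using out by blast
          then have ne: "fst z - snd z \<noteq> 0" using True by auto
          have k: "\<kappa> \<le> K (fst z - snd z)" using \<kappa>(2)[OF ne near] True by blast
          have "\<kappa> * (u (fst z))\<^sup>2 \<le> (u (fst z))\<^sup>2 * K (fst z - snd z)"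
            using mult_right_mono[OF k, of "(u (fst z))\<^sup>2"] by (simp add: mult.commute)
          then show ?thesis using z o True by (simp add: energy_density_square mem_Q_set restr_def)
        next
          case False
          then show ?thesis by (auto simp: restr_def)
        qed
      qed
    qed
    moreover have "(\<integral>z. ?G z \<partial>lebesgue) = \<kappa> * mass u u * b"
      using tensor_integral(2)[OF iu ib] by (simp add: mass_square b_def)
    ultimately show ?thesis using \<kappa>(1) b by (simp add: field_simps)
  qed
  then show ?thesis using \<kappa>(1) b by (intro exI[of _ "1 / (\<kappa> * b)"]) auto
qed

text \<open>
  With \<open>P\<close> and \<open>N\<close> the positive and negative parts, \<open>(u x - u y)\<^sup>2\<close> exceeds
  \<open>(P x - P y)\<^sup>2 + (N x - N y)\<^sup>2\<close> by \<open>2 * (P x * N y + N x * P y)\<close>, and \<open>K\<close> is bounded below on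
  differences of points of the bounded domain.
\<close>
lemma interaction:
  "\<exists>\<kappa>>0. \<forall>u\<in>X0_space K \<Omega>. energy (pos u) (pos u) + energy (pos (\<lambda>x. - u x)) (pos (\<lambda>x. - u x))
     + \<kappa> * (\<integral>x. restr (pos u) x \<partial>lebesgue) * (\<integral>x. restr (pos (\<lambda>x. - u x)) x \<partial>lebesgue) \<le> energy u u"
proof -
  obtain R where R: "\<And>x. x \<in> \<Omega> \<Longrightarrow> norm x \<le> R" "0 < R" using bounded_dom bounded_pos by blast
  have near: "norm (x - y) \<le> 2 * R" if "x \<in> \<Omega>" "y \<in> \<Omega>" for x y
    using norm_triangle_ineq4[of x y] R(1)[OF that(1)] R(1)[OF that(2)] by linarith
  obtain \<kappa> where \<kappa>: "0 < \<kappa>" "\<And>z. z \<noteq> 0 \<Longrightarrow> norm z \<le> 2 * R \<Longrightarrow> \<kappa> \<le> K z"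
    using kernel_lower_bound[of "2 * R"] R(2) by auto
  have "energy (pos u) (pos u) + energy (pos (\<lambda>x. - u x)) (pos (\<lambda>x. - u x))
     + (4 * \<kappa>) * (\<integral>x. restr (pos u) x \<partial>lebesgue) * (\<integral>x. restr (pos (\<lambda>x. - u x)) x \<partial>lebesgue) \<le> energy u u"
    if u: "u \<in> X0_space K \<Omega>" for u
  proof -
    define P N where "P = pos u" and "N = pos (\<lambda>x. - u x)"
    have PX: "P \<in> X0_space K \<Omega>" and NX: "N \<in> X0_space K \<Omega>"
      unfolding P_def N_def by (intro X0_pos u E.uminus_mem)+
    note i = integrable_restr[OF PX] integrable_restr[OF NX]
    let ?G = "\<lambda>z. (energy_density P z)\<^sup>2 + (energy_density N z)\<^sup>2 + 2 * \<kappa> * (restr P (fst z) * restr N (snd z))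
        + 2 * \<kappa> * (restr N (fst z) * restr P (snd z))"
    note Gi = X0D(5)[OF PX] X0D(5)[OF NX] tensor_integral(1)[OF i] tensor_integral(1)[OF i(2,1)]
    have "(\<integral>z. ?G z \<partial>lebesgue) \<le> energy u u"
    proof (rule integral_le_energy[OF u], intro Bochner_Integration.integrable_add Gi integrable_mult_right)
      have "?G z \<le> (energy_density u z)\<^sup>2" for z
      proof (cases "fst z = snd z \<or> \<not> (fst z \<in> \<Omega> \<or> snd z \<in> \<Omega>)")
        case True
        have "P (snd z) * N (snd z) = 0" by (simp add: P_def N_def pos_def max_def)
        then have "restr P (fst z) * restr N (snd z) = 0" "restr N (fst z) * restr P (snd z) = 0"
          using True by (auto simp: restr_def indicator_def mult.commute)
        then show ?thesis using True by (auto simp: energy_density_square mem_Q_set)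
      next
        case False
        let ?x = "fst z" and ?y = "snd z" let ?k = "K (?x - ?y)"
        have k0: "0 \<le> ?k" using K_pos[of "?x - ?y"] False by simp
        have nonneg: "0 \<le> P x" "0 \<le> N x" for x by (auto simp: P_def N_def pos_def)
        have "u x = P x - N x" and z: "P x * N x = 0" for x by (auto simp: P_def N_def pos_def max_def)
        then have "(u ?x - u ?y)\<^sup>2 = ((P ?x - N ?x) - (P ?y - N ?y))\<^sup>2" by simp
        also have "\<dots> = (P ?x - P ?y)\<^sup>2 + (N ?x - N ?y)\<^sup>2 + 2 * (P ?x * N ?y) + 2 * (N ?x * P ?y)
            - 2 * (P ?x * N ?x) - 2 * (P ?y * N ?y)"
          by (simp add: power2_eq_square algebra_simps)
        finally have id: "(u ?x - u ?y)\<^sup>2 = (P ?x - P ?y)\<^sup>2 + (N ?x - N ?y)\<^sup>2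
            + 2 * (P ?x * N ?y) + 2 * (N ?x * P ?y)"
          unfolding z by simp
        have b: "\<kappa> * (restr P ?x * restr N ?y) \<le> (P ?x * N ?y) * ?k \<and> \<kappa> * (restr N ?x * restr P ?y) \<le> (N ?x * P ?y) * ?k"
        proof (cases "?x \<in> \<Omega> \<and> ?y \<in> \<Omega>")
          case True
          then have "\<kappa> \<le> ?k" using \<kappa>(2)[OF _ near] False by simp
          then show ?thesis using True nonneg by (auto simp: restr_def mult.commute intro!: mult_right_mono)
        next
          case False
          then show ?thesis using nonneg k0 by (auto simp: restr_def)
        qed
        have "(energy_density u z)\<^sup>2 = (u ?x - u ?y)\<^sup>2 * ?k" "(energy_density P z)\<^sup>2 = (P ?x - P ?y)\<^sup>2 * ?k"
          "(energy_density N z)\<^sup>2 = (N ?x - N ?y)\<^sup>2 * ?k"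
          using False by (auto simp: energy_density_square mem_Q_set)
        then show ?thesis using b unfolding id by (simp add: algebra_simps)
      qed
      then show "AE z in lebesgue. ?G z \<le> (energy_density u z)\<^sup>2" by simp
    qed
    also have "(\<integral>z. ?G z \<partial>lebesgue) = energy P P + energy N N
        + (4 * \<kappa>) * (\<integral>x. restr P x \<partial>lebesgue) * (\<integral>x. restr N x \<partial>lebesgue)"
      using Gi tensor_integral(2)[OF i] tensor_integral(2)[OF i(2,1)] by (simp add: energy_square)
    finally show ?thesis by (simp add: P_def N_def)
  qed
  then show ?thesis using \<kappa>(1) by (intro exI[of _ "4 * \<kappa>"]) auto
qed

end

context fractional_setting begin

section \<open>Completeness, compactness and the Nash inequality\<close>

lemma L1_le_mass:
  assumes u: "u \<in> X0_space K \<Omega>"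
  shows "(\<integral>x. \<bar>restr u x\<bar> \<partial>lebesgue)\<^sup>2 \<le> measure lebesgue \<Omega> * mass u u"
proof -
  interpret L: form_space "L2_functions lebesgue" "\<lambda>f g. \<integral>x. f x * g x \<partial>(lebesgue :: (real^'n) measure)"
    by (rule form_space_L2)
  have sq: "(\<lambda>x. (indicator \<Omega> x)\<^sup>2 :: real) = indicator \<Omega>" by (auto simp: indicator_def)
  have 1: "indicator \<Omega> \<in> L2_functions lebesgue"
    using dom_lmeasurable by (simp add: L2_functions_def sq)
  have 2: "(\<lambda>x. \<bar>restr u x\<bar>) \<in> L2_functions lebesgue"
    using X0D(3)[OF u] by (auto simp: L2_functions_def)
  have "(\<lambda>x. indicator \<Omega> x * \<bar>restr u x\<bar>) = (\<lambda>x. \<bar>restr u x\<bar>)" by (auto simp: restr_def indicator_def)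
  then show ?thesis
    using L.cauchy_schwarz[OF 1 2] dom_lmeasurable sq
    by (simp add: mass_square power2_eq_square)
qed

text \<open>
  By the Poincare inequality and the boundedness of the domain, an energy Cauchy sequence is \<open>L\<^sup>1\<close>
  Cauchy and thus has a subsequence that converges almost everywhere. Fatou's lemma shows that the
  pointwise limit is the limit in energy. The limit is taken of the restrictions to the domain, so
  that it vanishes everywhere outside.
\<close>
lemma X0_complete:
  assumes F: "\<And>k::nat. F k \<in> X0_space K \<Omega>"
    and cau: "\<And>\<epsilon>. 0 < \<epsilon> \<Longrightarrow> \<exists>n. \<forall>k\<ge>n. \<forall>l\<ge>n. energy (\<lambda>x. F k x - F l x) (\<lambda>x. F k x - F l x) < \<epsilon>"
  shows "\<exists>g\<in>X0_space K \<Omega>. (\<lambda>k. energy (\<lambda>x. F k x - g x) (\<lambda>x. F k x - g x)) \<longlonglongrightarrow> 0"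
proof -
  obtain C where C: "0 < C" "\<And>u. u \<in> X0_space K \<Omega> \<Longrightarrow> mass u u \<le> C * energy u u"
    using poincare by blast
  have dX: "(\<lambda>x. F k x - F l x) \<in> X0_space K \<Omega>" for k l by (intro E.mem F)
  have mcau: "\<exists>n. \<forall>k\<ge>n. \<forall>l\<ge>n. mass (\<lambda>x. F k x - F l x) (\<lambda>x. F k x - F l x) < \<epsilon>" if "0 < \<epsilon>" for \<epsilon>
  proof -
    have "0 < \<epsilon> / C" using C(1) that by simp
    from cau[OF this] obtain n where n: "\<forall>k\<ge>n. \<forall>l\<ge>n. energy (\<lambda>x. F k x - F l x) (\<lambda>x. F k x - F l x) < \<epsilon> / C"
      by blast
    have "mass (\<lambda>x. F k x - F l x) (\<lambda>x. F k x - F l x) < \<epsilon>" if "k \<ge> n" "l \<ge> n" for k l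
    proof -
      have "mass (\<lambda>x. F k x - F l x) (\<lambda>x. F k x - F l x) \<le> C * energy (\<lambda>x. F k x - F l x) (\<lambda>x. F k x - F l x)"
        by (rule C(2)[OF dX])
      also have "\<dots> < C * (\<epsilon> / C)" using n that C(1) by (intro mult_strict_left_mono) auto
      finally show ?thesis using C(1) by simp
    qed
    then show ?thesis by blast
  qed
  define V where "V = measure lebesgue \<Omega>"
  have V: "0 \<le> V" by (simp add: V_def)
  obtain r where r: "strict_mono r" and cr: "AE x in lebesgue. Cauchy (\<lambda>i. restr (F (r i)) x)"
  proof (rule cauchy_L1_AE_cauchy_subseq[of lebesgue "\<lambda>k. restr (F k)"])
    show "integrable lebesgue (restr (F k))" for k by (rule integrable_restr[OF F])
    fix e :: real assume e: "0 < e"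
    then have "0 < e\<^sup>2 / (V + 1)" using V by simp
    from mcau[OF this] obtain n where n: "\<forall>k\<ge>n. \<forall>l\<ge>n.
        mass (\<lambda>x. F k x - F l x) (\<lambda>x. F k x - F l x) < e\<^sup>2 / (V + 1)"
      by blast
    have "(LINT x|lebesgue. norm (restr (F k) x - restr (F l) x)) < e" if "k \<ge> n" "l \<ge> n" for k l
    proof (rule power2_less_imp_less)
      have "(LINT x|lebesgue. norm (restr (F k) x - restr (F l) x))\<^sup>2
        \<le> V * mass (\<lambda>x. F k x - F l x) (\<lambda>x. F k x - F l x)"
        using L1_le_mass[OF dX, of k l] by (simp add: restr_diff V_def)
      also have "\<dots> \<le> V * (e\<^sup>2 / (V + 1))" using n that V by (intro mult_left_mono) (auto intro: less_imp_le)
      also have "\<dots> < e\<^sup>2" using e V by (simp add: field_simps)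
      finally show "(LINT x|lebesgue. norm (restr (F k) x - restr (F l) x))\<^sup>2 < e\<^sup>2" .
    qed (use e in simp)
    then show "\<exists>N. \<forall>i\<ge>N. \<forall>j\<ge>N. (LINT x|lebesgue. norm (restr (F i) x - restr (F j) x)) < e" by blast
  qed
  define u where "u x = lim (\<lambda>i. restr (F (r i)) x)" for x
  have um: "u \<in> borel_measurable lebesgue"
    unfolding u_def[abs_def] by (intro borel_measurable_lim_metric restr_measurable X0D(1) F)
  have u0: "u x = 0" if "x \<notin> \<Omega>" for x using that by (simp add: u_def restr_def)
  have limrs: "AE x in lebesgue. (\<lambda>i. restr (F (r i)) x) \<longlonglongrightarrow> u x"
    using cr by eventually_elim (simp add: u_def Cauchy_convergent_iff convergent_LIMSEQ_iff)
  have "AE x in lebesgue. \<forall>i. restr (F (r i)) x = F (r i) x"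
    unfolding AE_all_countable using restr_AE_eq[OF F] by blast
  then have limF: "AE x in lebesgue. (\<lambda>i. F (r i) x) \<longlonglongrightarrow> u x"
    using limrs by eventually_elim simp
  have limed: "AE z in lebesgue. (\<lambda>i. energy_density (\<lambda>x. F k x - F (r i) x) z) \<longlonglongrightarrow> energy_density (\<lambda>x. F k x - u x) z" for k
    using AE_lebesgue_fst[OF limF, where 'b = "real^'n"] AE_lebesgue_snd[OF limF, where 'a = "real^'n"]
    unfolding energy_density_def by eventually_elim (intro tendsto_intros)
  have limrs': "AE z in lebesgue. (\<lambda>i. restr (\<lambda>x. F k x - F (r i) x) z) \<longlonglongrightarrow> restr (\<lambda>x. F k x - u x) z" for k
    using limF unfolding restr_def by eventually_elim (intro tendsto_intros)
  have dm: "(\<lambda>x. F k x - u x) \<in> borel_measurable lebesgue" for k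
    using X0D(1)[OF F] um by (rule borel_measurable_diff)
  have key: "(\<lambda>x. F k x - u x) \<in> X0_space K \<Omega> \<and> energy (\<lambda>x. F k x - u x) (\<lambda>x. F k x - u x) \<le> \<epsilon>"
    if n: "\<And>k l. k \<ge> n \<Longrightarrow> l \<ge> n \<Longrightarrow> energy (\<lambda>x. F k x - F l x) (\<lambda>x. F k x - F l x) < \<epsilon>" and k: "k \<ge> n"
    for n k \<epsilon>
  proof
    have rn: "r i \<ge> i" for i using r by (rule seq_suble)
    have b: "(\<integral>z. (energy_density (\<lambda>x. F k x - F (r i) x) z)\<^sup>2 \<partial>lebesgue) \<le> \<epsilon>" if "i \<ge> n" for i
      using n[OF k, of "r i"] rn[of i] that by (simp add: energy_square)
    have b': "(\<integral>z. (restr (\<lambda>x. F k x - F (r i) x) z)\<^sup>2 \<partial>lebesgue) \<le> C * \<epsilon>" if "i \<ge> n" for i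
      using C(2)[OF dX, of k "r i"] mult_left_mono[OF b[OF that] less_imp_le[OF C(1)]]
      unfolding energy_square mass_square by linarith
    note e = Fatou_L2[OF X0D(4)[OF dX] energy_density_measurable[OF dm] limed b]
    note m = Fatou_L2[OF X0D(3)[OF dX] restr_measurable[OF dm] limrs' b']
    show "(\<lambda>x. F k x - u x) \<in> X0_space K \<Omega>"
      unfolding X0_iff
    proof (intro conjI dm)
      show "AE x in lebesgue. x \<notin> \<Omega> \<longrightarrow> F k x - u x = 0"
        using X0D(2)[OF F[of k]] by eventually_elim (simp add: u0)
      show "restr (\<lambda>x. F k x - u x) \<in> L2_functions lebesgue" using m(1) by blast
      show "energy_density (\<lambda>x. F k x - u x) \<in> L2_functions lebesgue" using e(1) by blast
    qed
    show "energy (\<lambda>x. F k x - u x) (\<lambda>x. F k x - u x) \<le> \<epsilon>" unfolding energy_square using e(2) by blast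
  qed
  have lim: "\<exists>n. \<forall>k\<ge>n. (\<lambda>x. F k x - u x) \<in> X0_space K \<Omega> \<and> energy (\<lambda>x. F k x - u x) (\<lambda>x. F k x - u x) \<le> \<epsilon>"
    if "0 < \<epsilon>" for \<epsilon>
    using cau[OF that] key by meson
  obtain n where "(\<lambda>x. F n x - u x) \<in> X0_space K \<Omega>" using lim[of 1] by auto
  from E.diff_mem[OF F[of n] this] have uX: "u \<in> X0_space K \<Omega>" by simp
  moreover have "(\<lambda>k. energy (\<lambda>x. F k x - u x) (\<lambda>x. F k x - u x)) \<longlonglongrightarrow> 0"
    unfolding LIMSEQ_def
  proof (intro allI impI)
    fix e :: real assume "0 < e"
    then obtain n where n: "\<And>k. k \<ge> n \<Longrightarrow> energy (\<lambda>x. F k x - u x) (\<lambda>x. F k x - u x) \<le> e / 2"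
      using lim[of "e / 2"] by auto
    have "dist (energy (\<lambda>x. F k x - u x) (\<lambda>x. F k x - u x)) 0 < e" if "k \<ge> n" for k
      using n[OF that] E.nonneg[OF E.diff_mem[OF F uX], of k] \<open>0 < e\<close> by (simp add: dist_real_def)
    then show "\<exists>no. \<forall>n\<ge>no. dist (energy (\<lambda>x. F n x - u x) (\<lambda>x. F n x - u x)) 0 < e" by blast
  qed
  ultimately show ?thesis by blast
qed

end

text \<open>
  The half-open cubes of the grid of mesh \<open>h\<close> that meet the set.
\<close>
lemma cube_partition:
  fixes A :: "(real ^ 'n::finite) set"
  assumes A: "bounded A" and h: "0 < h"
  obtains \<Q> where "finite \<Q>" "disjoint \<Q>" "A \<subseteq> \<Union>\<Q>"
    "\<And>Q. Q \<in> \<Q> \<Longrightarrow> Q \<in> lmeasurable" "\<And>Q. Q \<in> \<Q> \<Longrightarrow> h ^ CARD('n) \<le> measure lebesgue Q"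
    "\<And>Q x y. Q \<in> \<Q> \<Longrightarrow> x \<in> Q \<Longrightarrow> y \<in> Q \<Longrightarrow> norm (x - y) \<le> real CARD('n) * h"
proof -
  define idx :: "real^'n \<Rightarrow> int^'n" where "idx x = (\<chi> i. \<lfloor>x $ i / h\<rfloor>)" for x
  define cell where "cell z = {x. idx x = z}" for z
  have cell_iff: "x \<in> cell z \<longleftrightarrow> (\<forall>i. real_of_int (z $ i) * h \<le> x $ i \<and> x $ i < (real_of_int (z $ i) + 1) * h)" for x z
    using h by (simp add: cell_def idx_def vec_eq_iff floor_eq_iff pos_le_divide_eq pos_divide_less_eq)
  define \<Q> where "\<Q> = cell ` (idx ` A)"
  obtain R where R: "\<And>x. x \<in> A \<Longrightarrow> norm x \<le> R" using A by (auto simp: bounded_iff)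
  have "finite (idx ` A)"
  proof (rule finite_subset)
    let ?I = "{\<lfloor>- R / h\<rfloor>..\<lfloor>R / h\<rfloor>}"
    show "idx ` A \<subseteq> vec_lambda ` (PiE UNIV (\<lambda>_. ?I))"
    proof (rule image_subsetI)
      fix x assume x: "x \<in> A"
      have "\<bar>x $ i\<bar> \<le> R" for i using component_le_norm_cart[of x i] R[OF x] by linarith
      then have "- R / h \<le> x $ i / h" "x $ i / h \<le> R / h" for i
        using h by (auto simp: divide_right_mono abs_le_iff) (smt (verit) divide_right_mono minus_divide_left)
      then have "vec_nth (idx x) \<in> PiE UNIV (\<lambda>_. ?I)"
        by (auto simp: idx_def intro!: floor_mono)
      then show "idx x \<in> vec_lambda ` (PiE UNIV (\<lambda>_. ?I))"
        by (metis image_eqI vec_nth_inverse)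
    qed
    show "finite (vec_lambda ` (PiE (UNIV :: 'n set) (\<lambda>_. ?I)))" by (intro finite_imageI finite_PiE) auto
  qed
  then have fin: "finite \<Q>" by (simp add: \<Q>_def)
  have disj: "disjoint \<Q>" by (auto simp: \<Q>_def cell_def disjoint_def)
  have cov: "A \<subseteq> \<Union>\<Q>" by (auto simp: \<Q>_def cell_def)
  have diam: "norm (x - y) \<le> real CARD('n) * h" if "x \<in> cell z" "y \<in> cell z" for x y z
  proof -
    have "norm (x - y) \<le> (\<Sum>i\<in>UNIV. \<bar>(x - y) $ i\<bar>)" by (rule norm_le_l1_cart)
    also have "\<dots> \<le> (\<Sum>i\<in>(UNIV :: 'n set). h)"
    proof (rule sum_mono)
      fix i
      have "real_of_int (z $ i) * h \<le> x $ i" "x $ i < real_of_int (z $ i) * h + h"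
        "real_of_int (z $ i) * h \<le> y $ i" "y $ i < real_of_int (z $ i) * h + h"
        using that by (auto simp: cell_iff algebra_simps)
      then show "\<bar>(x - y) $ i\<bar> \<le> h" by (simp add: abs_le_iff)
    qed
    finally show ?thesis by simp
  qed
  have lm: "cell z \<in> lmeasurable" for z
  proof (rule bounded_set_imp_lmeasurable)
    have "cell z = (\<Inter>i\<in>UNIV. {x. x $ i \<ge> real_of_int (z $ i) * h} \<inter> {x. x $ i < (real_of_int (z $ i) + 1) * h})"
      by (auto simp: cell_iff)
    moreover have "{x::real^'n. x $ i \<ge> a} \<inter> {x. x $ i < b} \<in> sets borel" for i a b
      by (intro sets.Int borel_closed borel_open closed_halfspace_component_ge_cart open_halfspace_component_lt_cart)
    ultimately have "cell z \<in> sets borel" by (simp add: sets.finite_INT)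
    then show "cell z \<in> sets lebesgue" by simp
    show "bounded (cell z)"
      using diam[of _ z] unfolding bounded_def dist_norm by (metis empty_iff equals0I)
  qed
  have meas: "h ^ CARD('n) \<le> measure lebesgue (cell z)" for z
  proof -
    define a :: "real^'n" where "a = (\<chi> i. real_of_int (z $ i) * h)"
    define b :: "real^'n" where "b = (\<chi> i. (real_of_int (z $ i) + 1) * h)"
    have ab: "a $ i \<le> b $ i" for i using h by (simp add: a_def b_def algebra_simps)
    have le: "a \<bullet> c \<le> b \<bullet> c" if "c \<in> Basis" for c
      using that ab by (auto simp: Basis_vec_def inner_axis)
    have ne: "cbox a b \<noteq> {}" using ab by (auto simp: interval_ne_empty_cart)
    have "h ^ CARD('n) = (\<Prod>i\<in>UNIV. b $ i - a $ i)" by (simp add: a_def b_def algebra_simps)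
    also have "\<dots> = measure lborel (cbox a b)" using content_cbox_cart[OF ne] by simp
    also have "\<dots> = measure lborel (box a b)" using le by simp
    also have "\<dots> = measure lebesgue (box a b)" by (simp add: measure_completion)
    also have "\<dots> \<le> measure lebesgue (cell z)"
    proof (rule measure_mono_fmeasurable[OF _ _ lm])
      show "box a b \<subseteq> cell z"
        by (rule subsetI) (simp add: mem_box_cart cell_iff a_def b_def less_imp_le)
    qed simp
    finally show ?thesis .
  qed
  show ?thesis
    using fin disj cov lm meas diam by (intro that[of \<Q>]) (auto simp: \<Q>_def)
qed

context fractional_setting begin

definition cell_integral :: "(real^'n) set \<Rightarrow> (real^'n \<Rightarrow> real) \<Rightarrow> real" where
  "cell_integral Q w = (\<integral>x. indicator Q x * restr w x \<partial>lebesgue)"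

text \<open>
  For a cube \<open>Q\<close>, expanding the square gives
  \<open>2 * |Q| * \<integral>\<^sub>Q w\<^sup>2 = \<integral>\<^sub>Q\<integral>\<^sub>Q (w x - w y)\<^sup>2 + 2 * (\<integral>\<^sub>Q w)\<^sup>2\<close>. Points of a cube of side \<open>h\<close> are at
  distance at most \<open>n * h\<close>, where \<open>K\<close> is at least \<open>\<kappa> = c * (n * h)\<^bsup>-(n+2s)\<^esup>\<close>, while \<open>|Q| \<ge> h\<^bsup>n\<^esup>\<close>. Since
  \<open>\<kappa> * h\<^bsup>n\<^esup>\<close> is a multiple of \<open>h\<^bsup>-2s\<^esup>\<close>, the side \<open>h\<close> can be chosen such that \<open>2 * \<epsilon> * \<kappa> * h\<^bsup>n\<^esup> = 1\<close>.
\<close>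
lemma cube_inequality:
  assumes eps: "0 < \<epsilon>"
  shows "\<exists>\<Q> C. finite \<Q> \<and> disjoint \<Q> \<and> (\<forall>Q\<in>\<Q>. Q \<in> lmeasurable) \<and> 0 < C \<and>
    (\<forall>w\<in>X0_space K \<Omega>. mass w w \<le> \<epsilon> * energy w w + C * (\<Sum>Q\<in>\<Q>. (cell_integral Q w)\<^sup>2))"
proof -
  let ?n = "real CARD('n)"
  obtain c where c: "0 < c" "\<And>x. x \<noteq> 0 \<Longrightarrow> c * norm x powr (- (?n + 2 * s)) \<le> K x"
    using kernel unfolding admissible_kernel_def by blast
  have n: "0 < ?n" by simp
  define b where "b = 2 * \<epsilon> * (c * ?n powr (- (?n + 2 * s)))"
  have b: "0 < b" using eps c n by (simp add: b_def)
  define h where "h = b powr (1 / (2 * s))"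
  have h: "0 < h" using b by (simp add: h_def)
  have hs: "h powr (2 * s) = b" using b s_pos by (simp add: h_def powr_powr)
  define \<kappa> where "\<kappa> = c * (?n * h) powr (- (?n + 2 * s))"
  have \<kappa>: "0 < \<kappa>" using c h by (simp add: \<kappa>_def)
  have choice: "2 * \<epsilon> * (\<kappa> * h ^ CARD('n)) = 1"
  proof -
    have "(?n * h) powr (- (?n + 2 * s)) * h ^ CARD('n)
      = ?n powr (- (?n + 2 * s)) * (h powr (- (?n + 2 * s)) * h powr ?n)"
      using h by (simp add: powr_mult powr_realpow)
    also have "h powr (- (?n + 2 * s)) * h powr ?n = inverse b"
      using h by (simp add: hs powr_add[symmetric] powr_minus flip: hs)
    finally have "\<kappa> * h ^ CARD('n) = (c * ?n powr (- (?n + 2 * s))) * inverse b"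
      by (simp add: \<kappa>_def mult.assoc)
    then have "2 * \<epsilon> * (\<kappa> * h ^ CARD('n)) = b * inverse b"
      unfolding b_def by (simp only: mult.assoc)
    then show ?thesis using b by simp
  qed
  obtain \<Q> where Q: "finite \<Q>" "disjoint \<Q>" "\<Omega> \<subseteq> \<Union>\<Q>"
    "\<And>Q. Q \<in> \<Q> \<Longrightarrow> Q \<in> lmeasurable" "\<And>Q. Q \<in> \<Q> \<Longrightarrow> h ^ CARD('n) \<le> measure lebesgue Q"
    "\<And>Q x y. Q \<in> \<Q> \<Longrightarrow> x \<in> Q \<Longrightarrow> y \<in> Q \<Longrightarrow> norm (x - y) \<le> ?n * h"
    using cube_partition[OF bounded_dom h] by metis
  have "mass w w \<le> \<epsilon> * energy w w + (2 * \<epsilon> * \<kappa>) * (\<Sum>Q\<in>\<Q>. (cell_integral Q w)\<^sup>2)" if w: "w \<in> X0_space K \<Omega>" for w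
  proof -
    define v where "v = restr w"
    have vi: "integrable lebesgue v" and v2: "integrable lebesgue (\<lambda>x. (v x)\<^sup>2)"
      using integrable_restr[OF w] X0D(6)[OF w] by (auto simp: v_def)
    define f where "f Q x = indicator Q x * (v x)\<^sup>2" for Q x
    define g where "g Q x = indicator Q x * v x" for Q x
    have Qs: "Q \<in> sets lebesgue" if "Q \<in> \<Q>" for Q using Q(4)[OF that] by blast
    have fi: "integrable lebesgue (f Q)" and gi: "integrable lebesgue (g Q)"
      and ii: "integrable lebesgue (indicator Q :: _ \<Rightarrow> real)" if "Q \<in> \<Q>" for Q
      using integrable_mult_indicator[OF Qs[OF that] v2] integrable_mult_indicator[OF Qs[OF that] vi] Q(4)[OF that]
      by (auto simp: f_def[abs_def] g_def[abs_def] lmeasurable_iff_integrable)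
    let ?T = "\<lambda>Q z. f Q (fst z) * indicator Q (snd z) + indicator Q (fst z) * f Q (snd z)
        - 2 * (g Q (fst z) * g Q (snd z))"
    have T_eq: "?T Q z = indicator Q (fst z) * indicator Q (snd z) * (v (fst z) - v (snd z))\<^sup>2" for Q z
      by (simp add: f_def g_def power2_diff indicator_def)
    have Ti: "integrable lebesgue (?T Q)" if "Q \<in> \<Q>" for Q
      by (intro Bochner_Integration.integrable_add Bochner_Integration.integrable_diff
          integrable_mult_right tensor_integral(1) fi gi ii that)
    have TI: "(\<integral>z. ?T Q z \<partial>lebesgue) = 2 * measure lebesgue Q * (\<integral>x. f Q x \<partial>lebesgue) - 2 * (cell_integral Q w)\<^sup>2"
      if q: "Q \<in> \<Q>" for Q
      using tensor_integral[OF fi[OF q] ii[OF q]] tensor_integral[OF ii[OF q] fi[OF q]]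
        tensor_integral[OF gi[OF q] gi[OF q]] Qs[OF q]
      by (simp add: cell_integral_def g_def v_def power2_eq_square)
    have Gi: "integrable lebesgue (\<lambda>z. \<Sum>Q\<in>\<Q>. \<kappa> * ?T Q z)"
      by (intro Bochner_Integration.integrable_sum integrable_mult_right Ti)
    have "(\<integral>z. (\<Sum>Q\<in>\<Q>. \<kappa> * ?T Q z) \<partial>lebesgue) \<le> energy w w"
    proof (rule integral_le_energy[OF w Gi])
      show "AE z in lebesgue. (\<Sum>Q\<in>\<Q>. \<kappa> * ?T Q z) \<le> (energy_density w z)\<^sup>2"
        using AE_lebesgue_fst[OF restr_AE_eq[OF w], where 'b = "real^'n"]
          AE_lebesgue_snd[OF restr_AE_eq[OF w], where 'a = "real^'n"]
      proof eventually_elim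
        fix z :: "(real^'n) \<times> (real^'n)"
        assume z: "restr w (fst z) = w (fst z)" "restr w (snd z) = w (snd z)"
        let ?x = "fst z" and ?y = "snd z"
        show "(\<Sum>Q\<in>\<Q>. \<kappa> * ?T Q z) \<le> (energy_density w z)\<^sup>2"
        proof (cases "\<exists>Q\<in>\<Q>. ?x \<in> Q \<and> ?y \<in> Q \<and> ?x \<noteq> ?y \<and> (?x \<in> \<Omega> \<or> ?y \<in> \<Omega>)")
          case True
          then obtain P where P: "P \<in> \<Q>" "?x \<in> P" "?y \<in> P" "?x \<noteq> ?y" "?x \<in> \<Omega> \<or> ?y \<in> \<Omega>" by blast
          have "(\<Sum>Q\<in>\<Q>. \<kappa> * ?T Q z) = (\<Sum>Q\<in>\<Q>. if Q = P then \<kappa> * (w ?x - w ?y)\<^sup>2 else 0)"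
          proof (rule sum.cong[OF refl])
            fix Q assume "Q \<in> \<Q>"
            then show "\<kappa> * ?T Q z = (if Q = P then \<kappa> * (w ?x - w ?y)\<^sup>2 else 0)"
              unfolding T_eq using P Q(2) z by (auto simp: v_def indicator_def disjoint_def)
          qed
          also have "\<dots> = \<kappa> * (w ?x - w ?y)\<^sup>2" using Q(1) P(1) by simp
          also have "\<dots> \<le> K (?x - ?y) * (w ?x - w ?y)\<^sup>2"
          proof (rule mult_right_mono)
            have "\<kappa> \<le> c * norm (?x - ?y) powr (- (?n + 2 * s))"
              unfolding \<kappa>_def using c(1) P Q(6)[OF P(1-3)] s_pos by (intro mult_left_mono powr_mono2') auto
            then show "\<kappa> \<le> K (?x - ?y)" using c(2)[of "?x - ?y"] P(4) by simp
          qed simp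
          also have "\<dots> = (energy_density w z)\<^sup>2" using P(5) by (simp add: energy_density_square mem_Q_set mult.commute)
          finally show ?thesis .
        next
          case False
          have "\<kappa> * ?T Q z = 0" if "Q \<in> \<Q>" for Q
          proof (cases "?x \<in> Q \<and> ?y \<in> Q")
            case True
            then have "?x = ?y \<or> ?x \<notin> \<Omega> \<and> ?y \<notin> \<Omega>" using False that by blast
            then have "v ?x = v ?y" by (auto simp: v_def restr_def)
            then show ?thesis unfolding T_eq by simp
          next
            case False
            then show ?thesis unfolding T_eq by auto
          qed
          then have "(\<Sum>Q\<in>\<Q>. \<kappa> * ?T Q z) = 0" by (intro sum.neutral) blast
          then show ?thesis by simp
        qed
      qed
    qed
    also have "(\<integral>z. (\<Sum>Q\<in>\<Q>. \<kappa> * ?T Q z) \<partial>lebesgue) = (\<Sum>Q\<in>\<Q>. \<kappa> * (\<integral>z. ?T Q z \<partial>lebesgue))"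
      using Ti by (subst Bochner_Integration.integral_sum) auto
    also have "\<dots> = (\<Sum>Q\<in>\<Q>. \<kappa> * (2 * measure lebesgue Q * (\<integral>x. f Q x \<partial>lebesgue) - 2 * (cell_integral Q w)\<^sup>2))"
      by (intro sum.cong refl) (simp only: TI)
    finally have 1: "(\<Sum>Q\<in>\<Q>. \<kappa> * (2 * measure lebesgue Q * (\<integral>x. f Q x \<partial>lebesgue) - 2 * (cell_integral Q w)\<^sup>2)) \<le> energy w w" .
    have fn: "0 \<le> (\<integral>x. f Q x \<partial>lebesgue)" for Q by (rule integral_nonneg_AE) (simp add: f_def)
    have "mass w w \<le> (\<integral>x. (\<Sum>Q\<in>\<Q>. f Q x) \<partial>lebesgue)"
      unfolding mass_square
    proof (rule lebesgue_integral_mono[OF X0D(6)[OF w]])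
      show "integrable lebesgue (\<lambda>x. \<Sum>Q\<in>\<Q>. f Q x)" using fi by (intro Bochner_Integration.integrable_sum)
      fix x
      show "(restr w x)\<^sup>2 \<le> (\<Sum>Q\<in>\<Q>. f Q x)"
      proof (cases "x \<in> \<Omega>")
        case True
        then obtain P where P: "P \<in> \<Q>" "x \<in> P" using Q(3) by blast
        have "(restr w x)\<^sup>2 = f P x" using P by (simp add: f_def v_def)
        also have "\<dots> \<le> (\<Sum>Q\<in>\<Q>. f Q x)"
          using Q(1) P(1) by (intro member_le_sum) (auto simp: f_def)
        finally show ?thesis .
      next
        case False
        then show ?thesis by (simp add: restr_def f_def sum_nonneg)
      qed
    qed
    also have "\<dots> = (\<Sum>Q\<in>\<Q>. \<integral>x. f Q x \<partial>lebesgue)" using fi by (rule Bochner_Integration.integral_sum)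
    finally have 2: "mass w w \<le> (\<Sum>Q\<in>\<Q>. \<integral>x. f Q x \<partial>lebesgue)" .
    have "2 * \<kappa> * h ^ CARD('n) * mass w w \<le> 2 * \<kappa> * h ^ CARD('n) * (\<Sum>Q\<in>\<Q>. \<integral>x. f Q x \<partial>lebesgue)"
      using \<kappa> h 2 by (intro mult_left_mono) auto
    also have "\<dots> \<le> (\<Sum>Q\<in>\<Q>. 2 * \<kappa> * measure lebesgue Q * (\<integral>x. f Q x \<partial>lebesgue))"
      unfolding sum_distrib_left using \<kappa> Q(5) fn by (intro sum_mono mult_right_mono) auto
    also have "\<dots> \<le> energy w w + 2 * \<kappa> * (\<Sum>Q\<in>\<Q>. (cell_integral Q w)\<^sup>2)"
      using 1 by (simp add: sum_distrib_left sum_subtractf right_diff_distrib mult.assoc mult.left_commute)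
    finally have "\<epsilon> * (2 * \<kappa> * h ^ CARD('n) * mass w w) \<le> \<epsilon> * (energy w w + 2 * \<kappa> * (\<Sum>Q\<in>\<Q>. (cell_integral Q w)\<^sup>2))"
      using eps by (intro mult_left_mono) auto
    moreover have "\<epsilon> * (2 * \<kappa> * h ^ CARD('n) * mass w w) = (2 * \<epsilon> * (\<kappa> * h ^ CARD('n))) * mass w w"
      by simp
    ultimately have "mass w w \<le> \<epsilon> * (energy w w + 2 * \<kappa> * (\<Sum>Q\<in>\<Q>. (cell_integral Q w)\<^sup>2))"
      unfolding choice by simp
    then show ?thesis by (simp add: algebra_simps)
  qed
  moreover have "0 < 2 * \<epsilon> * \<kappa>" using eps \<kappa> by simp
  ultimately show ?thesis using Q(1,2,4) by blast
qed

lemma cell_integral_abs_le: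
  assumes u: "u \<in> X0_space K \<Omega>" and Q: "Q \<in> sets lebesgue"
  shows "\<bar>cell_integral Q u\<bar> \<le> (\<integral>x. \<bar>restr u x\<bar> \<partial>lebesgue)"
proof -
  have i: "integrable lebesgue (\<lambda>x. indicator Q x * restr u x)"
    using integrable_mult_indicator[OF Q integrable_restr[OF u]] by simp
  have "\<bar>cell_integral Q u\<bar> \<le> (\<integral>x. \<bar>indicator Q x * restr u x\<bar> \<partial>lebesgue)"
    unfolding cell_integral_def by (rule integral_abs_bound)
  also have "\<dots> \<le> (\<integral>x. \<bar>restr u x\<bar> \<partial>lebesgue)"
    using i integrable_restr[OF u] by (intro lebesgue_integral_mono integrable_abs) (auto simp: indicator_def)
  finally show ?thesis .
qed

lemma cell_integral_diff:
  assumes u: "u \<in> X0_space K \<Omega>" "v \<in> X0_space K \<Omega>" and Q: "Q \<in> sets lebesgue"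
  shows "cell_integral Q (\<lambda>x. u x - v x) = cell_integral Q u - cell_integral Q v"
  using integrable_mult_indicator[OF Q integrable_restr[OF u(1)]] integrable_mult_indicator[OF Q integrable_restr[OF u(2)]]
  by (simp add: cell_integral_def restr_diff right_diff_distrib)

text \<open>
  Apply the cube inequality with \<open>\<epsilon> * M \<le> 1/2\<close>, so that half of the mass absorbs the energy term. For a
  nonnegative function the sum of the squared integrals over disjoint cubes is at most the square of
  the full integral.
\<close>
lemma nash:
  "\<exists>c>0. \<forall>w\<in>X0_space K \<Omega>. (\<forall>x. 0 \<le> w x) \<longrightarrow> energy w w \<le> M * mass w w \<longrightarrow>
    c * mass w w \<le> (\<integral>x. restr w x \<partial>lebesgue)\<^sup>2"
proof -
  define \<epsilon> where "\<epsilon> = 1 / (2 * (\<bar>M\<bar> + 1))"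
  have eps: "0 < \<epsilon>" by (simp add: \<epsilon>_def)
  have epsM: "\<epsilon> * M \<le> 1 / 2" by (simp add: \<epsilon>_def field_simps)
  obtain \<Q> C where Q: "finite \<Q>" "disjoint \<Q>" "\<And>Q. Q \<in> \<Q> \<Longrightarrow> Q \<in> lmeasurable" and C: "0 < C"
    and ineq: "\<And>w. w \<in> X0_space K \<Omega> \<Longrightarrow> mass w w \<le> \<epsilon> * energy w w + C * (\<Sum>Q\<in>\<Q>. (cell_integral Q w)\<^sup>2)"
    using cube_inequality[OF eps] by blast
  have "(1 / (2 * C)) * mass w w \<le> (\<integral>x. restr w x \<partial>lebesgue)\<^sup>2"
    if w: "w \<in> X0_space K \<Omega>" and w0: "\<forall>x. 0 \<le> w x" and wM: "energy w w \<le> M * mass w w" for w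
  proof -
    have Qs: "Q \<in> sets lebesgue" if "Q \<in> \<Q>" for Q using Q(3)[OF that] by blast
    have r0: "0 \<le> restr w x" for x using w0 by (simp add: restr_def)
    have i: "integrable lebesgue (\<lambda>x. indicator Q x * restr w x)" if "Q \<in> \<Q>" for Q
      using integrable_mult_indicator[OF Qs[OF that] integrable_restr[OF w]] by simp
    have a0: "0 \<le> cell_integral Q w" for Q unfolding cell_integral_def by (rule integral_nonneg_AE) (simp add: r0)
    have S: "(\<Sum>Q\<in>\<Q>. cell_integral Q w) \<le> (\<integral>x. restr w x \<partial>lebesgue)"
    proof -
      have "(\<Sum>Q\<in>\<Q>. cell_integral Q w) = (\<integral>x. (\<Sum>Q\<in>\<Q>. indicator Q x * restr w x) \<partial>lebesgue)"
        unfolding cell_integral_def by (rule Bochner_Integration.integral_sum[symmetric]) (rule i)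
      also have "\<dots> \<le> (\<integral>x. restr w x \<partial>lebesgue)"
      proof (rule lebesgue_integral_mono)
        show "integrable lebesgue (\<lambda>x. \<Sum>Q\<in>\<Q>. indicator Q x * restr w x)"
          by (rule Bochner_Integration.integrable_sum) (rule i)
        show "integrable lebesgue (restr w)" by (rule integrable_restr[OF w])
        fix x
        show "(\<Sum>Q\<in>\<Q>. indicator Q x * restr w x) \<le> restr w x"
        proof (cases "\<exists>P\<in>\<Q>. x \<in> P")
          case True
          then obtain P where P: "P \<in> \<Q>" "x \<in> P" by blast
          have "(\<Sum>Q\<in>\<Q>. indicator Q x * restr w x) = (\<Sum>Q\<in>\<Q>. if Q = P then restr w x else 0)"
            using P Q(2) by (intro sum.cong) (auto simp: indicator_def disjoint_def)
          also have "\<dots> = restr w x" using Q(1) P(1) by simp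
          finally show ?thesis by simp
        next
          case False
          then have "(\<Sum>Q\<in>\<Q>. indicator Q x * restr w x) = 0" by (intro sum.neutral) auto
          then show ?thesis using r0 by simp
        qed
      qed
      finally show ?thesis .
    qed
    have "(\<Sum>Q\<in>\<Q>. (cell_integral Q w)\<^sup>2) \<le> (\<Sum>Q\<in>\<Q>. cell_integral Q w * (\<Sum>Q\<in>\<Q>. cell_integral Q w))"
      unfolding power2_eq_square using Q(1) a0 by (intro sum_mono mult_left_mono member_le_sum) auto
    also have "\<dots> = (\<Sum>Q\<in>\<Q>. cell_integral Q w)\<^sup>2" by (simp add: sum_distrib_right power2_eq_square)
    also have "\<dots> \<le> (\<integral>x. restr w x \<partial>lebesgue)\<^sup>2" using S a0 by (intro power_mono sum_nonneg) auto
    finally have sq: "C * (\<Sum>Q\<in>\<Q>. (cell_integral Q w)\<^sup>2) \<le> C * (\<integral>x. restr w x \<partial>lebesgue)\<^sup>2"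
      using C by (intro mult_left_mono) auto
    have "\<epsilon> * energy w w \<le> \<epsilon> * (M * mass w w)" using eps wM by (intro mult_left_mono) auto
    also have "\<dots> \<le> (1 / 2) * mass w w"
      using mult_right_mono[OF epsM H.nonneg[OF w]] by (simp add: mult.assoc)
    finally have "mass w w / 2 \<le> C * (\<integral>x. restr w x \<partial>lebesgue)\<^sup>2" using ineq[OF w] sq by simp
    then show ?thesis using C by (simp add: field_simps)
  qed
  then show ?thesis using C by (intro exI[of _ "1 / (2 * C)"]) auto
qed

text \<open>
  The integrals over the countably many cubes of all the grids are bounded, so a diagonal subsequence
  makes all of them converge. The cube inequality for the grid with \<open>\<epsilon> = 1 / Suc j\<close> then controls the
  mass of differences.
\<close>
lemma X0_compact:
  assumes F: "\<And>k::nat. F k \<in> X0_space K \<Omega>" and M: "\<And>k. energy (F k) (F k) \<le> M"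
  shows "\<exists>r::nat \<Rightarrow> nat. strict_mono r \<and> (\<forall>\<epsilon>>0. \<exists>n. \<forall>k\<ge>n. \<forall>l\<ge>n.
    mass (\<lambda>x. F (r k) x - F (r l) x) (\<lambda>x. F (r k) x - F (r l) x) < \<epsilon>)"
proof -
  obtain C where C: "0 < C" "\<And>u. u \<in> X0_space K \<Omega> \<Longrightarrow> mass u u \<le> C * energy u u"
    using poincare by blast
  have M0: "0 \<le> M" using M[of 0] E.nonneg[OF F[of 0]] by linarith
  define V where "V = measure lebesgue \<Omega>"
  have L1: "(\<integral>x. \<bar>restr (F k) x\<bar> \<partial>lebesgue) \<le> sqrt (V * (C * M))" for k
  proof (rule real_le_rsqrt)
    have "(\<integral>x. \<bar>restr (F k) x\<bar> \<partial>lebesgue)\<^sup>2 \<le> V * mass (F k) (F k)"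
      using L1_le_mass[OF F] by (simp add: V_def)
    also have "\<dots> \<le> V * (C * M)"
      by (intro mult_left_mono order_trans[OF C(2)[OF F]] M) (use C(1) in \<open>auto simp: V_def\<close>)
    finally show "(\<integral>x. \<bar>restr (F k) x\<bar> \<partial>lebesgue)\<^sup>2 \<le> V * (C * M)" .
  qed
  have "\<forall>j::nat. \<exists>\<Q> c. finite \<Q> \<and> (\<forall>Q\<in>\<Q>. Q \<in> sets lebesgue) \<and> 0 < c \<and>
    (\<forall>w\<in>X0_space K \<Omega>. mass w w \<le> (1 / Suc j) * energy w w + c * (\<Sum>Q\<in>\<Q>. (cell_integral Q w)\<^sup>2))"
  proof
    fix j
    show "\<exists>\<Q> c. finite \<Q> \<and> (\<forall>Q\<in>\<Q>. Q \<in> sets lebesgue) \<and> 0 < c \<and>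
      (\<forall>w\<in>X0_space K \<Omega>. mass w w \<le> (1 / Suc j) * energy w w + c * (\<Sum>Q\<in>\<Q>. (cell_integral Q w)\<^sup>2))"
      using cube_inequality[of "1 / Suc j"] fmeasurableD by (metis of_nat_0_less_iff zero_less_Suc zero_less_divide_1_iff)
  qed
  then obtain \<Q> c where Q: "\<And>j. finite (\<Q> j)" "\<And>j Q. Q \<in> \<Q> j \<Longrightarrow> Q \<in> sets lebesgue"
    and c: "\<And>j::nat. 0 < c j"
    and ineq: "\<And>j w. w \<in> X0_space K \<Omega> \<Longrightarrow>
      mass w w \<le> (1 / Suc j) * energy w w + c j * (\<Sum>Q\<in>\<Q> j. (cell_integral Q w)\<^sup>2)"
    by metis
  obtain r :: "nat \<Rightarrow> nat" where r: "strict_mono r"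
    and lim: "\<And>Q. Q \<in> (\<Union>j. \<Q> j) \<Longrightarrow> \<exists>l. (\<lambda>k. cell_integral Q (F (r k))) \<longlonglongrightarrow> l"
  proof (rule function_convergent_subsequence[of "\<Union>j. \<Q> j" "\<lambda>k Q. cell_integral Q (F k)" "sqrt (V * (C * M))"])
    show "countable (\<Union>j. \<Q> j)" using Q(1) by (intro countable_UN) (auto intro: countable_finite)
    show "norm (cell_integral Q (F k)) \<le> sqrt (V * (C * M))" if "Q \<in> (\<Union>j. \<Q> j)" for k Q
      using cell_integral_abs_le[OF F, of Q k] L1[of k] Q(2) that by fastforce
  qed blast
  have "\<exists>n. \<forall>k\<ge>n. \<forall>l\<ge>n. mass (\<lambda>x. F (r k) x - F (r l) x) (\<lambda>x. F (r k) x - F (r l) x) < \<epsilon>"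
    if eps: "0 < \<epsilon>" for \<epsilon>
  proof -
    obtain j where j: "1 / Suc j < \<epsilon> / (2 * (4 * M + 1))"
      using nat_approx_posE[of "\<epsilon> / (2 * (4 * M + 1))"] eps M0 by auto
    define A where "A = real (card (\<Q> j)) + 1"
    have A: "0 < A" by (simp add: A_def)
    define \<delta> where "\<delta> = sqrt (\<epsilon> / (2 * c j * A))"
    have \<delta>: "0 < \<delta>" using eps c[of j] A by (simp add: \<delta>_def)
    have "\<forall>Q\<in>\<Q> j. \<exists>n. \<forall>k\<ge>n. \<forall>l\<ge>n. \<bar>cell_integral Q (F (r k)) - cell_integral Q (F (r l))\<bar> < \<delta>"
    proof
      fix Q assume "Q \<in> \<Q> j"
      then have "Cauchy (\<lambda>k. cell_integral Q (F (r k)))"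
        using lim[of Q] by (metis UN_I UNIV_I LIMSEQ_imp_Cauchy)
      then show "\<exists>n. \<forall>k\<ge>n. \<forall>l\<ge>n. \<bar>cell_integral Q (F (r k)) - cell_integral Q (F (r l))\<bar> < \<delta>"
        using \<delta> by (simp add: Cauchy_def dist_real_def)
    qed
    then obtain n where n: "\<And>Q k l. Q \<in> \<Q> j \<Longrightarrow> k \<ge> n Q \<Longrightarrow> l \<ge> n Q \<Longrightarrow> \<bar>cell_integral Q (F (r k)) - cell_integral Q (F (r l))\<bar> < \<delta>"
      by metis
    define N where "N = Max (insert 0 (n ` \<Q> j))"
    have N: "n Q \<le> N" if "Q \<in> \<Q> j" for Q using Q(1) that by (simp add: N_def)
    have "mass (\<lambda>x. F (r k) x - F (r l) x) (\<lambda>x. F (r k) x - F (r l) x) < \<epsilon>" if k: "k \<ge> N" and l: "l \<ge> N" for k l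
    proof -
      let ?w = "\<lambda>x. F (r k) x - F (r l) x"
      have w: "?w \<in> X0_space K \<Omega>" by (intro E.mem F)
      have "E.nrm ?w \<le> sqrt M + sqrt M"
        using E.nrm_diff[OF F F, of "r k" "r l"] M by (simp add: E.nrm_def) (smt (verit) real_sqrt_le_mono)
      then have "(E.nrm ?w)\<^sup>2 \<le> (2 * sqrt M)\<^sup>2" using w by (intro power_mono) auto
      then have e4: "energy ?w ?w \<le> 4 * M" using M0 by (simp add: E.nrm_square[OF w])
      have "(1 / Suc j) * energy ?w ?w \<le> (\<epsilon> / (2 * (4 * M + 1))) * (4 * M)"
        using j e4 E.nonneg[OF w] eps M0 by (intro mult_mono) auto
      also have "\<dots> \<le> \<epsilon> / 2" using eps M0 by (simp add: field_simps)
      finally have 1: "(1 / Suc j) * energy ?w ?w \<le> \<epsilon> / 2" .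
      have "(\<Sum>Q\<in>\<Q> j. (cell_integral Q ?w)\<^sup>2) \<le> (\<Sum>Q\<in>\<Q> j. \<delta>\<^sup>2)"
      proof (rule sum_mono)
        fix P assume P: "P \<in> \<Q> j"
        have "\<bar>cell_integral P ?w\<bar> \<le> \<bar>\<delta>\<bar>"
          using n[OF P, of k l] N[OF P] k l \<delta> by (simp add: cell_integral_diff[OF F F Q(2)[OF P]])
        then show "(cell_integral P ?w)\<^sup>2 \<le> \<delta>\<^sup>2" by (simp add: abs_le_square_iff)
      qed
      also have "\<dots> < A * \<delta>\<^sup>2" using \<delta> by (simp add: A_def)
      finally have "c j * (\<Sum>Q\<in>\<Q> j. (cell_integral Q ?w)\<^sup>2) < c j * (A * \<delta>\<^sup>2)" using c[of j] by simp
      also have "\<dots> = \<epsilon> / 2" using eps c[of j] A by (simp add: \<delta>_def)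
      finally show ?thesis using 1 ineq[OF w, of j] by linarith
    qed
    then show ?thesis by blast
  qed
  then show ?thesis using r by blast
qed

end

context fractional_setting begin

section \<open>Existence of admissible paths\<close>

definition bump :: "real ^ 'n \<Rightarrow> real \<Rightarrow> real ^ 'n \<Rightarrow> real" where
  "bump a r x = max 0 (r - dist x a)"

lemma bump_continuous: "continuous_on UNIV (bump a r)"
  unfolding bump_def[abs_def] by (intro continuous_intros)

text \<open>
  A bump is bounded and Lipschitz, so \<open>(b x - b y)\<^sup>2 * K (x - y)\<close> is dominated by a multiple of the integrable
  weight \<open>min |z|\<^sup>2 1 * K z\<close> at \<open>z = x - y\<close>, with \<open>x\<close> or \<open>y\<close> in the bounded domain.
\<close>
lemma bump_X0:
  assumes r: "0 < r" and sub: "ball a r \<subseteq> \<Omega>"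
  shows "bump a r \<in> X0_space K \<Omega>"
  unfolding X0_iff
proof (intro conjI)
  let ?b = "bump a r"
  have b0: "?b x = 0" if "x \<notin> \<Omega>" for x
  proof -
    have "x \<notin> ball a r" using sub that by blast
    then show ?thesis by (simp add: bump_def dist_commute)
  qed
  have br: "0 \<le> ?b x" "?b x \<le> r" for x using r by (auto simp: bump_def)
  have lip: "\<bar>?b x - ?b y\<bar> \<le> norm (x - y)" for x y
    using dist_triangle[of x a y] dist_triangle[of y a x] by (auto simp: bump_def dist_norm norm_minus_commute)
  show bm: "?b \<in> borel_measurable lebesgue"
    by (rule measurable_completion) (simp add: borel_measurable_continuous_onI[OF bump_continuous])
  show "AE x in lebesgue. x \<notin> \<Omega> \<longrightarrow> ?b x = 0" using b0 by simp
  have "integrable lebesgue (\<lambda>x. (restr ?b x)\<^sup>2)"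
  proof (rule Bochner_Integration.integrable_bound)
    show "integrable lebesgue (\<lambda>x. r\<^sup>2 * indicator \<Omega> x :: real)" by simp
    show "(\<lambda>x. (restr ?b x)\<^sup>2) \<in> borel_measurable lebesgue" using restr_measurable[OF bm] by simp
    show "AE x in lebesgue. norm ((restr ?b x)\<^sup>2) \<le> norm (r\<^sup>2 * indicator \<Omega> x :: real)"
      using br by (auto simp: restr_def indicator_def power_mono)
  qed
  then show "restr ?b \<in> L2_functions lebesgue" using restr_measurable[OF bm] by (simp add: L2_functions_def)
  let ?k = "\<lambda>x. min ((norm x)\<^sup>2) 1 * K x"
  let ?c = "max 1 (r\<^sup>2)"
  have k0: "0 \<le> ?k x" for x using K_pos[of x] by (cases "x = 0") auto
  have "integrable lebesgue (\<lambda>z. (energy_density ?b z)\<^sup>2)"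
  proof (rule Bochner_Integration.integrable_bound)
    show "integrable lebesgue (\<lambda>z. ?c * (indicator \<Omega> (fst z) * ?k (fst z - snd z) + indicator \<Omega> (snd z) * ?k (fst z - snd z)))"
      using integrable_convolution[OF K_weighted dom_lmeasurable] by simp
    show "(\<lambda>z. (energy_density ?b z)\<^sup>2) \<in> borel_measurable lebesgue" using energy_density_measurable[OF bm] by simp
    have "(energy_density ?b z)\<^sup>2 \<le> ?c * (indicator \<Omega> (fst z) * ?k (fst z - snd z) + indicator \<Omega> (snd z) * ?k (fst z - snd z))"
      (is "_ \<le> ?R") for z
    proof -
      let ?w = "fst z - snd z" and ?d = "?b (fst z) - ?b (snd z)"
      have d1: "?d\<^sup>2 \<le> (norm ?w)\<^sup>2" using lip by (metis abs_le_square_iff abs_norm_cancel)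
      have "\<bar>?d\<bar> \<le> \<bar>r\<bar>" using br[of "fst z"] br[of "snd z"] by linarith
      then have d2: "?d\<^sup>2 \<le> r\<^sup>2" by (simp add: abs_le_square_iff)
      have d: "?d\<^sup>2 \<le> ?c * min ((norm ?w)\<^sup>2) 1"
      proof (cases "(norm ?w)\<^sup>2 \<le> 1")
        case True
        have "1 * (norm ?w)\<^sup>2 \<le> ?c * (norm ?w)\<^sup>2" by (intro mult_right_mono) auto
        then show ?thesis using True d1 by simp
      next
        case False
        then show ?thesis using d2 by (simp add: max_def min_def)
      qed
      have main: "?d\<^sup>2 * K ?w \<le> ?c * ?k ?w"
      proof (cases "?w = 0")
        case False
        then show ?thesis using mult_right_mono[OF d, of "K ?w"] K_pos[of ?w] by (simp add: mult.assoc)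
      qed simp
      have "(energy_density ?b z)\<^sup>2 \<le> indicator (Q_set \<Omega>) z * (?c * ?k ?w)"
        unfolding energy_density_square by (intro mult_left_mono main) simp
      also have "\<dots> \<le> (indicator \<Omega> (fst z) + indicator \<Omega> (snd z)) * (?c * ?k ?w)"
        using k0[of ?w] by (intro mult_right_mono) (auto simp: indicator_def mem_Q_set)
      also have "\<dots> = ?R" by (simp add: algebra_simps)
      finally show ?thesis .
    qed
    then show "AE z in lebesgue. norm ((energy_density ?b z)\<^sup>2)
        \<le> norm (?c * (indicator \<Omega> (fst z) * ?k (fst z - snd z) + indicator \<Omega> (snd z) * ?k (fst z - snd z)))"
      by (intro AE_I2) (simp, smt (verit))
  qed
  then show "energy_density ?b \<in> L2_functions lebesgue" using energy_density_measurable[OF bm] by (simp add: L2_functions_def)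
qed

lemma AE_eq_continuous:
  fixes f g :: "real ^ 'n \<Rightarrow> real"
  assumes "continuous_on UNIV f" "continuous_on UNIV g" and ae: "AE x in lebesgue. f x = g x"
  shows "f x = g x"
proof (rule ccontr)
  assume ne: "f x \<noteq> g x"
  let ?S = "{x. f x \<noteq> g x}"
  have "open ?S" using open_Collect_neq[of f g] assms(1,2) by simp
  moreover have "?S \<noteq> {}" using ne by blast
  ultimately have "\<not> negligible ?S" by (rule open_not_negligible)
  moreover have "?S \<in> null_sets lebesgue"
    using ae by (simp add: completion.AE_iff_null_sets)
  ultimately show False by (simp add: negligible_iff_null_sets)
qed

text \<open>
  Two concentric bumps of different radii cannot both be multiples of the same function, as they
  would be multiples of each other.
\<close>
lemma exists_independent:
  assumes \<phi>: "\<phi> \<in> X0_space K \<Omega>"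
  shows "\<exists>e\<in>X0_space K \<Omega>. \<forall>a. mass (\<lambda>x. e x - a * \<phi> x) (\<lambda>x. e x - a * \<phi> x) \<noteq> 0"
proof (rule ccontr)
  assume none: "\<not> ?thesis"
  obtain a where a: "a \<in> \<Omega>" using nonempty_dom by blast
  then obtain r where r: "0 < r" "ball a r \<subseteq> \<Omega>" using open_dom by (auto simp: open_contains_ball)
  have half: "ball a (r / 2) \<subseteq> \<Omega>" using r by (auto simp: subset_iff)
  have X: "bump a r \<in> X0_space K \<Omega>" "bump a (r / 2) \<in> X0_space K \<Omega>"
    using r half by (auto intro!: bump_X0)
  have mult: "\<exists>c. AE x in lebesgue. e x = c * \<phi> x" if e: "e \<in> X0_space K \<Omega>" for e
  proof -
    obtain c where "mass (\<lambda>x. e x - c * \<phi> x) (\<lambda>x. e x - c * \<phi> x) = 0" using none e by blast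
    then have "AE x in lebesgue. e x - c * \<phi> x = 0"
      using mass_zero_iff[OF E.diff_mem[OF e E.scale_mem[OF \<phi>]]] by blast
    then show ?thesis by auto
  qed
  obtain c d where c: "AE x in lebesgue. bump a r x = c * \<phi> x"
    and d: "AE x in lebesgue. bump a (r / 2) x = d * \<phi> x"
    using mult[OF X(1)] mult[OF X(2)] by blast
  have eq: "d * bump a r x = c * bump a (r / 2) x" for x
  proof (rule AE_eq_continuous)
    show "AE x in lebesgue. d * bump a r x = c * bump a (r / 2) x"
      using c d by eventually_elim simp
  qed (intro continuous_on_mult continuous_on_const bump_continuous)+
  \<comment> \<open>at this distance from the centre the smaller bump vanishes and the larger one does not\<close>
  obtain v :: "real^'n" where v: "norm v = 3 * r / 4" using vector_choose_size[of "3 * r / 4"] r by auto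
  have "d * (r / 4) = 0" using eq[of "a + v"] v r by (simp add: bump_def dist_norm)
  then have d0: "d = 0" using r by simp
  have "bump a (r / 2) a = 0 * bump a (r / 2) a"
    by (rule AE_eq_continuous[where f = "bump a (r / 2)" and g = "\<lambda>x. 0 * bump a (r / 2) x"])
      (use d d0 in \<open>auto intro!: bump_continuous\<close>)
  then show False using r by (simp add: bump_def)
qed

section \<open>The minimax level lies on the Fucik spectrum\<close>

lemma norm_eq: "X0_norm K \<Omega> u = sqrt (energy u u)"
  by (simp add: X0_norm_def energy_def power2_eq_square split_beta abs_mult_self_eq flip: abs_mult)

lemma norm_square: "u \<in> X0_space K \<Omega> \<Longrightarrow> (X0_norm K \<Omega> u)\<^sup>2 = energy u u"
  by (simp add: norm_eq E.nonneg)

lemma sphere_eq: "unit_sphere K \<Omega> = {u \<in> X0_space K \<Omega>. mass u u = 1}"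
  by (simp add: unit_sphere_def mass_def power2_eq_square)

lemma first_eigenvalue_le:
  assumes u: "u \<in> X0_space K \<Omega>"
  shows "first_eigenvalue K \<Omega> * mass u u \<le> energy u u"
proof (cases "mass u u = 0")
  case True
  then show ?thesis using E.nonneg[OF u] by simp
next
  case False
  then have m: "0 < mass u u" using H.nonneg[OF u] by simp
  define a where "a = 1 / sqrt (mass u u)"
  have a2: "a\<^sup>2 = 1 / mass u u" using m by (simp add: a_def power_divide)
  let ?v = "\<lambda>x. a * u x"
  have vX: "?v \<in> X0_space K \<Omega>" by (rule E.scale_mem[OF u])
  have "mass ?v ?v = 1" "energy ?v ?v = energy u u / mass u u"
    using a2 m u vX by (simp_all add: H.scale_left H.scale_right E.scale_left E.scale_right
        power2_eq_square mult.assoc[symmetric])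
  then have v: "?v \<in> unit_sphere K \<Omega>" "(X0_norm K \<Omega> ?v)\<^sup>2 = energy u u / mass u u"
    using vX by (auto simp: sphere_eq norm_square)
  have "first_eigenvalue K \<Omega> \<le> (X0_norm K \<Omega> ?v)\<^sup>2"
    unfolding first_eigenvalue_def
    by (rule cINF_lower[OF _ v(1)]) (auto intro!: bdd_belowI2[where m = 0])
  then show ?thesis using m by (simp add: v(2) field_simps)
qed

lemma mass_cong_AE:
  assumes eq: "AE x in lebesgue. u x = v x"
    and [measurable]: "u \<in> borel_measurable lebesgue" "v \<in> borel_measurable lebesgue"
      "w \<in> borel_measurable lebesgue"
  shows "mass u w = mass v w"
  unfolding mass_eq
  by (intro integral_cong_AE borel_measurable_times restr_measurable)
    (use eq in \<open>auto simp: restr_def elim!: eventually_mono\<close>)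

text \<open>
  The space \<open>X\<^sub>0\<close> with its energy and the \<open>L\<^sup>2\<close> product is an instance of the minimax setting, in which
  equality almost everywhere becomes vanishing mass of the difference.
\<close>
lemma fucik_from_minimax:
  assumes \<phi>: "first_eigenfunction K \<Omega> \<phi>" and p: "0 \<le> p"
  shows "first_eigenvalue K \<Omega> < minimax_level K \<Omega> \<phi> p \<and>
    (p + minimax_level K \<Omega> \<phi> p, minimax_level K \<Omega> \<phi> p) \<in> fucik_spectrum K \<Omega>"
proof -
  let ?V = "X0_space K \<Omega>" and ?lam = "first_eigenvalue K \<Omega>"
  have phiX: "\<phi> \<in> ?V" and phi1: "mass \<phi> \<phi> = 1" and phi0: "AE x in lebesgue. 0 \<le> \<phi> x"
    and phiE: "\<And>v. v \<in> ?V \<Longrightarrow> energy \<phi> v = ?lam * mass \<phi> v"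
    using \<phi> by (auto simp: first_eigenfunction_def sphere_eq energy_def mass_def)
  obtain C where C: "0 < C" "\<And>u. u \<in> ?V \<Longrightarrow> mass u u \<le> C * energy u u" using poincare by blast
  obtain e where e: "e \<in> ?V" "\<And>a. mass (\<lambda>x. e x - a * \<phi> x) (\<lambda>x. e x - a * \<phi> x) \<noteq> 0"
    using exists_independent[OF phiX] by blast
  have negX: "(\<lambda>x. - \<phi> x) \<in> ?V" by (rule E.uminus_mem[OF phiX])
  interpret M: minimax_setting ?V energy mass C p ?lam \<phi> e
  proof unfold_locales
    show "mass (pos f) f = mass (pos f) (pos f)" for f by (rule mass_pos_self)
    show "mass (pos \<phi>) v = mass \<phi> v" if "v \<in> ?V" for v
      by (rule mass_cong_AE[OF _ X0D(1)[OF X0_pos[OF phiX]] X0D(1)[OF phiX] X0D(1)[OF that]])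
        (use phi0 in \<open>auto simp: pos_def elim!: eventually_mono\<close>)
    show "mass (pos (\<lambda>x. - \<phi> x)) v = 0" if "v \<in> ?V" for v
    proof -
      have "mass (pos (\<lambda>x. - \<phi> x)) v = mass (\<lambda>_. 0) v"
        by (rule mass_cong_AE[OF _ X0D(1)[OF X0_pos[OF negX]] X0D(1)[OF E.zero_mem] X0D(1)[OF that]])
          (use phi0 in \<open>auto simp: pos_def elim!: eventually_mono\<close>)
      then show ?thesis by (simp add: mass_def)
    qed
  qed (fact C p energy_null X0_complete X0_compact X0_pos mass_pos_contraction
      mass_pos_convex phiX phi1 phiE e)+
  have J_eq: "J_functional K \<Omega> p u = M.J u" if "u \<in> ?V" for u
    unfolding J_functional_def M.J_def norm_square[OF that]
    by (simp add: mass_def pos_def power2_eq_square)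
  have paths_eq: "admissible_paths K \<Omega> \<phi> = M.paths"
  proof -
    have null: "H.nrm (\<lambda>x. u x - w x) = 0 \<longleftrightarrow> (AE x in lebesgue. u x = w x)" if "u \<in> ?V" "w \<in> ?V" for u w
      using mass_zero_iff[OF E.diff_mem[OF that]] by (simp add: H.nrm_def)
    have "\<gamma> \<in> admissible_paths K \<Omega> \<phi> \<longleftrightarrow> \<gamma> \<in> M.paths" for \<gamma>
    proof -
      have "(\<forall>t\<in>{-1..1}. \<gamma> t \<in> unit_sphere K \<Omega>) \<longleftrightarrow> (\<forall>t\<in>{-1..1}. \<gamma> t \<in> M.sphere)"
        by (simp add: sphere_eq M.sphere_def)
      moreover have "(AE x in lebesgue. \<gamma> (-1) x = - \<phi> x) \<longleftrightarrow> H.nrm (\<lambda>x. \<gamma> (-1) x - (- \<phi> x)) = 0"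
        "(AE x in lebesgue. \<gamma> 1 x = \<phi> x) \<longleftrightarrow> H.nrm (\<lambda>x. \<gamma> 1 x - \<phi> x) = 0"
        if "\<forall>t\<in>{-1..1}. \<gamma> t \<in> M.sphere"
        using null[OF _ negX, of "\<gamma> (-1)"] null[OF _ phiX, of "\<gamma> 1"] that by (auto simp: M.sphere_def)
      ultimately show ?thesis
        unfolding admissible_paths_def M.paths_def mem_Collect_eq E.cts_path_def E.nrm_def norm_eq
        by (auto simp: M.sphere_def)
    qed
    then show ?thesis by blast
  qed
  have level_eq: "minimax_level K \<Omega> \<phi> p = M.level"
    unfolding minimax_level_def M.level_def paths_eq
  proof (intro INF_cong SUP_cong refl J_eq)
    fix \<gamma> u assume "\<gamma> \<in> M.paths" "u \<in> \<gamma> ` {-1..1}"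
    then show "u \<in> ?V" by (auto simp: M.paths_def M.sphere_def)
  qed
  obtain \<kappa> where \<kappa>: "0 < \<kappa>" "\<And>u. u \<in> ?V \<Longrightarrow> energy (pos u) (pos u) + energy (pos (\<lambda>x. - u x)) (pos (\<lambda>x. - u x))
     + \<kappa> * (\<integral>x. restr (pos u) x \<partial>lebesgue) * (\<integral>x. restr (pos (\<lambda>x. - u x)) x \<partial>lebesgue) \<le> energy u u"
    using interaction by blast
  have "?lam < M.level"
  proof (rule M.level_gap[where m = "\<lambda>w. \<integral>x. restr w x \<partial>lebesgue", OF \<kappa>(1) nash _ \<kappa>(2) mass_split first_eigenvalue_le])
    show "0 \<le> (\<integral>x. restr w x \<partial>lebesgue)" if "\<forall>x. 0 \<le> w x" for w
      using that by (intro integral_nonneg_AE) (simp add: restr_def)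
  qed
  moreover have "(p + M.level, M.level) \<in> fucik_spectrum K \<Omega>"
  proof -
    obtain u where u: "u \<in> M.sphere"
      and crit: "\<And>v. v \<in> ?V \<Longrightarrow> energy u v = p * mass (pos u) v + M.level * mass u v"
      using M.minimax_critical by blast
    have uX: "u \<in> ?V" and u1: "mass u u = 1" using u by (auto simp: M.sphere_def)
    have nX: "(\<lambda>x. - u x) \<in> ?V" by (rule E.uminus_mem[OF uX])
    have "energy u v = (p + M.level) * mass (pos u) v - M.level * mass (pos (\<lambda>x. - u x)) v" if v: "v \<in> ?V" for v
    proof -
      have "u = (\<lambda>x. pos u x - pos (\<lambda>x. - u x) x)" by (auto simp: pos_def)
      then have mv: "mass u v = mass (pos u) v - mass (pos (\<lambda>x. - u x)) v"
        using H.diff_left[OF X0_pos[OF uX] X0_pos[OF nX] v] by simp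
      show ?thesis unfolding crit[OF v] mv by (simp add: algebra_simps)
    qed
    then have "fucik_weak_solution K \<Omega> (p + M.level) M.level u"
      unfolding fucik_weak_solution_def using uX by (simp add: energy_def mass_def pos_def)
    moreover have "\<not> (AE x in lebesgue. u x = 0)" using mass_zero_iff[OF uX] u1 by simp
    ultimately show ?thesis by (auto simp: fucik_spectrum_def)
  qed
  ultimately show ?thesis by (simp add: level_eq)
qed

end

theorem theorem2p9:
  fixes s p :: real
    and \<Omega> :: "(real ^ 'n::finite) set"
    and K :: "real ^ 'n \<Rightarrow> real"
    and \<phi>\<^sub>1 :: "real ^ 'n \<Rightarrow> real"
  assumes "0 < s" and "s < 1" and "real CARD('n) > 2 * s"
    and "bounded_lipschitz_domain \<Omega>"
    and "admissible_kernel s K"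
    and "first_eigenfunction K \<Omega> \<phi>\<^sub>1"
    and "p \<ge> 0"
  shows "minimax_level K \<Omega> \<phi>\<^sub>1 p > first_eigenvalue K \<Omega> \<and>
    (p + minimax_level K \<Omega> \<phi>\<^sub>1 p, minimax_level K \<Omega> \<phi>\<^sub>1 p) \<in> fucik_spectrum K \<Omega>"
proof -
  interpret fractional_setting s K \<Omega>
    by unfold_locales (use assms in \<open>auto simp: bounded_lipschitz_domain_def\<close>)
  show ?thesis by (rule fucik_from_minimax[OF assms(6,7)])
qed

end
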